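(* Let $f$ be a polynomial of degree $d\ge 2$ whose Julia set is disconnected, and let $\mathcal{K}_f$ be its filled-in Julia set. Then the first entry point into $\mathcal{K}_f$ of a Brownian path started at $\infty$ almost surely lies in $$\mathcal{K}_f^0=\{z\in\mathcal{K}_f:\ \text{the connected component of } \mathcal{K}_f \text{ containing } z \text{ is } \{z\}\}.$$ Equivalently, $\omega_f(\mathcal{K}_f^0)=1$, where $\omega_f$ is the harmonic measure of $\mathcal{K}_f$.
   Context: For a polynomial $f$ of degree $\ge 2$, $\mathcal{K}_f=\{z\in\mathbb{C}:\sup_n|f^n(z)|<\infty\}$ is the filled-in Julia set and $\mathcal{J}_f=\partial\mathcal{K}_f$ is the Julia set; $\mathcal{J}_f$ is disconnected if and only if $\mathcal{K}_f$ is. A Brownian path $Z(t)$ is a sample path of Brownian motion on the Riemann sphere started at the point at infinity. It almost surely enters $\mathcal{K}_f$ in finite time; with $t_0=\inf\{t: Z(t)\in\mathcal{K}_f\}$, the point $Z(t_0)$ is called the first entry point. The harmonic measure $\omega_f$ is the Borel probability measure on $\mathcal{K}_f$ for which $\omega_f(X)$ is the probability that the first entry point lies in $X$; it is the harmonic measure of $\mathcal{K}_f$ with pole at $\infty$ (equivalently, the equilibrium measure of $\mathcal{K}_f$). *)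

theory Defs
  imports "HOL-Probability.Probability" "HOL-Computational_Algebra.Polynomial"
begin

section \<open>Filled-in Julia sets\<close>

definition filled_julia :: "complex poly \<Rightarrow> complex set" where
  "filled_julia f = {z. bdd_above (range (\<lambda>n. norm ((poly f ^^ n) z)))}"

definition julia :: "complex poly \<Rightarrow> complex set" where
  "julia f = frontier (filled_julia f)"

definition point_components :: "complex set \<Rightarrow> complex set" where
  "point_components K = {z \<in> K. connected_component_set K z = {z}}"


section \<open>The Riemann sphere\<close>

text \<open>
  The Riemann sphere is the unit sphere of the Euclidean space \<^typ>\<open>complex \<times> real\<close>, with the
  point at infinity as its north pole. The plane is identified with the rest of the sphere by
  stereographic projection.
\<close>

definition sphere_infinity :: "complex \<times> real" where
  "sphere_infinity = (0, 1)"

definition to_sphere :: "complex \<Rightarrow> complex \<times> real" where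
  "to_sphere z = ((2 / ((norm z)\<^sup>2 + 1)) *\<^sub>R z, ((norm z)\<^sup>2 - 1) / ((norm z)\<^sup>2 + 1))"

definition from_sphere :: "complex \<times> real \<Rightarrow> complex" where
  "from_sphere p = fst p / of_real (1 - snd p)"

lemma to_sphere_in_sphere: "to_sphere z \<in> sphere 0 1 - {sphere_infinity}"
proof -
  have pos: "(norm z)\<^sup>2 + 1 > 0"
    by (simp add: add_nonneg_pos)
  have "(2 / ((norm z)\<^sup>2 + 1) * norm z)\<^sup>2 + (((norm z)\<^sup>2 - 1) / ((norm z)\<^sup>2 + 1))\<^sup>2
      = ((2 * norm z)\<^sup>2 + ((norm z)\<^sup>2 - 1)\<^sup>2) / ((norm z)\<^sup>2 + 1)\<^sup>2"
    by (simp add: power_mult_distrib power_divide add_divide_distrib)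
  also have "(2 * norm z)\<^sup>2 + ((norm z)\<^sup>2 - 1)\<^sup>2 = ((norm z)\<^sup>2 + 1)\<^sup>2"
    by (simp add: power2_eq_square algebra_simps)
  finally have "(2 / ((norm z)\<^sup>2 + 1) * norm z)\<^sup>2 + (((norm z)\<^sup>2 - 1) / ((norm z)\<^sup>2 + 1))\<^sup>2 = 1"
    using pos by simp
  moreover have "norm ((2 / ((norm z)\<^sup>2 + 1)) *\<^sub>R z) = 2 / ((norm z)\<^sup>2 + 1) * norm z"
    using pos by simp
  ultimately have "norm (to_sphere z) = 1"
    by (simp add: to_sphere_def norm_Pair power_divide)
  moreover have "to_sphere z \<noteq> sphere_infinity"
    using pos by (simp add: to_sphere_def sphere_infinity_def field_simps)
  ultimately show ?thesis by simp
qed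

lemma from_sphere_to_sphere: "from_sphere (to_sphere z) = z"
proof -
  have pos: "(norm z)\<^sup>2 + 1 > 0"
    by (simp add: add_nonneg_pos)
  have "1 - ((norm z)\<^sup>2 - 1) / ((norm z)\<^sup>2 + 1) = 2 / ((norm z)\<^sup>2 + 1)"
    using pos by (simp add: field_simps)
  with pos show ?thesis
    by (simp add: from_sphere_def to_sphere_def scaleR_conv_of_real del: of_real_add of_real_divide)
qed


section \<open>Brownian motion on the Riemann sphere\<close>

definition C2_on :: "'a::euclidean_space set \<Rightarrow> ('a \<Rightarrow> real) \<Rightarrow> bool" where
  "C2_on S \<phi> \<longleftrightarrow> (\<exists>(G :: 'a \<Rightarrow> 'a) (H :: 'a \<Rightarrow> 'a \<Rightarrow>\<^sub>L 'a).
     (\<forall>x\<in>S. (\<phi> has_derivative (\<lambda>h. G x \<bullet> h)) (at x)) \<and>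
     (\<forall>x\<in>S. (G has_derivative blinfun_apply (H x)) (at x)) \<and>
     continuous_on S H)"

definition laplacian :: "('a::euclidean_space \<Rightarrow> real) \<Rightarrow> 'a \<Rightarrow> real" where
  "laplacian \<phi> x = (\<Sum>b\<in>Basis. (deriv ^^ 2) (\<lambda>s. \<phi> (x + s *\<^sub>R b)) 0)"

text \<open>
  The Laplace-Beltrami operator of the round unit sphere is, at a point of the sphere, the
  Euclidean Laplacian of the extension that is constant along rays from the origin.
\<close>

definition sphere_laplacian :: "('a::euclidean_space \<Rightarrow> real) \<Rightarrow> 'a \<Rightarrow> real" where
  "sphere_laplacian \<phi> x = laplacian (\<lambda>y. \<phi> (y /\<^sub>R norm y)) x"

definition natural_filtration ::
    "'w measure \<Rightarrow> (real \<Rightarrow> 'w \<Rightarrow> 'a::topological_space) \<Rightarrow> real \<Rightarrow> 'w measure" where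
  "natural_filtration M Z t =
     sigma (space M) {Z u -` A \<inter> space M | u A. 0 \<le> u \<and> u \<le> t \<and> A \<in> sets borel}"

definition martingale ::
    "'w measure \<Rightarrow> (real \<Rightarrow> 'w measure) \<Rightarrow> (real \<Rightarrow> 'w \<Rightarrow> real) \<Rightarrow> bool" where
  "martingale M F X \<longleftrightarrow>
     (\<forall>t\<ge>0. X t \<in> borel_measurable (F t) \<and> integrable M (X t)) \<and>
     (\<forall>s t. 0 \<le> s \<and> s \<le> t \<longrightarrow> (AE w in M. real_cond_exp M (F s) (X t) w = X s w))"

text \<open>
  Brownian motion on the sphere is the continuous process generated by half the Laplace-Beltrami
  operator, characterised by the martingale problem for this operator. The test functions are the
  twice continuously differentiable functions on the sphere, each given by some extension to the
  punctured space; only the values on the sphere enter.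
\<close>

definition brownian_motion_from_infinity ::
    "'w measure \<Rightarrow> (real \<Rightarrow> 'w \<Rightarrow> complex \<times> real) \<Rightarrow> bool" where
  "brownian_motion_from_infinity M Z \<longleftrightarrow>
     prob_space M \<and>
     (\<forall>t\<ge>0. Z t \<in> borel_measurable M) \<and>
     (\<forall>w\<in>space M. \<forall>t\<ge>0. Z t w \<in> sphere 0 1) \<and>
     (\<forall>w\<in>space M. continuous_on {0..} (\<lambda>t. Z t w)) \<and>
     (\<forall>w\<in>space M. Z 0 w = sphere_infinity) \<and>
     (\<forall>\<phi>. C2_on (- {0}) \<phi> \<longrightarrow>
        martingale M (natural_filtration M Z)
          (\<lambda>t w. \<phi> (Z t w) - \<phi> (Z 0 w)
                 - integral {0..t} (\<lambda>u. sphere_laplacian \<phi> (Z u w) / 2)))"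


section \<open>First entry and harmonic measure\<close>

definition enters :: "(real \<Rightarrow> 'w \<Rightarrow> complex \<times> real) \<Rightarrow> complex set \<Rightarrow> 'w \<Rightarrow> bool" where
  "enters Z K w \<longleftrightarrow> (\<exists>t\<ge>0. Z t w \<in> to_sphere ` K)"

text \<open>The following two functions are meaningful only for paths that enter \<open>K\<close>.\<close>

definition first_entry_time ::
    "(real \<Rightarrow> 'w \<Rightarrow> complex \<times> real) \<Rightarrow> complex set \<Rightarrow> 'w \<Rightarrow> real" where
  "first_entry_time Z K w = Inf {t. 0 \<le> t \<and> Z t w \<in> to_sphere ` K}"

definition first_entry_point ::
    "(real \<Rightarrow> 'w \<Rightarrow> complex \<times> real) \<Rightarrow> complex set \<Rightarrow> 'w \<Rightarrow> complex" where
  "first_entry_point Z K w = from_sphere (Z (first_entry_time Z K w) w)"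

text \<open>
  The harmonic measure of \<open>K\<close> with pole at infinity: the mass of \<open>X\<close> is the probability that the
  path enters \<open>K\<close> and its first entry point lies in \<open>X\<close>. The law of the Brownian path is unique,
  so the measure does not depend on the choice of \<open>M\<close> and \<open>Z\<close>.
\<close>

definition harmonic_measure ::
    "'w measure \<Rightarrow> (real \<Rightarrow> 'w \<Rightarrow> complex \<times> real) \<Rightarrow> complex set \<Rightarrow> complex measure" where
  "harmonic_measure M Z K =
     distr (restrict_space M {w \<in> space M. enters Z K w}) borel (first_entry_point Z K)"

end

theory Submission
  imports Defs "HOL-Complex_Analysis.Complex_Analysis"
    "HOL-Computational_Algebra.Fundamental_Theorem_Algebra"
begin

text \<open>
  The functions \<open>ln ((\<bar>z - v\<bar>\<^sup>2 + e) / (1 + \<bar>z\<bar>\<^sup>2)) / 2\<close> are smooth on the whole sphere and have an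
  explicit Laplacian. Stopping the corresponding martingales shows that the path hits the filled
  Julia set \<open>K\<close> almost surely and that its entry point \<open>X\<close> satisfies \<open>E (ln \<bar>X - v\<bar>) \<ge> - \<gamma>\<close> for all
  \<open>v\<close> outside \<open>K\<close>, where \<open>- \<gamma>\<close> is the logarithm of the capacity of \<open>K\<close>. By the minimum principle the
  potential of \<open>X\<close> is then close, outside \<open>K\<close>, to that of the uniform distribution on the \<open>d ^ n\<close>
  preimages of a generic point under \<open>f ^ n\<close>. Splitting the Cauchy transforms and applying
  Liouville's theorem, the mass that \<open>X\<close> gives to a clopen part of \<open>K\<close> is at most an upper bound for
  the proportion of preimages near that part.

  As \<open>K\<close> is disconnected, a component of \<open>{\<bar>f ^ n\<bar> < R}\<close> contains only \<open>O ((d - 1) ^ n)\<close> of these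
  preimages, so the components containing critical points have summable mass. Hence, almost surely,
  there is an \<open>s\<close> such that \<open>f ^ (n - s)\<close> is injective on the component \<open>P n\<close> of \<open>{\<bar>f ^ n\<bar> < R}\<close>
  around \<open>X\<close> for infinitely many \<open>n\<close>. A limit of the inverse branches is constant by Hurwitz'
  theorem, because \<open>X\<close> is a limit of points outside \<open>K\<close>, and therefore the sets \<open>P n \<inter> K\<close> shrink to
  \<open>X\<close> along a subsequence.
\<close>

section \<open>Logarithms of the chordal distance\<close>

text \<open>The martingale problem accepts only test functions that are twice differentiable on the
  whole sphere, which is why the pole at \<open>v\<close> is rounded off by \<open>e\<close>. The
  rounding leaves a nonnegative source term in the Laplacian, so stopping gives inequalities; beside
  it stands a constant that is the same for every pole. Comparing a pole outside \<open>K\<close>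
  with the average over preimages therefore cancels the expected stopping time, and only \<gamma>
  survives. The result is a lower bound for the potential of \<open>X\<close>. It suffices because
  potentials of probability measures agree at infinity: a harmonic function that vanishes there and
  is at least - \<eta> is small near infinity. Disconnectedness enters through a count: once
  \<open>U (Suc N0)\<close> falls apart over the connected \<open>U N0\<close>, every point of
  \<open>U N0\<close> has a preimage in another part, so at each later level a component loses one
  of the d choices. The resulting bound on the probability that \<open>F j X\<close> lies in a
  component with a critical point does not depend on \<open>j\<close>; summed along an orbit segment
  it is a tail of a convergent series, whatever the length of the segment. Hence \<open>s\<close>
  stays fixed while \<open>n\<close> grows.\<close>

text \<open>
  On the sphere this is \<open>(\<bar>z - w\<bar>\<^sup>2 + e) / (1 + \<bar>z\<bar>\<^sup>2)\<close>, which is an affine function of the point of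
  the ambient space.
\<close>

definition chordal_form :: "complex \<Rightarrow> real \<Rightarrow> complex \<times> real \<Rightarrow> real" where
  "chordal_form w e y =
     (1 + (norm w)\<^sup>2 + e) / 2 + ((- w, (1 - (norm w)\<^sup>2 - e) / 2) \<bullet> y)"

lemma chordal_form_infinity: "chordal_form w e sphere_infinity = 1"
  by (simp add: chordal_form_def sphere_infinity_def inner_prod_def field_simps)

lemma chordal_form_to_sphere:
  "chordal_form w e (to_sphere z) = ((norm (z - w))\<^sup>2 + e) / (1 + (norm z)\<^sup>2)"
proof -
  have pos: "1 + (norm z)\<^sup>2 > 0" "1 + (norm z)\<^sup>2 \<noteq> 0" "(norm z)\<^sup>2 + 1 \<noteq> 0"
    by (simp_all add: add_pos_nonneg add_nonneg_pos order_less_imp_not_eq2)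
  have "(norm (z - w))\<^sup>2 = (norm z)\<^sup>2 - 2 * (w \<bullet> z) + (norm w)\<^sup>2"
    by (simp add: power2_norm_eq_inner inner_diff_left inner_diff_right inner_commute)
  then show ?thesis
    using pos by (simp add: chordal_form_def to_sphere_def inner_prod_def divide_simps) (simp add: algebra_simps)
qed

lemma to_sphere_surj:
  assumes "y \<in> sphere 0 1" "y \<noteq> sphere_infinity"
  shows "to_sphere (from_sphere y) = y"
proof -
  obtain x s where y: "y = (x, s)" by force
  have n: "(norm x)\<^sup>2 + s\<^sup>2 = 1"
    using assms by (simp add: y norm_Pair)
  then have s: "s \<noteq> 1" using assms by (auto simp: y sphere_infinity_def)
  have s1: "s < 1"
  proof -
    have "s\<^sup>2 \<le> 1" using n by (smt (verit) zero_le_power2)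
    then have "s \<le> 1" by (simp add: abs_square_le_1)
    with s show ?thesis by simp
  qed
  have nz: "(norm (from_sphere y))\<^sup>2 = (1 + s) / (1 - s)"
  proof -
    have "(norm (from_sphere y))\<^sup>2 = (norm x)\<^sup>2 / (1 - s)\<^sup>2"
      using s1 by (simp add: from_sphere_def y norm_divide power_divide del: of_real_diff)
    also have "(norm x)\<^sup>2 = (1 - s) * (1 + s)"
      using n by (simp add: algebra_simps power2_eq_square)
    finally show ?thesis using s1 by (simp add: power2_eq_square)
  qed
  have a: "(norm (from_sphere y))\<^sup>2 + 1 = 2 / (1 - s)"
    unfolding nz using s1 by (simp add: field_simps)
  have b: "(norm (from_sphere y))\<^sup>2 - 1 = 2 * s / (1 - s)"
    unfolding nz using s1 by (simp add: field_simps)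
  show ?thesis
    unfolding to_sphere_def a b using s1
    by (simp add: y from_sphere_def scaleR_conv_of_real)
qed

lemma continuous_on_chordal_form: "continuous_on S (chordal_form w e)"
  unfolding chordal_form_def by (intro continuous_intros)

lemma continuous_on_to_sphere: "continuous_on S to_sphere"
  unfolding to_sphere_def
  by (intro continuous_intros) (auto simp: add_nonneg_pos order_less_imp_not_eq2)

lemma continuous_on_from_sphere:
  "continuous_on (sphere 0 1 - {sphere_infinity}) from_sphere"
proof -
  have "1 - snd y \<noteq> 0" if "y \<in> sphere 0 1 - {sphere_infinity}" for y :: "complex \<times> real"
    using that by (cases y) (auto simp: sphere_infinity_def norm_Pair)
  then show ?thesis
    unfolding from_sphere_def
    by (intro continuous_intros) (auto simp del: of_real_diff)
qed

lemma chordal_form_pos: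
  assumes "e > 0" "y \<in> sphere 0 1"
  shows "chordal_form w e y > 0"
proof (cases "y = sphere_infinity")
  case True then show ?thesis by (simp add: chordal_form_infinity)
next
  case False
  have "(norm (from_sphere y - w))\<^sup>2 + e > 0"
    using assms by (simp add: add_nonneg_pos)
  moreover have "1 + (norm (from_sphere y))\<^sup>2 > 0" by (simp add: add_pos_nonneg)
  ultimately show ?thesis
    using chordal_form_to_sphere[of w e "from_sphere y"] to_sphere_surj[OF assms(2) False] by simp
qed

text \<open>Extended constantly along rays, since test functions live on the punctured space.
  Multiplying the argument of the logarithm by \<open>norm y\<close> turns it into
  \<open>\<alpha> * norm y + l \<bullet> y\<close>, whose derivatives are explicit.\<close>

definition log_chordal :: "complex \<Rightarrow> real \<Rightarrow> complex \<times> real \<Rightarrow> real" where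
  "log_chordal w e y = ln (chordal_form w e (y /\<^sub>R norm y)) / 2"

lemma chordal_form_scaled:
  assumes "y \<noteq> 0"
  shows "norm y * chordal_form w e (y /\<^sub>R norm y) =
    (1 + (norm w)\<^sup>2 + e) / 2 * norm y + ((- w, (1 - (norm w)\<^sup>2 - e) / 2) \<bullet> y)"
  using assms by (simp add: chordal_form_def field_simps inner_scaleR_right)

lemma log_chordal_sphere: "y \<in> sphere 0 1 \<Longrightarrow> log_chordal w e y = ln (chordal_form w e y) / 2"
  by (simp add: log_chordal_def)

text \<open>Links \<open>laplacian\<close>, which iterates \<open>deriv\<close> along coordinate
  lines, to the trace of the Hessian. The gradient is required on a neighbourhood because the inner
  \<open>deriv\<close> is evaluated near 0, not only at 0.\<close>

lemma second_directional_derivative: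
  fixes \<phi> :: "'a::euclidean_space \<Rightarrow> real"
  assumes "open S" "x \<in> S"
    and G: "\<And>y. y \<in> S \<Longrightarrow> (\<phi> has_derivative (\<lambda>h. G y \<bullet> h)) (at y)"
    and H: "(G has_derivative blinfun_apply H) (at x)"
  shows "(deriv ^^ 2) (\<lambda>s. \<phi> (x + s *\<^sub>R b)) 0 = H b \<bullet> b"
proof -
  have line: "((\<lambda>s. x + s *\<^sub>R b) has_derivative (\<lambda>h. h *\<^sub>R b)) (at s)" for s
    by (auto intro!: derivative_eq_intros)
  have 1: "deriv (\<lambda>s. \<phi> (x + s *\<^sub>R b)) s = G (x + s *\<^sub>R b) \<bullet> b" if "x + s *\<^sub>R b \<in> S" for s
  proof (rule DERIV_imp_deriv)
    show "((\<lambda>s. \<phi> (x + s *\<^sub>R b)) has_real_derivative G (x + s *\<^sub>R b) \<bullet> b) (at s)"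
      using has_derivative_compose[OF line G[OF that]]
      by (simp add: has_field_derivative_def mult.commute[of _ "_ \<bullet> _"])
  qed
  have "open ((\<lambda>s. x + s *\<^sub>R b) -` S)"
    using \<open>open S\<close> by (intro open_vimage continuous_intros)
  then have "eventually (\<lambda>s. s \<in> (\<lambda>s. x + s *\<^sub>R b) -` S) (nhds 0)"
    using \<open>x \<in> S\<close> by (intro eventually_nhds_in_open) auto
  then have ev: "eventually (\<lambda>s. deriv (\<lambda>s. \<phi> (x + s *\<^sub>R b)) s = G (x + s *\<^sub>R b) \<bullet> b) (nhds 0)"
    by eventually_elim (simp add: 1)
  have "((\<lambda>s. G (x + s *\<^sub>R b)) has_derivative (\<lambda>h. blinfun_apply H (h *\<^sub>R b))) (at 0)"
    using has_derivative_compose[OF line, of G "blinfun_apply H" 0] H by simp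
  from has_derivative_inner_left[OF this, of b]
  have "((\<lambda>s. G (x + s *\<^sub>R b) \<bullet> b) has_real_derivative H b \<bullet> b) (at 0)"
    by (simp add: has_field_derivative_def blinfun.scaleR_right mult.commute[of _ "_ \<bullet> _"])
  then have "deriv (deriv (\<lambda>s. \<phi> (x + s *\<^sub>R b))) 0 = H b \<bullet> b"
    by (subst deriv_cong_ev[OF ev refl]) (rule DERIV_imp_deriv)
  then show ?thesis by (simp add: numeral_2_eq_2)
qed

text \<open>Positivity away from the origin keeps the logarithm smooth. With gradient
  \<open>G\<close> and Hessian \<open>H\<close> the Laplacian is the trace of \<open>H\<close>; the
  summand with \<open>DIM('a) - 2\<close> is the Laplacian of \<open>ln (norm y)\<close> on the unit
  sphere. Both conclusions are proved together because they share \<open>G\<close> and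
  \<open>H\<close>.\<close>

lemma C2_on_ln_affine_aux:
  fixes l :: "'a::euclidean_space"
  assumes pos: "\<And>y. y \<noteq> 0 \<Longrightarrow> \<alpha> * norm y + l \<bullet> y > 0"
  shows "C2_on (- {0}) (\<lambda>y. (ln (\<alpha> * norm y + l \<bullet> y) - ln (norm y)) / 2) \<and>
    (\<forall>x. norm x = 1 \<longrightarrow> laplacian (\<lambda>y. (ln (\<alpha> * norm y + l \<bullet> y) - ln (norm y)) / 2) x =
      ((real DIM('a) - 1) * \<alpha> / (\<alpha> + l \<bullet> x)
        - (\<alpha>\<^sup>2 + 2 * \<alpha> * (l \<bullet> x) + l \<bullet> l) / (\<alpha> + l \<bullet> x)\<^sup>2 - (real DIM('a) - 2)) / 2)"
proof -
  define N where "N y = \<alpha> * norm y + l \<bullet> y" for y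
  define V where "V y = (\<alpha> / norm y) *\<^sub>R y + l" for y
  define G where "G y = (1/2) *\<^sub>R ((1 / N y) *\<^sub>R V y - (1 / (norm y)\<^sup>2) *\<^sub>R y)" for y
  \<comment> \<open>The rank one map sending \<open>h\<close> to
    \<open>(a \<bullet> h) *\<^sub>R b\<close>, composed from two standard bounded linear functions
    so that its continuity in \<open>a\<close> and \<open>b\<close> is immediate.\<close>
  define outer :: "'a \<Rightarrow> 'a \<Rightarrow> 'a \<Rightarrow>\<^sub>L 'a" where
    "outer a b = blinfun_scaleR_left b o\<^sub>L blinfun_inner_left a" for a b
  \<comment> \<open>The derivative of \<open>V\<close>, that is, \<alpha> times the Hessian of the
    norm.\<close>
  define DV :: "'a \<Rightarrow> 'a \<Rightarrow>\<^sub>L 'a" where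
    "DV y = (\<alpha> / norm y) *\<^sub>R id_blinfun - (\<alpha> / (norm y)^3) *\<^sub>R outer y y" for y
  define H :: "'a \<Rightarrow> 'a \<Rightarrow>\<^sub>L 'a" where
    "H y = (1/2) *\<^sub>R ((1 / N y) *\<^sub>R DV y - (1 / (N y)\<^sup>2) *\<^sub>R outer (V y) (V y)
             - ((1 / (norm y)\<^sup>2) *\<^sub>R id_blinfun - (2 / (norm y)^4) *\<^sub>R outer y y))" for y
  have outer_apply: "blinfun_apply (outer a b) h = (a \<bullet> h) *\<^sub>R b" for a b h
    by (simp add: outer_def inner_commute)
  have Npos: "N y > 0" if "y \<noteq> 0" for y using pos[OF that] by (simp add: N_def)
  have dn: "(norm has_derivative (\<lambda>h. (y \<bullet> h) / norm y)) (at y)" if "y \<noteq> 0" for y :: 'a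
    using has_derivative_norm[OF that]
    by (simp add: sgn_div_norm inner_commute divide_inverse mult.commute)
  have dN: "(N has_derivative (\<lambda>h. V y \<bullet> h)) (at y)" if "y \<noteq> 0" for y
    unfolding N_def V_def
    by (rule derivative_eq_intros dn[OF that] refl | simp add: inner_add_left)+
  have du: "((\<lambda>y. 1 / N y) has_derivative (\<lambda>h. - (1 / (N y)\<^sup>2) * (V y \<bullet> h))) (at y)" if "y \<noteq> 0" for y
    using Deriv.has_derivative_inverse[OF _ dN[OF that]] Npos[OF that]
    by (simp add: inverse_eq_divide power2_eq_square mult_ac)
  have dr: "((\<lambda>y. \<alpha> / norm y) has_derivative (\<lambda>h. - (\<alpha> / (norm y)^3) * (y \<bullet> h))) (at y)" if "y \<noteq> 0" for y :: 'a
    using has_derivative_mult_right[OF Deriv.has_derivative_inverse[OF _ dn[OF that]], of \<alpha>] that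
    by (simp add: inverse_eq_divide power3_eq_cube mult_ac)
  have dv: "((\<lambda>y. 1 / (norm y)\<^sup>2) has_derivative (\<lambda>h. - (2 / (norm y)^4) * (y \<bullet> h))) (at y)" if "y \<noteq> 0" for y :: 'a
    using has_derivative_power[OF Deriv.has_derivative_inverse[OF _ dn[OF that]], of 2] that
    by (simp add: inverse_eq_divide power4_eq_xxxx power2_eq_square mult_ac)
  have dV: "(V has_derivative blinfun_apply (DV y)) (at y)" if "y \<noteq> 0" for y
  proof -
    have "(V has_derivative (\<lambda>h. ((\<alpha> / norm y) *\<^sub>R h + (- (\<alpha> / (norm y)^3) * (y \<bullet> h)) *\<^sub>R y) + 0)) (at y)"
      unfolding V_def
      by (rule has_derivative_add has_derivative_scaleR has_derivative_ident has_derivative_const dr[OF that])+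
    moreover have "(\<lambda>h. ((\<alpha> / norm y) *\<^sub>R h + (- (\<alpha> / (norm y)^3) * (y \<bullet> h)) *\<^sub>R y) + 0) = blinfun_apply (DV y)"
      by (rule ext) (simp add: DV_def blinfun.diff_left blinfun.scaleR_left outer_apply)
    ultimately show ?thesis by simp
  qed
  have dL: "((\<lambda>y. ln (N y)) has_derivative (\<lambda>h. (V y \<bullet> h) * (1 / N y))) (at y)" if "y \<noteq> 0" for y
    using DERIV_compose_FDERIV[OF DERIV_ln_divide[OF Npos[OF that]] dN[OF that]] .
  have dLn: "((\<lambda>y. ln (norm y)) has_derivative (\<lambda>h. ((y \<bullet> h) / norm y) * (1 / norm y))) (at y)" if "y \<noteq> 0" for y :: 'a
    using that by (intro DERIV_compose_FDERIV[OF DERIV_ln_divide dn]) auto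
  have 1: "((\<lambda>y. (ln (\<alpha> * norm y + l \<bullet> y) - ln (norm y)) / 2) has_derivative (\<lambda>h. G y \<bullet> h)) (at y)"
    if "y \<noteq> 0" for y
  proof -
    have "((\<lambda>y. (1/2) * (ln (N y) - ln (norm y))) has_derivative
        (\<lambda>h. (1/2) * ((V y \<bullet> h) * (1 / N y) - ((y \<bullet> h) / norm y) * (1 / norm y)))) (at y)"
      by (intro has_derivative_mult_right has_derivative_diff dL dLn that)
    moreover have "(\<lambda>h. (1/2) * ((V y \<bullet> h) * (1 / N y) - ((y \<bullet> h) / norm y) * (1 / norm y))) = (\<lambda>h. G y \<bullet> h)"
      by (rule ext) (simp add: G_def inner_diff_left power2_eq_square)
    ultimately show ?thesis by (simp add: N_def)
  qed
  have 2: "(G has_derivative blinfun_apply (H y)) (at y)" if "y \<noteq> 0" for y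
  proof -
    have "(G has_derivative (\<lambda>h. (1/2) *\<^sub>R (((1 / N y) *\<^sub>R blinfun_apply (DV y) h + (- (1 / (N y)\<^sup>2) * (V y \<bullet> h)) *\<^sub>R V y)
        - ((1 / (norm y)\<^sup>2) *\<^sub>R h + (- (2 / (norm y)^4) * (y \<bullet> h)) *\<^sub>R y)))) (at y)" (is "(G has_derivative ?D) _")
      unfolding G_def
      by (intro has_derivative_scaleR_right has_derivative_diff has_derivative_scaleR has_derivative_ident du dv dV that)
    moreover have "?D = blinfun_apply (H y)"
      by (rule ext) (simp add: H_def blinfun.diff_left blinfun.scaleR_left outer_apply)
    ultimately show ?thesis by simp
  qed
  have "continuous_on (-{0}) H"
    unfolding H_def DV_def outer_def N_def V_def
    by (intro continuous_intros) (auto dest: Npos simp: N_def)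
  then have C2: "C2_on (- {0}) (\<lambda>y. (ln (\<alpha> * norm y + l \<bullet> y) - ln (norm y)) / 2)"
    unfolding C2_on_def using 1 2 by (intro exI[of _ G] exI[of _ H]) auto
  have "laplacian (\<lambda>y. (ln (\<alpha> * norm y + l \<bullet> y) - ln (norm y)) / 2) x =
      ((real DIM('a) - 1) * \<alpha> / (\<alpha> + l \<bullet> x)
        - (\<alpha>\<^sup>2 + 2 * \<alpha> * (l \<bullet> x) + l \<bullet> l) / (\<alpha> + l \<bullet> x)\<^sup>2 - (real DIM('a) - 2)) / 2"
    if x: "norm x = 1" for x
  proof -
    have "x \<noteq> 0" using x by auto
    have trace_outer: "(\<Sum>b\<in>Basis. outer a a b \<bullet> b) = a \<bullet> a" for a :: 'a
      by (simp add: outer_apply euclidean_inner[of a a])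
    have "laplacian (\<lambda>y. (ln (\<alpha> * norm y + l \<bullet> y) - ln (norm y)) / 2) x = (\<Sum>b\<in>Basis. H x b \<bullet> b)"
      unfolding laplacian_def
      by (intro sum.cong refl second_directional_derivative[of "-{0}" _ _ G] 1 2) (use \<open>x \<noteq> 0\<close> in auto)
    also have "\<dots> = (1/2) * ((1 / N x) * (\<Sum>b\<in>Basis. DV x b \<bullet> b) - (1 / (N x)\<^sup>2) * (V x \<bullet> V x)
        - (real DIM('a) - 2))"
      unfolding H_def
      by (simp add: blinfun.diff_left blinfun.scaleR_left inner_diff_left x
          sum_subtractf sum_distrib_left[symmetric] trace_outer inner_Basis power2_norm_eq_inner[symmetric]
          sum_divide_distrib[symmetric])
    also have "(\<Sum>b\<in>Basis. DV x b \<bullet> b) = (real DIM('a) - 1) * \<alpha>"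
      by (simp add: DV_def blinfun.diff_left blinfun.scaleR_left inner_diff_left x
          sum_subtractf sum_distrib_left[symmetric] trace_outer power2_norm_eq_inner[symmetric] algebra_simps)
    also have "V x \<bullet> V x = \<alpha>\<^sup>2 + 2 * \<alpha> * (l \<bullet> x) + l \<bullet> l"
      unfolding V_def x using x[unfolded norm_eq_1]
      by (simp add: inner_add_left inner_add_right power2_eq_square inner_commute)
    finally show ?thesis by (simp add: N_def x)
  qed
  with C2 show ?thesis by blast
qed

lemmas C2_on_ln_affine = C2_on_ln_affine_aux[THEN conjunct1]
  and laplacian_ln_affine = C2_on_ln_affine_aux[THEN conjunct2, rule_format]

lemma log_chordal_eq:
  assumes "e > 0" "y \<noteq> 0"
  shows "(1 + (norm w)\<^sup>2 + e) / 2 * norm y + ((- w, (1 - (norm w)\<^sup>2 - e) / 2) \<bullet> y) > 0" (is "?N > 0")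
    and "log_chordal w e y =
      (ln ((1 + (norm w)\<^sup>2 + e) / 2 * norm y + ((- w, (1 - (norm w)\<^sup>2 - e) / 2) \<bullet> y)) - ln (norm y)) / 2"
proof -
  have pos: "chordal_form w e (y /\<^sub>R norm y) > 0"
    using assms by (intro chordal_form_pos) auto
  with assms show "?N > 0"
    unfolding chordal_form_scaled[OF \<open>y \<noteq> 0\<close>, symmetric] by simp
  show "log_chordal w e y = (ln ?N - ln (norm y)) / 2"
    unfolding chordal_form_scaled[OF \<open>y \<noteq> 0\<close>, symmetric] log_chordal_def
    using pos assms by (simp add: ln_mult)
qed

lemma C2_on_cong:
  assumes "open S" "\<And>x. x \<in> S \<Longrightarrow> \<phi> x = \<psi> x"
  shows "C2_on S \<phi> \<longleftrightarrow> C2_on S \<psi>"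
proof -
  have "(\<phi> has_derivative D) (at x) \<longleftrightarrow> (\<psi> has_derivative D) (at x)" if "x \<in> S" for D x
    using assms that has_derivative_transform_within_open[of _ _ x UNIV S] by metis
  then show ?thesis unfolding C2_on_def by auto
qed

lemma C2_on_log_chordal:
  assumes "e > 0"
  shows "C2_on (- {0}) (log_chordal w e)"
proof -
  have "C2_on (- {0}) (log_chordal w e) \<longleftrightarrow> C2_on (- {0}) (\<lambda>y.
      (ln ((1 + (norm w)\<^sup>2 + e) / 2 * norm y + ((- w, (1 - (norm w)\<^sup>2 - e) / 2) \<bullet> y)) - ln (norm y)) / 2)"
    using log_chordal_eq(2)[OF assms] by (intro C2_on_cong) auto
  then show ?thesis
    using C2_on_ln_affine[OF log_chordal_eq(1)[OF assms]] by blast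
qed

text \<open>The coefficients satisfy \<open>\<alpha>\<^sup>2 - l \<bullet> l = e\<close>, so the
  numerator of the quadratic term is \<open>2 * \<alpha> * (\<alpha> + l \<bullet> y) - e\<close>,
  and in dimension 3 the terms with \<alpha> cancel. What is left is a positive source that
  concentrates at \<open>w\<close> as \<open>e\<close> tends to 0, and the constant that balances it
  on the closed sphere.\<close>

lemma sphere_laplacian_log_chordal:
  assumes "e > 0" "y \<in> sphere 0 1"
  shows "sphere_laplacian (log_chordal w e) y = (e / (chordal_form w e y)\<^sup>2 - 1) / 2"
proof -
  define \<alpha> where "\<alpha> = (1 + (norm w)\<^sup>2 + e) / 2"
  define l where "l = (- w, (1 - (norm w)\<^sup>2 - e) / 2)"
  have y: "norm y = 1" using assms by simp
  have fun_eq: "log_chordal w e (x /\<^sub>R norm x) = (ln (\<alpha> * norm x + l \<bullet> x) - ln (norm x)) / 2" if "x \<noteq> 0" for x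
    using log_chordal_eq(2)[OF assms(1) that, of w] that
    unfolding \<alpha>_def l_def log_chordal_def by simp
  have "laplacian (\<lambda>x. log_chordal w e (x /\<^sub>R norm x)) y = laplacian (\<lambda>x. (ln (\<alpha> * norm x + l \<bullet> x) - ln (norm x)) / 2) y"
    unfolding laplacian_def
  proof (intro sum.cong refl)
    fix b :: "complex \<times> real"
    have "open ((\<lambda>s. y + s *\<^sub>R b) -` (- {0}))"
      by (intro open_vimage continuous_intros)
    then have "eventually (\<lambda>s. s \<in> (\<lambda>s. y + s *\<^sub>R b) -` (- {0})) (nhds 0)"
      using y by (intro eventually_nhds_in_open) auto
    then have ev: "eventually (\<lambda>s. log_chordal w e ((y + s *\<^sub>R b) /\<^sub>R norm (y + s *\<^sub>R b)) =
        (ln (\<alpha> * norm (y + s *\<^sub>R b) + l \<bullet> (y + s *\<^sub>R b)) - ln (norm (y + s *\<^sub>R b))) / 2) (nhds 0)"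
      by eventually_elim (use fun_eq in blast)
    show "(deriv ^^ 2) (\<lambda>s. log_chordal w e ((y + s *\<^sub>R b) /\<^sub>R norm (y + s *\<^sub>R b))) 0 =
        (deriv ^^ 2) (\<lambda>s. (ln (\<alpha> * norm (y + s *\<^sub>R b) + l \<bullet> (y + s *\<^sub>R b)) - ln (norm (y + s *\<^sub>R b))) / 2) 0"
      by (rule higher_deriv_cong_ev[OF ev refl])
  qed
  also have "\<dots> = ((real DIM(complex \<times> real) - 1) * \<alpha> / (\<alpha> + l \<bullet> y)
        - (\<alpha>\<^sup>2 + 2 * \<alpha> * (l \<bullet> y) + l \<bullet> l) / (\<alpha> + l \<bullet> y)\<^sup>2 - (real DIM(complex \<times> real) - 2)) / 2"
    using log_chordal_eq(1)[OF assms(1)]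
    by (intro laplacian_ln_affine y) (simp add: \<alpha>_def l_def)
  also have "\<dots> = (e / (\<alpha> + l \<bullet> y)\<^sup>2 - 1) / 2"
  proof -
    have pos: "\<alpha> + l \<bullet> y > 0"
      using chordal_form_pos[OF assms, of w] by (simp add: chordal_form_def \<alpha>_def l_def)
    have "\<alpha>\<^sup>2 - l \<bullet> l = e"
    proof -
      have "l \<bullet> l = (norm w)\<^sup>2 + ((1 - (norm w)\<^sup>2 - e) / 2)\<^sup>2"
        using power2_norm_eq_inner[of w] by (simp add: l_def inner_prod_def power2_eq_square)
      then show ?thesis by (simp add: \<alpha>_def power2_eq_square field_simps)
    qed
    then have "\<alpha>\<^sup>2 + 2 * \<alpha> * (l \<bullet> y) + l \<bullet> l = 2 * \<alpha> * (\<alpha> + l \<bullet> y) - e"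
      by (simp add: power2_eq_square algebra_simps)
    moreover have "(2 * \<alpha> * (\<alpha> + l \<bullet> y) - e) / (\<alpha> + l \<bullet> y)\<^sup>2 = 2 * \<alpha> / (\<alpha> + l \<bullet> y) - e / (\<alpha> + l \<bullet> y)\<^sup>2"
      using pos by (simp add: diff_divide_distrib power2_eq_square)
    ultimately show ?thesis by simp
  qed
  finally show ?thesis
    by (simp add: sphere_laplacian_def chordal_form_def \<alpha>_def l_def)
qed

section \<open>Optional stopping\<close>

lemma subalgebra_natural_filtration:
  assumes "\<And>t. t \<ge> 0 \<Longrightarrow> Z t \<in> borel_measurable M"
  shows "subalgebra M (natural_filtration M Z t)"
proof -
  let ?G = "{Z u -` A \<inter> space M | u A. 0 \<le> u \<and> u \<le> t \<and> A \<in> sets borel}"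
  have sub: "?G \<subseteq> sets M"
    using assms by (auto intro!: measurable_sets)
  then have "?G \<subseteq> Pow (space M)"
    using sets.space_closed by blast
  then show ?thesis
    unfolding subalgebra_def natural_filtration_def
    by (simp add: space_measure_of_conv sets_measure_of sets.sigma_sets_subset[OF sub])
qed

lemma measurable_natural_filtration:
  assumes "0 \<le> u" "u \<le> t"
  shows "Z u \<in> borel_measurable (natural_filtration M Z t)"
proof (rule measurableI)
  let ?G = "{Z u -` A \<inter> space M | u A. 0 \<le> u \<and> u \<le> t \<and> A \<in> sets borel}"
  have G: "?G \<subseteq> Pow (space M)" by auto
  fix A :: "'b set" assume "A \<in> sets borel"
  then have "Z u -` A \<inter> space M \<in> sigma_sets (space M) ?G"
    using assms by (intro sigma_sets.Basic) auto
  then show "Z u -` A \<inter> space (natural_filtration M Z t) \<in> sets (natural_filtration M Z t)"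
    unfolding natural_filtration_def using G
    by (simp add: space_measure_of_conv sets_measure_of)
qed auto

lemma space_natural_filtration: "space (natural_filtration M Z t) = space M"
  by (simp add: natural_filtration_def space_measure_of_conv)

text \<open>The martingale property in the form used by discretised stopping: an increment after
  time \<open>s\<close> has mean zero on every event known at time \<open>s\<close>.\<close>

lemma martingale_increment_integral:
  assumes "prob_space M" and Z: "\<And>t. t \<ge> 0 \<Longrightarrow> Z t \<in> borel_measurable M"
    and mart: "martingale M (natural_filtration M Z) X"
    and st: "0 \<le> s" "s \<le> t" and A: "A \<in> sets (natural_filtration M Z s)"
  shows "integrable M (\<lambda>w. indicator A w * (X t w - X s w))"
    and "(\<integral>w. indicator A w * (X t w - X s w) \<partial>M) = 0"
proof -
  interpret prob_space M by fact
  interpret finite_measure_subalgebra M "natural_filtration M Z s"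
    by unfold_locales (rule subalgebra_natural_filtration[OF Z])
  have int: "integrable M (X t)" "integrable M (X s)"
    using mart st unfolding martingale_def by auto
  have AM: "A \<in> sets M"
    using A subalgebra_natural_filtration[of Z M s, OF Z] by (auto simp: subalgebra_def)
  have i1: "integrable M (\<lambda>w. indicator A w * X t w)" "integrable M (\<lambda>w. indicator A w * X s w)"
    using integrable_mult_indicator[OF AM int(1)] integrable_mult_indicator[OF AM int(2)] by auto
  then show "integrable M (\<lambda>w. indicator A w * (X t w - X s w))"
    by (simp add: right_diff_distrib)
  have "(\<integral>w\<in>A. X t w \<partial>M) = (\<integral>w\<in>A. real_cond_exp M (natural_filtration M Z s) (X t) w \<partial>M)"
    by (rule real_cond_exp_intA[OF int(1) A])
  also have "\<dots> = (\<integral>w\<in>A. X s w \<partial>M)"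
  proof (rule set_lebesgue_integral_cong_AE)
    show "AE w\<in>A in M. real_cond_exp M (natural_filtration M Z s) (X t) w = X s w"
    proof -
      have "AE w in M. real_cond_exp M (natural_filtration M Z s) (X t) w = X s w"
        using mart st unfolding martingale_def by blast
      then show ?thesis by (rule eventually_mono) simp
    qed
    show "real_cond_exp M (natural_filtration M Z s) (X t) \<in> borel_measurable M" by simp
    show "X s \<in> borel_measurable M" using int by auto
  qed (rule AM)
  finally show "(\<integral>w. indicator A w * (X t w - X s w) \<partial>M) = 0"
    using i1 by (simp add: right_diff_distrib set_lebesgue_integral_def)
qed

text \<open>Rounding \<sigma> up to a grid writes the stopped process as \<open>X 0\<close> plus the
  increments over those grid steps whose left end lies before \<sigma>. Each has mean zero, since
  rounding up makes the decision to take a step an event at its left end. Path continuity and the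
  uniform bound then let the mesh tend to 0.\<close>

lemma optional_stopping:
  assumes "prob_space M" and Z: "\<And>t. t \<ge> 0 \<Longrightarrow> Z t \<in> borel_measurable M"
    and mart: "martingale M (natural_filtration M Z) X"
    and cont: "\<And>w. w \<in> space M \<Longrightarrow> continuous_on {0..T} (\<lambda>t. X t w)"
    and bound: "\<And>w t. w \<in> space M \<Longrightarrow> t \<in> {0..T} \<Longrightarrow> \<bar>X t w\<bar> \<le> B"
    and T: "T > 0" and \<sigma>: "\<And>w. w \<in> space M \<Longrightarrow> \<sigma> w \<in> {0..T}"
    and adapted: "\<And>t. 0 \<le> t \<Longrightarrow> t < T \<Longrightarrow> {w \<in> space M. t < \<sigma> w} \<in> sets (natural_filtration M Z t)"
  shows "integrable M (\<lambda>w. X (\<sigma> w) w)"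
    and "(\<integral>w. X (\<sigma> w) w \<partial>M) = (\<integral>w. X 0 w \<partial>M)"
proof -
  interpret prob_space M by fact
  define A where "A t = {w \<in> space M. t < \<sigma> w}" for t
  define g where "g N k = T * real k / real N" for N k :: nat
  define Y where "Y N w = X 0 w + (\<Sum>k<N. indicator (A (g N k)) w * (X (g N (Suc k)) w - X (g N k) w))" for N w
  \<comment> \<open>The index of \<sigma> rounded up to the grid: \<open>k < m N w\<close> holds
    exactly if the grid point \<open>g N k\<close> lies strictly before \<sigma>, which is the kind
    of event that \<open>adapted\<close> covers.\<close>
  define m where "m N w = nat \<lceil>\<sigma> w * real N / T\<rceil>" for N w
  have gT: "0 \<le> g N k" "k < N \<Longrightarrow> g N k < T" "k \<le> N \<Longrightarrow> g N k \<le> T" "g N k \<le> g N (Suc k)" for N k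
    using T by (auto simp: g_def divide_simps mult_left_mono)
  have m_le: "m N w \<le> N" if "w \<in> space M" for N w
  proof -
    have "\<sigma> w * real N / T \<le> real N"
      using \<sigma>[OF that] T mult_right_mono[of "\<sigma> w" T "real N"] by (simp add: divide_simps mult.commute)
    then show ?thesis unfolding m_def by (simp add: ceiling_le_iff nat_le_iff)
  qed
  have Y_eq: "Y N w = X (g N (m N w)) w" if w: "w \<in> space M" and N: "N > 0" for N w
  proof -
    have iff: "w \<in> A (g N k) \<longleftrightarrow> k < m N w" for k
    proof -
      have "w \<in> A (g N k) \<longleftrightarrow> T * real k / real N < \<sigma> w" using w by (simp add: A_def g_def)
      also have "\<dots> \<longleftrightarrow> real k < \<sigma> w * real N / T"
        using T N by (simp add: field_simps)
      also have "\<dots> \<longleftrightarrow> int k < \<lceil>\<sigma> w * real N / T\<rceil>"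
        by (simp add: less_ceiling_iff)
      also have "\<dots> \<longleftrightarrow> k < m N w" unfolding m_def by linarith
      finally show ?thesis .
    qed
    have "(\<Sum>k<N. indicator (A (g N k)) w * (X (g N (Suc k)) w - X (g N k) w))
        = (\<Sum>k<m N w. X (g N (Suc k)) w - X (g N k) w)"
      using m_le[OF w, of N] by (intro sum.mono_neutral_cong_right) (auto simp: iff indicator_def)
    also have "\<dots> = X (g N (m N w)) w - X (g N 0) w"
      by (rule sum_lessThan_telescope)
    finally show ?thesis by (simp add: Y_def g_def)
  qed
  have intX: "integrable M (X 0)" using mart by (simp add: martingale_def)
  have inc: "integrable M (\<lambda>w. indicator (A (g N k)) w * (X (g N (Suc k)) w - X (g N k) w))"
    "(\<integral>w. indicator (A (g N k)) w * (X (g N (Suc k)) w - X (g N k) w) \<partial>M) = 0" if "k < N" for N k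
    using martingale_increment_integral[OF assms(1) Z mart gT(1) gT(4), of "A (g N k)" N k]
      adapted[OF gT(1) gT(2)[OF that]]
    by (auto simp: A_def)
  have intY: "integrable M (Y N)" for N
    unfolding Y_def using intX inc by (intro Bochner_Integration.integrable_add Bochner_Integration.integrable_sum) auto
  have EY: "(\<integral>w. Y N w \<partial>M) = (\<integral>w. X 0 w \<partial>M)" for N
  proof -
    let ?I = "\<lambda>k w. indicator (A (g N k)) w * (X (g N (Suc k)) w - X (g N k) w)"
    have "integrable M (\<lambda>w. \<Sum>k<N. ?I k w)"
      by (rule Bochner_Integration.integrable_sum) (use inc(1) in simp)
    then have "(\<integral>w. Y N w \<partial>M) = (\<integral>w. X 0 w \<partial>M) + (\<integral>w. (\<Sum>k<N. ?I k w) \<partial>M)"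
      unfolding Y_def by (rule Bochner_Integration.integral_add[OF intX])
    also have "(\<integral>w. (\<Sum>k<N. ?I k w) \<partial>M) = (\<Sum>k<N. \<integral>w. ?I k w \<partial>M)"
      by (rule Bochner_Integration.integral_sum) (use inc(1) in simp)
    also have "\<dots> = 0" using inc(2) by (intro sum.neutral) simp
    finally show ?thesis by simp
  qed
  \<comment> \<open>\<open>Suc N\<close> excludes the grid without steps, where \<open>g\<close>
    would divide by 0.\<close>
  have lim: "(\<lambda>N. Y (Suc N) w) \<longlonglongrightarrow> X (\<sigma> w) w" if w: "w \<in> space M" for w
  proof -
    have "\<bar>g (Suc N) (m (Suc N) w) - \<sigma> w\<bar> \<le> T / real (Suc N)" for N
    proof -
      have "0 \<le> \<sigma> w * real (Suc N) / T" using \<sigma>[OF w] T by auto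
      then have r: "real (m (Suc N) w) = of_int \<lceil>\<sigma> w * real (Suc N) / T\<rceil>" by (simp add: m_def)
      have *: "\<bar>real (m (Suc N) w) - \<sigma> w * real (Suc N) / T\<bar> \<le> 1" unfolding r by linarith
      have "g (Suc N) (m (Suc N) w) - \<sigma> w = (T / real (Suc N)) * (real (m (Suc N) w) - \<sigma> w * real (Suc N) / T)"
        using T by (simp add: g_def right_diff_distrib)
      then have "\<bar>g (Suc N) (m (Suc N) w) - \<sigma> w\<bar> = (T / real (Suc N)) * \<bar>real (m (Suc N) w) - \<sigma> w * real (Suc N) / T\<bar>"
        using T by (simp add: abs_mult)
      also have "\<dots> \<le> (T / real (Suc N)) * 1" using T by (intro mult_left_mono *) auto
      finally show ?thesis by simp
    qed
    then have "(\<lambda>N. g (Suc N) (m (Suc N) w) - \<sigma> w) \<longlonglongrightarrow> 0"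
      by (intro Lim_null_comparison[OF _ LIMSEQ_Suc[OF lim_const_over_n[of T]]]) (auto intro!: always_eventually)
    then have "(\<lambda>N. g (Suc N) (m (Suc N) w)) \<longlonglongrightarrow> \<sigma> w" by (simp add: LIM_zero_iff)
    then have "(\<lambda>N. X (g (Suc N) (m (Suc N) w)) w) \<longlonglongrightarrow> X (\<sigma> w) w"
      by (rule continuous_on_tendsto_compose[OF cont[OF w]]) (use \<sigma>[OF w] gT m_le[OF w] le_SucI in auto)
    then show ?thesis using Y_eq[OF w] by simp
  qed
  have bnd: "norm (Y (Suc N) w) \<le> B" if w: "w \<in> space M" for N w
    using Y_eq[OF w] bound[OF w] gT m_le[OF w] by (auto simp: real_norm_def)
  have meas: "(\<lambda>w. X (\<sigma> w) w) \<in> borel_measurable M"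
    by (rule borel_measurable_LIMSEQ_real[OF lim]) (use intY in auto)
  have "(\<lambda>N. \<integral>w. Y (Suc N) w \<partial>M) \<longlonglongrightarrow> (\<integral>w. X (\<sigma> w) w \<partial>M)"
    by (rule integral_dominated_convergence[where w="\<lambda>_. B"]) (use meas lim bnd intY in auto)
  moreover have "integrable M (\<lambda>w. X (\<sigma> w) w)"
    using meas bound \<sigma> by (intro integrable_const_bound[of _ B]) auto
  ultimately show "integrable M (\<lambda>w. X (\<sigma> w) w)" "(\<integral>w. X (\<sigma> w) w \<partial>M) = (\<integral>w. X 0 w \<partial>M)"
    by (auto simp: EY LIMSEQ_const_iff)
qed

section \<open>Hitting times\<close>

text \<open>The hitting time of \<open>C\<close> capped at \<open>T\<close>. Inserting
  \<open>T\<close> into the set makes the infimum meaningful also for paths that miss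
  \<open>C\<close>, and keeps the stopping time bounded.\<close>

definition stopped_time :: "(real \<Rightarrow> 'w \<Rightarrow> 'a::topological_space) \<Rightarrow> 'a set \<Rightarrow> real \<Rightarrow> 'w \<Rightarrow> real" where
  "stopped_time Z C T w = Inf (insert T {t \<in> {0..T}. Z t w \<in> C})"

lemma stopped_time_mem:
  assumes "continuous_on {0..} (\<lambda>t. Z t w)" "closed C" "T \<ge> 0"
  shows "stopped_time Z C T w \<in> insert T {t \<in> {0..T}. Z t w \<in> C}"
proof -
  have "closed ({0..T} \<inter> (\<lambda>t. Z t w) -` C)"
    using assms by (intro continuous_closed_preimage continuous_on_subset[OF assms(1)]) auto
  moreover have "{0..T} \<inter> (\<lambda>t. Z t w) -` C = {t \<in> {0..T}. Z t w \<in> C}" by auto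
  ultimately have "closed (insert T {t \<in> {0..T}. Z t w \<in> C})" by simp
  moreover have "bdd_below (insert T {t \<in> {0..T}. Z t w \<in> C})"
    using assms by (intro bdd_belowI[of _ 0]) auto
  ultimately show ?thesis unfolding stopped_time_def by (intro closed_contains_Inf) auto
qed

lemma stopped_time_le:
  assumes "0 \<le> t" "t \<le> T" "Z t w \<in> C"
  shows "stopped_time Z C T w \<le> t"
  unfolding stopped_time_def using assms
  by (intro cInf_lower bdd_belowI[of _ 0]) auto

lemma stopped_time_range:
  assumes "continuous_on {0..} (\<lambda>t. Z t w)" "closed C" "T \<ge> 0"
  shows "stopped_time Z C T w \<in> {0..T}"
  using stopped_time_mem[of Z w C T, OF assms] assms(3) by auto

lemma stopped_time_hits:
  assumes "continuous_on {0..} (\<lambda>t. Z t w)" "closed C" "T \<ge> 0" "stopped_time Z C T w < T"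
  shows "Z (stopped_time Z C T w) w \<in> C"
  using stopped_time_mem[of Z w C T, OF assms(1-3)] assms(4) by auto

lemma less_stopped_time_iff:
  assumes "continuous_on {0..} (\<lambda>t. Z t w)" "closed C" "0 \<le> t" "t < T"
  shows "t < stopped_time Z C T w \<longleftrightarrow> (\<forall>u\<in>{0..t}. Z u w \<notin> C)"
proof
  assume "t < stopped_time Z C T w"
  then show "\<forall>u\<in>{0..t}. Z u w \<notin> C" using stopped_time_le[of _ T Z w C] assms by force
next
  assume *: "\<forall>u\<in>{0..t}. Z u w \<notin> C"
  show "t < stopped_time Z C T w"
  proof (rule ccontr)
    assume "\<not> ?thesis"
    then show False
      using stopped_time_hits[of Z w C T, OF assms(1,2)] stopped_time_range[of Z w C T, OF assms(1,2)] * assms by auto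
  qed
qed

text \<open>As paths are continuous, it suffices to look at rational times.\<close>

lemma stopped_time_adapted:
  fixes Z :: "real \<Rightarrow> 'w \<Rightarrow> 'a::metric_space"
  assumes cont: "\<And>w. w \<in> space M \<Longrightarrow> continuous_on {0..} (\<lambda>t. Z t w)"
    and C: "closed C" "C \<noteq> {}" and t: "0 \<le> t" "t < T"
  shows "{w \<in> space M. t < stopped_time Z C T w} \<in> sets (natural_filtration M Z t)"
proof -
  \<comment> \<open>The point 0 is added so that \<open>D\<close> is nonempty and has the right
    closure also for \<open>t = 0\<close>.\<close>
  define D where "D = insert 0 ({0<..<t} \<inter> \<rat>)"
  have D: "countable D" "D \<subseteq> {0..t}" "{0..t} \<subseteq> closure D"
  proof -
    show "countable D" unfolding D_def by (simp add: countable_rat countable_Int2)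
    show "D \<subseteq> {0..t}" using t by (auto simp: D_def)
    show "{0..t} \<subseteq> closure D"
    proof (cases "t = 0")
      case True then show ?thesis using closure_subset[of D] by (auto simp: D_def)
    next
      case False
      have "closure ({0<..<t} \<inter> \<rat>) = closure {0<..<t}"
        by (intro closure_open_Int_superset) (auto simp: Rats_closure_real)
      then show ?thesis using False t closure_mono[of "{0<..<t} \<inter> \<rat>" D]
        by (auto simp: D_def closure_greaterThanLessThan)
    qed
  qed
  \<comment> \<open>On a compact time interval, avoiding the closed set \<open>C\<close> means
    keeping a positive distance from it. A bound \<open>1 / real (Suc n)\<close> on the distance is
    a closed condition, so it passes from \<open>D\<close> to all of \<open>{0..t}\<close>.\<close>
  have eq: "{w \<in> space M. t < stopped_time Z C T w} =
     {w \<in> space M. \<exists>n::nat. \<forall>q\<in>D. infdist (Z q w) C \<ge> 1 / real (Suc n)}" (is "?L = ?R")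
  proof (intro Collect_cong conj_cong refl)
    fix w assume w: "w \<in> space M"
    have ct: "continuous_on {0..t} (\<lambda>u. infdist (Z u w) C)"
      by (intro continuous_on_infdist continuous_on_subset[OF cont[OF w]]) auto
    show "t < stopped_time Z C T w \<longleftrightarrow> (\<exists>n::nat. \<forall>q\<in>D. infdist (Z q w) C \<ge> 1 / real (Suc n))"
      unfolding less_stopped_time_iff[of Z w C t T, OF cont[OF w] C(1) t]
    proof
      assume *: "\<forall>u\<in>{0..t}. Z u w \<notin> C"
      obtain u0 where u0: "u0 \<in> {0..t}" "\<And>u. u \<in> {0..t} \<Longrightarrow> infdist (Z u0 w) C \<le> infdist (Z u w) C"
        using continuous_attains_inf[OF _ _ ct] t by (metis atLeastatMost_empty_iff2 compact_Icc linorder_not_le)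
      have "infdist (Z u0 w) C > 0"
        using * u0(1) C by (metis in_closed_iff_infdist_zero infdist_nonneg le_less)
      then obtain n where "1 / real (Suc n) < infdist (Z u0 w) C"
        using nat_approx_posE by blast
      then show "\<exists>n::nat. \<forall>q\<in>D. infdist (Z q w) C \<ge> 1 / real (Suc n)"
        using u0(2) D(2) by (meson less_imp_le order_trans subsetD)
    next
      assume "\<exists>n::nat. \<forall>q\<in>D. infdist (Z q w) C \<ge> 1 / real (Suc n)"
      then obtain n :: nat where n: "\<forall>q\<in>D. infdist (Z q w) C \<ge> 1 / real (Suc n)" by blast
      show "\<forall>u\<in>{0..t}. Z u w \<notin> C"
      proof
        fix u assume u: "u \<in> {0..t}"
        have "closed ({0..t} \<inter> (\<lambda>u. infdist (Z u w) C) -` {1 / real (Suc n)..})"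
          by (intro continuous_closed_preimage ct) auto
        moreover have "D \<subseteq> {0..t} \<inter> (\<lambda>u. infdist (Z u w) C) -` {1 / real (Suc n)..}"
          using n D(2) by auto
        ultimately have "u \<in> {0..t} \<inter> (\<lambda>u. infdist (Z u w) C) -` {1 / real (Suc n)..}"
          using D(3) u closure_minimal by blast
        then have "infdist (Z u w) C > 0" by (auto intro: less_le_trans[of 0 "1 / (1 + real n)"])
        then show "Z u w \<notin> C" by auto
      qed
    qed
  qed
  have m: "(\<lambda>w. infdist (Z q w) C) \<in> borel_measurable (natural_filtration M Z t)" if "q \<in> D" for q
  proof -
    have "Z q \<in> borel_measurable (natural_filtration M Z t)"
      using that D(2) by (intro measurable_natural_filtration) auto
    then show ?thesis
      by (rule measurable_compose) (intro borel_measurable_continuous_onI continuous_intros)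
  qed
  have "{w \<in> space (natural_filtration M Z t). \<exists>n::nat. \<forall>q\<in>D. infdist (Z q w) C \<ge> 1 / real (Suc n)} =
      (\<Union>n. \<Inter>q\<in>D. {w \<in> space (natural_filtration M Z t). infdist (Z q w) C \<ge> 1 / real (Suc n)})"
    by (auto simp: D_def)
  also have "\<dots> \<in> sets (natural_filtration M Z t)"
  proof (rule sets.countable_UN, rule image_subsetI)
    fix n :: nat
    show "(\<Inter>q\<in>D. {w \<in> space (natural_filtration M Z t). infdist (Z q w) C \<ge> 1 / real (Suc n)})
        \<in> sets (natural_filtration M Z t)"
    proof (intro sets.countable_INT' D(1))
      show "(\<lambda>q. {w \<in> space (natural_filtration M Z t). 1 / real (Suc n) \<le> infdist (Z q w) C}) ` D
          \<subseteq> sets (natural_filtration M Z t)"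
        using m by (auto simp del: of_nat_Suc)
    qed (simp add: D_def)
  qed
  finally have "{w \<in> space (natural_filtration M Z t). \<exists>n::nat. \<forall>q\<in>D. infdist (Z q w) C \<ge> 1 / real (Suc n)}
      \<in> sets (natural_filtration M Z t)" .
  then show ?thesis unfolding eq space_natural_filtration .
qed

section \<open>Brownian motion on the sphere\<close>

text \<open>Rounding the random time down to multiples of \<open>1 / real (Suc N)\<close> leaves
  countably many deterministic times; path continuity recovers the value at the exact time.\<close>

lemma measurable_at_random_time:
  fixes Z :: "real \<Rightarrow> 'w \<Rightarrow> 'a::{metric_space,second_countable_topology}"
  assumes Z: "\<And>t. t \<ge> 0 \<Longrightarrow> Z t \<in> borel_measurable M"
    and cont: "\<And>w. w \<in> space M \<Longrightarrow> continuous_on {0..} (\<lambda>t. Z t w)"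
    and \<tau>: "\<tau> \<in> borel_measurable M" "\<And>w. w \<in> space M \<Longrightarrow> \<tau> w \<ge> 0"
  shows "(\<lambda>w. Z (\<tau> w) w) \<in> borel_measurable M"
proof (rule borel_measurable_LIMSEQ_metric)
  fix N :: nat
  have "(\<lambda>w. nat \<lfloor>real (Suc N) * \<tau> w\<rfloor>) \<in> measurable M (count_space UNIV)"
    using \<tau>(1) by measurable
  then show "(\<lambda>w. Z (real (nat \<lfloor>real (Suc N) * \<tau> w\<rfloor>) / real (Suc N)) w) \<in> borel_measurable M"
    by (rule measurable_compose_countable[where f="\<lambda>k. Z (real k / real (Suc N))", rotated]) (rule Z, simp)
next
  fix w assume w: "w \<in> space M"
  have b: "\<bar>real (nat \<lfloor>real (Suc N) * \<tau> w\<rfloor>) / real (Suc N) - \<tau> w\<bar> \<le> 1 / real (Suc N)" for N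
  proof -
    have "0 \<le> real (Suc N) * \<tau> w" using \<tau>(2)[OF w] by simp
    then have "\<bar>real (nat \<lfloor>real (Suc N) * \<tau> w\<rfloor>) - real (Suc N) * \<tau> w\<bar> \<le> 1" by linarith
    moreover have "real (nat \<lfloor>real (Suc N) * \<tau> w\<rfloor>) / real (Suc N) - \<tau> w =
       (real (nat \<lfloor>real (Suc N) * \<tau> w\<rfloor>) - real (Suc N) * \<tau> w) / real (Suc N)"
      by (simp add: field_simps)
    ultimately show ?thesis by (simp add: abs_divide divide_right_mono)
  qed
  have "(\<lambda>N. real (nat \<lfloor>real (Suc N) * \<tau> w\<rfloor>) / real (Suc N) - \<tau> w) \<longlonglongrightarrow> 0"
    by (rule Lim_null_comparison[OF _ LIMSEQ_Suc[OF lim_const_over_n[of 1]]]) (use b in \<open>auto intro!: always_eventually\<close>)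
  then have "(\<lambda>N. real (nat \<lfloor>real (Suc N) * \<tau> w\<rfloor>) / real (Suc N)) \<longlonglongrightarrow> \<tau> w"
    by (simp add: LIM_zero_iff)
  then show "(\<lambda>N. Z (real (nat \<lfloor>real (Suc N) * \<tau> w\<rfloor>) / real (Suc N)) w) \<longlonglongrightarrow> Z (\<tau> w) w"
    by (rule continuous_on_tendsto_compose[OF cont[OF w]]) (use \<tau>(2)[OF w] in auto)
qed

lemma continuous_on_compact_bounded:
  assumes "continuous_on S f" "compact S"
  obtains B :: real where "\<And>y. y \<in> S \<Longrightarrow> \<bar>f y\<bar> \<le> B"
proof -
  have "bounded (f ` S)" using assms compact_continuous_image compact_imp_bounded by blast
  then show ?thesis using that unfolding bounded_iff by auto
qed

text \<open>The form is affine in \<open>e\<close> with slope \<open>(1 - s) / 2\<close>, where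
  \<open>s\<close> is the height of the point and at most 1 on the sphere.\<close>

lemma chordal_form_0_le:
  assumes "e \<ge> 0" "y \<in> sphere 0 1"
  shows "chordal_form v 0 y \<le> chordal_form v e y"
proof -
  obtain x s where y: "y = (x, s)" by force
  have "\<bar>s\<bar> \<le> 1" using assms(2) norm_snd_le[of s x] by (simp add: y)
  then have "e * s \<le> e * 1" by (intro mult_left_mono assms) auto
  then show ?thesis by (simp add: chordal_form_def y inner_prod_def field_simps)
qed

text \<open>With \<open>r = norm (z - v)\<close> the denominator is at most
  \<open>2 * r\<^sup>2\<close> plus a constant, and \<open>r \<ge> \<kappa>\<close> absorbs the
  constant into a multiple of \<open>r\<^sup>2\<close>. The bound therefore holds uniformly up to
  infinity.\<close>

lemma chordal_form_0_ge:
  assumes "norm (z - v) \<ge> \<kappa>" "\<kappa> > 0"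
  shows "chordal_form v 0 (to_sphere z) \<ge> 1 / (2 + (1 + 2 * (norm v)\<^sup>2) / \<kappa>\<^sup>2)"
proof -
  define r where "r = norm (z - v)"
  have r: "r \<ge> \<kappa>" "r > 0" using assms by (auto simp: r_def)
  have "norm z \<le> r + norm v" unfolding r_def using norm_triangle_sub[of z v] by simp
  then have "(norm z)\<^sup>2 \<le> (r + norm v)\<^sup>2" by (intro power_mono) auto
  also have "\<dots> \<le> 2 * r\<^sup>2 + 2 * (norm v)\<^sup>2"
    using sum_squares_ge_zero[of "r - norm v" 0] by (simp add: power2_eq_square algebra_simps)
  finally have 1: "1 + (norm z)\<^sup>2 \<le> 2 * r\<^sup>2 + (1 + 2 * (norm v)\<^sup>2)" by simp
  have "\<kappa>\<^sup>2 \<le> r\<^sup>2" using r assms by (intro power_mono) auto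
  then have "(1 + 2 * (norm v)\<^sup>2) * \<kappa>\<^sup>2 \<le> (1 + 2 * (norm v)\<^sup>2) * r\<^sup>2" by (intro mult_left_mono) auto
  then have "1 + 2 * (norm v)\<^sup>2 \<le> r\<^sup>2 * ((1 + 2 * (norm v)\<^sup>2) / \<kappa>\<^sup>2)"
    using assms by (simp add: field_simps)
  with 1 have "1 + (norm z)\<^sup>2 \<le> r\<^sup>2 * (2 + (1 + 2 * (norm v)\<^sup>2) / \<kappa>\<^sup>2)" by (simp add: algebra_simps)
  moreover have "2 + (1 + 2 * (norm v)\<^sup>2) / \<kappa>\<^sup>2 > 0" by (intro add_pos_nonneg) auto
  moreover have "1 + (norm z)\<^sup>2 > 0" by (simp add: add_pos_nonneg)
  ultimately show ?thesis
    unfolding chordal_form_to_sphere r_def[symmetric] by (simp add: divide_simps mult.commute)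
qed

locale sphere_brownian =
  fixes M :: "'w measure" and Z :: "real \<Rightarrow> 'w \<Rightarrow> complex \<times> real"
  assumes bm: "brownian_motion_from_infinity M Z"
begin

sublocale prob_space M
  using bm by (simp add: brownian_motion_from_infinity_def)

lemma Z_measurable: "t \<ge> 0 \<Longrightarrow> Z t \<in> borel_measurable M"
  and Z_sphere: "w \<in> space M \<Longrightarrow> t \<ge> 0 \<Longrightarrow> Z t w \<in> sphere 0 1"
  and Z_cont: "w \<in> space M \<Longrightarrow> continuous_on {0..} (\<lambda>t. Z t w)"
  and Z_start: "w \<in> space M \<Longrightarrow> Z 0 w = sphere_infinity"
  and Z_martingale: "C2_on (- {0}) \<phi> \<Longrightarrow> martingale M (natural_filtration M Z)
          (\<lambda>t w. \<phi> (Z t w) - \<phi> (Z 0 w) - integral {0..t} (\<lambda>u. sphere_laplacian \<phi> (Z u w) / 2))"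
  using bm by (simp_all add: brownian_motion_from_infinity_def)

lemma stopped_time_in: "w \<in> space M \<Longrightarrow> closed C \<Longrightarrow> T \<ge> 0 \<Longrightarrow> stopped_time Z C T w \<in> {0..T}"
  using stopped_time_range[of Z w C T] Z_cont by blast

lemma stopped_time_measurable:
  assumes "closed C" "C \<noteq> {}" "T \<ge> 0"
  shows "stopped_time Z C T \<in> borel_measurable M"
proof -
  have "{w \<in> space M. t < stopped_time Z C T w} \<in> sets M" for t
  proof -
    consider "t < 0" | "0 \<le> t" "t < T" | "t \<ge> T" by linarith
    then show ?thesis
    proof cases
      case 1
      then have "{w \<in> space M. t < stopped_time Z C T w} = space M"
        using stopped_time_in[OF _ assms(1,3)] by fastforce
      then show ?thesis by simp
    next
      case 2
      then have "{w \<in> space M. t < stopped_time Z C T w} \<in> sets (natural_filtration M Z t)"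
        by (intro stopped_time_adapted Z_cont assms)
      then show ?thesis
        using subalgebra_natural_filtration[of Z M t, OF Z_measurable] by (auto simp: subalgebra_def)
    next
      case 3
      then have "{w \<in> space M. t < stopped_time Z C T w} = {}"
        using stopped_time_in[OF _ assms(1,3)] by fastforce
      then show ?thesis by (metis sets.empty_sets)
    qed
  qed
  then show ?thesis by (simp add: borel_measurable_iff_greater)
qed

lemma Z_stopped_measurable:
  assumes "closed C" "C \<noteq> {}" "T \<ge> 0"
  shows "(\<lambda>w. Z (stopped_time Z C T w) w) \<in> borel_measurable M"
  using stopped_time_in[OF _ assms(1,3)]
  by (intro measurable_at_random_time[OF Z_measurable Z_cont stopped_time_measurable[OF assms]]) auto

lemma Z_stopped_sphere:
  "w \<in> space M \<Longrightarrow> closed C \<Longrightarrow> T \<ge> 0 \<Longrightarrow> Z (stopped_time Z C T w) w \<in> sphere 0 1"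
  using stopped_time_in[of w C T] Z_sphere[of w "stopped_time Z C T w"] by simp

lemma continuous_on_log_chordal_sphere:
  "e > 0 \<Longrightarrow> continuous_on (sphere 0 1) (log_chordal v e)"
proof -
  assume e: "e > 0"
  have "continuous_on (sphere 0 1) (\<lambda>y. ln (chordal_form v e y) / 2)"
    using chordal_form_pos[OF e, of _ v]
    by (intro continuous_intros continuous_on_chordal_form) (auto simp: less_imp_neq[symmetric])
  then show ?thesis
    by (rule continuous_on_eq) (simp add: log_chordal_sphere)
qed

lemma integrable_continuous_sphere:
  assumes \<phi>: "continuous_on (sphere 0 1) \<phi>" and C: "closed C" "C \<noteq> {}" "T \<ge> 0"
  shows "integrable M (\<lambda>w. \<phi> (Z (stopped_time Z C T w) w) :: real)"
proof -
  obtain B where B: "\<And>y. y \<in> sphere 0 1 \<Longrightarrow> \<bar>\<phi> y\<bar> \<le> B"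
    using continuous_on_compact_bounded[OF \<phi> compact_sphere] by blast
  have "(\<lambda>w. Z (stopped_time Z C T w) w) \<in> measurable M (restrict_space borel (sphere 0 1))"
    using Z_stopped_sphere[OF _ C(1,3)] by (intro measurable_restrict_space2 Z_stopped_measurable C) auto
  then have "(\<lambda>w. \<phi> (Z (stopped_time Z C T w) w)) \<in> borel_measurable M"
    by (rule measurable_compose) (rule borel_measurable_continuous_on_restrict[OF \<phi>])
  then show ?thesis
    using B Z_stopped_sphere[OF _ C(1,3)] by (intro integrable_const_bound[of _ B]) auto
qed

text \<open>The integrated Laplacian consists of a source \<open>h \<ge> 0\<close> and a constant,
  the latter producing \<open>\<sigma> w / 4\<close>. Dropping the source gives the lower bound for
  every pole; the upper bound holds when the path stays away from the pole, where the source is at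
  most \<delta>.\<close>

lemma
  assumes e: "e > 0" and C: "closed C" "C \<noteq> {}" and T: "T > 0"
  defines "\<sigma> \<equiv> stopped_time Z C T"
  shows integrable_log_chordal_stopped: "integrable M (\<lambda>w. log_chordal v e (Z (\<sigma> w) w))"
    and integrable_stopped_time: "integrable M \<sigma>"
    and log_chordal_stopped_ge: "(\<integral>w. log_chordal v e (Z (\<sigma> w) w) + \<sigma> w / 4 \<partial>M) \<ge> 0"
    and log_chordal_stopped_le:
      "(\<And>w u. w \<in> space M \<Longrightarrow> 0 \<le> u \<Longrightarrow> u < \<sigma> w \<Longrightarrow> e / (chordal_form v e (Z u w))\<^sup>2 \<le> \<delta>) \<Longrightarrow> \<delta> \<ge> 0 \<Longrightarrow>
        (\<integral>w. log_chordal v e (Z (\<sigma> w) w) + \<sigma> w / 4 \<partial>M) \<le> \<delta> * T / 4"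
proof -
  define h where "h y = e / (chordal_form v e y)\<^sup>2" for y
  define X where "X t w = log_chordal v e (Z t w) - log_chordal v e (Z 0 w) -
     integral {0..t} (\<lambda>u. sphere_laplacian (log_chordal v e) (Z u w) / 2)" for t w
  have conth: "continuous_on (sphere 0 1) h"
    unfolding h_def using chordal_form_pos[OF e, of _ v]
    by (intro continuous_intros continuous_on_chordal_form) (auto simp: less_imp_neq[symmetric])
  have conthZ: "continuous_on {0..t} (\<lambda>u. h (Z u w))" if "w \<in> space M" for t w
    by (rule continuous_on_compose2[OF conth continuous_on_subset[OF Z_cont[OF that]]])
       (use Z_sphere[OF that] in auto)
  have h_nonneg: "h y \<ge> 0" for y using e by (simp add: h_def)
  obtain B1 where B1: "\<And>y. y \<in> sphere 0 1 \<Longrightarrow> \<bar>log_chordal v e y\<bar> \<le> B1"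
    using continuous_on_compact_bounded[OF continuous_on_log_chordal_sphere[OF e] compact_sphere] by blast
  obtain B2 where B2: "\<And>y. y \<in> sphere 0 1 \<Longrightarrow> \<bar>h y\<bar> \<le> B2"
    using continuous_on_compact_bounded[OF conth compact_sphere] by blast
  have int_eq: "integral {0..t} (\<lambda>u. sphere_laplacian (log_chordal v e) (Z u w) / 2) =
      integral {0..t} (\<lambda>u. h (Z u w)) / 4 - t / 4" if w: "w \<in> space M" and t: "t \<ge> 0" for w t
  proof -
    have "integral {0..t} (\<lambda>u. sphere_laplacian (log_chordal v e) (Z u w) / 2) =
        integral {0..t} (\<lambda>u. h (Z u w) / 4 - 1 / 4)"
      by (rule integral_cong) (use Z_sphere[OF w] sphere_laplacian_log_chordal[OF e] in \<open>simp add: h_def field_simps\<close>)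
    also have "\<dots> = integral {0..t} (\<lambda>u. h (Z u w) / 4) - integral {0..t} (\<lambda>u. 1 / 4)"
      by (intro integral_diff integrable_continuous_interval continuous_intros conthZ w) auto
    finally show ?thesis using t by simp
  qed
  \<comment> \<open>The starting value drops out because \<open>chordal_form\<close> equals 1 at
    infinity. The factor 1/4 is the product of the 1/2 in the Laplacian and the 1/2 in the
    generator.\<close>
  have X_eq: "X t w = log_chordal v e (Z t w) - integral {0..t} (\<lambda>u. h (Z u w)) / 4 + t / 4"
    if "w \<in> space M" "t \<ge> 0" for w t
    unfolding X_def int_eq[OF that] Z_start[OF that(1)]
    by (simp add: log_chordal_def chordal_form_infinity) (simp add: sphere_infinity_def norm_Pair chordal_form_infinity[unfolded sphere_infinity_def])
  have \<sigma>: "\<sigma> w \<in> {0..T}" if "w \<in> space M" for w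
    unfolding \<sigma>_def using stopped_time_in[OF that C(1)] T by simp
  have int_bound: "0 \<le> integral {0..t} (\<lambda>u. h (Z u w))" "integral {0..t} (\<lambda>u. h (Z u w)) \<le> B2 * T"
    if w: "w \<in> space M" and t: "t \<in> {0..T}" for w t
  proof -
    show "0 \<le> integral {0..t} (\<lambda>u. h (Z u w))"
      by (intro integral_nonneg integrable_continuous_interval conthZ w h_nonneg)
    have "integral {0..t} (\<lambda>u. h (Z u w)) \<le> integral {0..t} (\<lambda>u. B2)"
    proof (intro integral_le integrable_continuous_interval conthZ w continuous_intros)
      fix u assume "u \<in> {0..t}"
      then show "h (Z u w) \<le> B2" using B2[OF Z_sphere[OF w, of u]] by simp
    qed
    also have "\<dots> = B2 * t" using t by simp
    also have "\<dots> \<le> B2 * T"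
      using t B2[OF Z_sphere[OF w, of 0]] by (intro mult_left_mono) auto
    finally show "integral {0..t} (\<lambda>u. h (Z u w)) \<le> B2 * T" .
  qed
  have bnd: "\<bar>X t w\<bar> \<le> B1 + B2 * T / 4 + T / 4" if w: "w \<in> space M" and t: "t \<in> {0..T}" for w t
    using X_eq[OF w, of t] B1[OF Z_sphere[OF w, of t]] int_bound[OF w t] t by auto
  have contX: "continuous_on {0..T} (\<lambda>t. X t w)" if w: "w \<in> space M" for w
  proof -
    have "continuous_on {0..T} (\<lambda>t. log_chordal v e (Z t w) - integral {0..t} (\<lambda>u. h (Z u w)) / 4 + t / 4)"
    proof (intro continuous_on_add continuous_on_diff continuous_on_divide continuous_on_id continuous_on_const)
      show "continuous_on {0..T} (\<lambda>t. log_chordal v e (Z t w))"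
        by (rule continuous_on_compose2[OF continuous_on_log_chordal_sphere[OF e] continuous_on_subset[OF Z_cont[OF w]]])
           (use Z_sphere[OF w] in auto)
      show "continuous_on {0..T} (\<lambda>t. integral {0..t} (\<lambda>u. h (Z u w)))"
        by (intro indefinite_integral_continuous_1 integrable_continuous_interval conthZ w)
    qed simp_all
    moreover have "X t w = log_chordal v e (Z t w) - integral {0..t} (\<lambda>u. h (Z u w)) / 4 + t / 4" if "t \<in> {0..T}" for t
      using that by (intro X_eq w) auto
    ultimately show ?thesis by (subst continuous_on_cong[OF refl])
  qed
  have mart: "martingale M (natural_filtration M Z) X"
    unfolding X_def by (rule Z_martingale[OF C2_on_log_chordal[OF e]])
  have adapted: "{w \<in> space M. t < \<sigma> w} \<in> sets (natural_filtration M Z t)" if "0 \<le> t" "t < T" for t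
    unfolding \<sigma>_def by (rule stopped_time_adapted[OF Z_cont C that])
  note os_rule = optional_stopping[where \<sigma>=\<sigma> and T=T and X=X and Z=Z and M=M,
      OF prob_space_axioms Z_measurable mart contX bnd T \<sigma> adapted]
  have os: "integrable M (\<lambda>w. X (\<sigma> w) w)" "(\<integral>w. X (\<sigma> w) w \<partial>M) = (\<integral>w. X 0 w \<partial>M)"
    by (rule os_rule; assumption)+
  have EX: "(\<integral>w. X (\<sigma> w) w \<partial>M) = 0"
    unfolding os(2) by (intro integral_eq_zero_AE AE_I2) (simp add: X_def)
  show i1: "integrable M (\<lambda>w. log_chordal v e (Z (\<sigma> w) w))"
    unfolding \<sigma>_def by (intro integrable_continuous_sphere continuous_on_log_chordal_sphere e C) (use T in simp)
  show i2: "integrable M \<sigma>"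
    using stopped_time_measurable[OF C, of T] T \<sigma>
    by (intro integrable_const_bound[of _ T]) (auto simp: \<sigma>_def)
  have i3: "integrable M (\<lambda>w. log_chordal v e (Z (\<sigma> w) w) + \<sigma> w / 4)"
    using i1 i2 by auto
  have "(\<integral>w. X (\<sigma> w) w \<partial>M) \<le> (\<integral>w. log_chordal v e (Z (\<sigma> w) w) + \<sigma> w / 4 \<partial>M)"
  proof (rule integral_mono[OF os(1) i3])
    fix w assume w: "w \<in> space M"
    show "X (\<sigma> w) w \<le> log_chordal v e (Z (\<sigma> w) w) + \<sigma> w / 4"
      using X_eq[OF w, of "\<sigma> w"] \<sigma>[OF w] int_bound(1)[OF w \<sigma>[OF w]] by simp
  qed
  then show "(\<integral>w. log_chordal v e (Z (\<sigma> w) w) + \<sigma> w / 4 \<partial>M) \<ge> 0" using EX by simp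
  assume small: "\<And>w u. w \<in> space M \<Longrightarrow> 0 \<le> u \<Longrightarrow> u < \<sigma> w \<Longrightarrow> e / (chordal_form v e (Z u w))\<^sup>2 \<le> \<delta>"
    and "\<delta> \<ge> 0"
  have "(\<integral>w. log_chordal v e (Z (\<sigma> w) w) + \<sigma> w / 4 \<partial>M) \<le> (\<integral>w. X (\<sigma> w) w + \<delta> * T / 4 \<partial>M)"
  proof (rule integral_mono[OF i3])
    show "integrable M (\<lambda>w. X (\<sigma> w) w + \<delta> * T / 4)" using os(1) by simp
    fix w assume w: "w \<in> space M"
    have "integral {0..\<sigma> w} (\<lambda>u. h (Z u w)) \<le> \<delta> * \<sigma> w"
    proof (cases "\<sigma> w = 0")
      case False
      then have pos: "0 < \<sigma> w" using \<sigma>[OF w] by simp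
      \<comment> \<open>The assumption concerns times strictly before \<sigma>; the end point
        follows by continuity, which is where \<sigma> > 0 is used.\<close>
      have le: "h (Z u w) \<le> \<delta>" if "u \<in> {0..\<sigma> w}" for u
      proof -
        have 1: "continuous_on (closure {0..<\<sigma> w}) (\<lambda>u. h (Z u w))" using pos conthZ[OF w] by simp
        have 2: "u \<in> closure {0..<\<sigma> w}" using that pos by simp
        have 3: "h (Z x w) \<le> \<delta>" if "x \<in> {0..<\<sigma> w}" for x
          using small[OF w, of x] that by (simp add: h_def)
        show ?thesis by (rule continuous_le_on_closure[OF 1 2 3])
      qed
      have "integral {0..\<sigma> w} (\<lambda>u. h (Z u w)) \<le> integral {0..\<sigma> w} (\<lambda>u. \<delta>)"
        by (rule integral_le[OF integrable_continuous_interval[OF conthZ[OF w]] integrable_const_ivl le])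
      then show ?thesis using pos by (simp add: mult.commute)
    qed simp
    also have "\<dots> \<le> \<delta> * T" using \<sigma>[OF w] \<open>\<delta> \<ge> 0\<close> by (intro mult_left_mono) auto
    finally show "log_chordal v e (Z (\<sigma> w) w) + \<sigma> w / 4 \<le> X (\<sigma> w) w + \<delta> * T / 4"
      using X_eq[OF w, of "\<sigma> w"] \<sigma>[OF w] by simp
  qed
  also have "\<dots> = \<delta> * T / 4"
    using os(1) EX by (simp add: prob_space)
  finally show "(\<integral>w. log_chordal v e (Z (\<sigma> w) w) + \<sigma> w / 4 \<partial>M) \<le> \<delta> * T / 4" .
qed

end

context sphere_brownian
begin

lemma stopped_time_eq_first_entry:
  assumes w: "w \<in> space M" and C: "closed (to_sphere ` K)" and t: "0 \<le> t" "t \<le> T" "Z t w \<in> to_sphere ` K"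
  shows "stopped_time Z (to_sphere ` K) T w = first_entry_time Z K w"
    and "Z (stopped_time Z (to_sphere ` K) T w) w \<in> to_sphere ` K"
    and "first_entry_point Z K w = from_sphere (Z (stopped_time Z (to_sphere ` K) T w) w)"
proof -
  define s where "s = stopped_time Z (to_sphere ` K) T w"
  have s: "s \<in> insert T {t \<in> {0..T}. Z t w \<in> to_sphere ` K}"
    unfolding s_def by (rule stopped_time_mem[of Z w "to_sphere ` K" T, OF Z_cont[OF w] C]) (use t in simp)
  have le: "s \<le> x" if "0 \<le> x" "x \<le> T" "Z x w \<in> to_sphere ` K" for x
    unfolding s_def by (rule stopped_time_le[of x T Z w, OF that])
  have s2: "0 \<le> s" "s \<le> T" "Z s w \<in> to_sphere ` K"
    using s le[OF t] t by auto
  have "Inf {t. 0 \<le> t \<and> Z t w \<in> to_sphere ` K} = s"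
    using s2 le by (intro cInf_eq_minimum) force+
  then show "s = first_entry_time Z K w" by (simp add: first_entry_time_def)
  then show "first_entry_point Z K w = from_sphere (Z s w)" by (simp add: first_entry_point_def)
  show "Z s w \<in> to_sphere ` K" by (rule s2)
qed

text \<open>If the path were in the interior of \<open>Y\<close> at a time up to \<sigma>, then by
  continuity it would already be in \<open>Y\<close> a little earlier, before the first hit. An
  earlier time exists because the path starts at infinity and not in \<open>Y\<close>.\<close>

lemma Z_stopped_outside:
  assumes w: "w \<in> space M" and Y: "compact Y" and T: "T > 0"
  defines "\<sigma> \<equiv> stopped_time Z (to_sphere ` Y) T w"
  assumes u: "0 \<le> u" "u \<le> \<sigma>"
  shows "Z u w = sphere_infinity \<or> (\<exists>z\<in>closure (- Y). Z u w = to_sphere z)"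
proof (rule ccontr)
  assume neg: "\<not> ?thesis"
  define z where "z = from_sphere (Z u w)"
  have Zu: "Z u w \<noteq> sphere_infinity" "Z u w = to_sphere z"
    using neg to_sphere_surj[OF Z_sphere[OF w u(1)]] by (auto simp: z_def)
  have C: "closed (to_sphere ` Y)"
    by (intro compact_imp_closed compact_continuous_image continuous_on_to_sphere Y)
  have \<sigma>: "0 \<le> \<sigma>" "\<sigma> \<le> T" unfolding \<sigma>_def using stopped_time_in[OF w C, of T] T by auto
  have before: "Z x w \<notin> to_sphere ` Y" if "0 \<le> x" "x < \<sigma>" for x
    using stopped_time_le[of x T Z w "to_sphere ` Y"] that \<sigma> by (auto simp: \<sigma>_def)
  have "u > 0" using Zu(1) Z_start[OF w] u by (cases "u = 0") auto
  have op: "openin (top_of_set (sphere 0 1 - {sphere_infinity}))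
      ((sphere 0 1 - {sphere_infinity}) \<inter> from_sphere -` (- closure (- Y)))"
    by (intro continuous_openin_preimage_gen continuous_on_from_sphere) auto
  define G where "G = (sphere 0 1 - {sphere_infinity}) \<inter> from_sphere -` (- closure (- Y))"
  have "\<exists>W. open W \<and> G = (sphere 0 1 - {sphere_infinity}) \<inter> W"
    using op unfolding G_def[symmetric] by (simp only: openin_open)
  then obtain W where W: "open W" "G = (sphere 0 1 - {sphere_infinity}) \<inter> W"
    by (elim exE conjE)
  have "Z u w \<in> W"
  proof -
    have "Z u w \<in> G"
    proof -
      have "z \<notin> closure (- Y)" using neg Zu(2) by blast
      then have "from_sphere (Z u w) \<in> - closure (- Y)" by (simp only: z_def Compl_iff not_False_eq_True)
      then show ?thesis unfolding G_def using Zu(1) Z_sphere[OF w u(1)] by blast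
    qed
    then show ?thesis using W(2) by simp
  qed
  then have "Z u w \<in> W - {sphere_infinity}" "open (W - {sphere_infinity})" using Zu W by auto
  moreover have "((\<lambda>x. Z x w) \<longlongrightarrow> Z u w) (at u within {0..})"
    using Z_cont[OF w] u(1) by (auto simp: continuous_on_def)
  ultimately have ev: "eventually (\<lambda>x. Z x w \<in> W - {sphere_infinity}) (at u within {0..})"
    using topological_tendstoD by blast
  have "at u within {0..<u} \<noteq> bot"
    using \<open>u > 0\<close> by (simp add: at_within_eq_bot_iff)
  moreover have "eventually (\<lambda>x. Z x w \<in> W - {sphere_infinity} \<and> x \<in> {0..<u}) (at u within {0..<u})"
    using ev by (intro eventually_conj) (auto simp: eventually_at_filter elim: eventually_mono)
  ultimately obtain x where x: "Z x w \<in> W - {sphere_infinity}" "x \<in> {0..<u}"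
    using eventually_happens' by blast
  then have "Z x w \<in> (sphere 0 1 - {sphere_infinity}) \<inter> W" using Z_sphere[OF w, of x] by auto
  then have "from_sphere (Z x w) \<notin> closure (- Y)" unfolding W(2)[symmetric] by (simp add: G_def)
  then have "from_sphere (Z x w) \<in> Y" using closure_subset[of "- Y"] by auto
  then have "Z x w \<in> to_sphere ` Y"
    using to_sphere_surj[of "Z x w"] x Z_sphere[OF w, of x] by (metis DiffE atLeastLessThan_iff imageI singletonI)
  then show False using before[of x] x u by auto
qed

end

section \<open>Averaged logarithmic potentials of finite sets\<close>

definition mean_log :: "complex set \<Rightarrow> complex \<Rightarrow> real" where
  "mean_log S z = (\<Sum>v\<in>S. ln (norm (z - v))) / card S"

definition mean_log_chordal :: "complex set \<Rightarrow> complex \<times> real \<Rightarrow> real" where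
  "mean_log_chordal S y = (\<Sum>v\<in>S. ln (chordal_form v 0 y) / 2) / card S"

lemma mean_log_chordal_infinity: "mean_log_chordal S sphere_infinity = 0"
  by (simp add: mean_log_chordal_def chordal_form_infinity)

lemma mean_log_chordal_to_sphere:
  assumes "finite S" "S \<noteq> {}" "z \<notin> S"
  shows "mean_log_chordal S (to_sphere z) = mean_log S z - ln (1 + (norm z)\<^sup>2) / 2"
proof -
  have pos: "1 + (norm z)\<^sup>2 > 0" by (simp add: add_pos_nonneg)
  have "ln (chordal_form v 0 (to_sphere z)) / 2 = ln (norm (z - v)) - ln (1 + (norm z)\<^sup>2) / 2" if "v \<in> S" for v
  proof -
    have "norm (z - v) > 0" using that assms by auto
    then show ?thesis using pos by (simp add: chordal_form_to_sphere ln_div ln_realpow diff_divide_distrib)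
  qed
  then have "(\<Sum>v\<in>S. ln (chordal_form v 0 (to_sphere z)) / 2) = (\<Sum>v\<in>S. ln (norm (z - v)) - ln (1 + (norm z)\<^sup>2) / 2)"
    by (intro sum.cong refl)
  then have "mean_log_chordal S (to_sphere z) = ((\<Sum>v\<in>S. ln (norm (z - v))) - card S * (ln (1 + (norm z)\<^sup>2) / 2)) / card S"
    unfolding mean_log_chordal_def by (simp only: sum_subtractf sum_constant)
  also have "\<dots> = mean_log S z - ln (1 + (norm z)\<^sup>2) / 2"
    using assms by (simp add: mean_log_def field_simps)
  finally show ?thesis .
qed

lemma chordal_form_0_ge_outside:
  assumes S: "finite S" "S \<subseteq> interior Y"
  obtains \<kappa> where "\<kappa> > 0" "\<And>v y. v \<in> S \<Longrightarrow> y = sphere_infinity \<or> (\<exists>z\<in>closure (- Y). y = to_sphere z) \<Longrightarrow>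
     chordal_form v 0 y \<ge> \<kappa>"
proof -
  have "\<exists>\<kappa>>0. \<forall>y. y = sphere_infinity \<or> (\<exists>z\<in>closure (- Y). y = to_sphere z) \<longrightarrow> chordal_form v 0 y \<ge> \<kappa>"
    if vS: "v \<in> S" for v
  proof -
    obtain r where r: "r > 0" "ball v r \<subseteq> interior Y"
    proof -
      have "v \<in> interior Y" using S vS by blast
      then have "\<exists>r>0. ball v r \<subseteq> interior Y" by (simp only: open_contains_ball_eq[OF open_interior, symmetric])
      then show thesis using that by (elim exE conjE)
    qed
    have far: "norm (z - v) \<ge> r" if "z \<in> closure (- Y)" for z
    proof (rule ccontr)
      assume "\<not> ?thesis"
      then have "z \<in> ball v r" by (simp add: dist_norm norm_minus_commute)
      then show False using r(2) that by (auto simp only: closure_complement)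
    qed
    define \<kappa> where "\<kappa> = 1 / (2 + (1 + 2 * (norm v)\<^sup>2) / r\<^sup>2)"
    have "2 + (1 + 2 * (norm v)\<^sup>2) / r\<^sup>2 \<ge> 1" by (simp add: add_increasing2)
    then have "\<kappa> > 0" "\<kappa> \<le> 1" by (auto simp: \<kappa>_def divide_simps)
    moreover have "chordal_form v 0 y \<ge> \<kappa>" if "y = sphere_infinity \<or> (\<exists>z\<in>closure (- Y). y = to_sphere z)" for y
      using that chordal_form_0_ge[OF far r(1)] \<open>\<kappa> \<le> 1\<close> by (auto simp: chordal_form_infinity \<kappa>_def)
    ultimately show ?thesis by blast
  qed
  then have "\<forall>v\<in>S. \<exists>\<kappa>>0. \<forall>y. y = sphere_infinity \<or> (\<exists>z\<in>closure (- Y). y = to_sphere z) \<longrightarrow> chordal_form v 0 y \<ge> \<kappa>"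
    by (rule ballI)
  from bchoice[OF this] obtain k where k0: "\<forall>v\<in>S. 0 < k v \<and> (\<forall>y. y = sphere_infinity \<or>
      (\<exists>z\<in>closure (- Y). y = to_sphere z) \<longrightarrow> chordal_form v 0 y \<ge> k v)"
    by (elim exE)
  have k: "k v > 0" "y = sphere_infinity \<or> (\<exists>z\<in>closure (- Y). y = to_sphere z) \<Longrightarrow> chordal_form v 0 y \<ge> k v"
    if "v \<in> S" for v y using k0[rule_format, OF that] by blast+
  show ?thesis
  proof (rule that[of "Min (insert 1 (k ` S))"])
    show "Min (insert 1 (k ` S)) > 0" using S k by (subst Min_gr_iff) auto
    fix v y assume v: "v \<in> S" "y = sphere_infinity \<or> (\<exists>z\<in>closure (- Y). y = to_sphere z)"
    have "Min (insert 1 (k ` S)) \<le> k v" using S v by (intro Min_le) auto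
    then show "Min (insert 1 (k ` S)) \<le> chordal_form v 0 y" using k(2)[OF v] by linarith
  qed
qed

context sphere_brownian
begin

text \<open>Up to the hitting time of \<open>Y\<close> the path keeps away from the poles, which lie
  in the interior of \<open>Y\<close>. The source is then at most
  \<open>e / \<kappa>\<^sup>2\<close> and disappears as \<open>e\<close> tends to 0. Replacing a
  smoothed logarithm by the exact one only lowers the left side, so the inequality survives the
  passage.\<close>

lemma mean_log_chordal_stopped:
  assumes Y: "compact Y" and S: "finite S" "S \<noteq> {}" "S \<subseteq> interior Y" and T: "T > 0"
  defines "\<sigma> \<equiv> stopped_time Z (to_sphere ` Y) T"
  shows "integrable M (\<lambda>w. mean_log_chordal S (Z (\<sigma> w) w))"
    and "(\<integral>w. mean_log_chordal S (Z (\<sigma> w) w) + \<sigma> w / 4 \<partial>M) \<le> 0"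
proof -
  define C where "C = to_sphere ` Y"
  have C: "closed C" "C \<noteq> {}" unfolding C_def using S interior_subset[of Y]
    by (auto intro!: compact_imp_closed compact_continuous_image continuous_on_to_sphere Y)
  obtain \<kappa> where \<kappa>: "\<kappa> > 0" "\<And>v y. v \<in> S \<Longrightarrow> y = sphere_infinity \<or> (\<exists>z\<in>closure (- Y). y = to_sphere z) \<Longrightarrow>
     chordal_form v 0 y \<ge> \<kappa>" by (rule chordal_form_0_ge_outside[OF S(1,3)]) blast
  have out: "chordal_form v 0 (Z u w) \<ge> \<kappa>" if "w \<in> space M" "0 \<le> u" "u \<le> \<sigma> w" "v \<in> S" for u v w
    using \<kappa>(2)[OF that(4) Z_stopped_outside[OF that(1) Y T that(2)]] that(3) by (simp add: \<sigma>_def)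
  have \<sigma>: "0 \<le> \<sigma> w" "\<sigma> w \<le> T" if "w \<in> space M" for w
    unfolding \<sigma>_def C_def[symmetric] using stopped_time_in[OF that C(1), of T] T by auto
  have sph: "Z (\<sigma> w) w \<in> sphere 0 1" if "w \<in> space M" for w
    using Z_sphere[OF that] \<sigma>[OF that] by blast
  have int1: "integrable M (\<lambda>w. ln (chordal_form v 0 (Z (\<sigma> w) w)) / 2)" if v: "v \<in> S" for v
  proof -
    obtain B where B: "\<And>y. y \<in> sphere 0 1 \<Longrightarrow> \<bar>chordal_form v 0 y\<bar> \<le> B"
      using continuous_on_compact_bounded[OF continuous_on_chordal_form compact_sphere] by blast
    have m: "(\<lambda>w. Z (\<sigma> w) w) \<in> borel_measurable M"
      unfolding \<sigma>_def C_def[symmetric] using Z_stopped_measurable[OF C] T by simp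
    have "(\<lambda>w. chordal_form v 0 (Z (\<sigma> w) w)) \<in> borel_measurable M"
      by (rule measurable_compose[OF m borel_measurable_continuous_onI[OF continuous_on_chordal_form]])
    then have "(\<lambda>w. ln (chordal_form v 0 (Z (\<sigma> w) w)) / 2) \<in> borel_measurable M" by measurable
    moreover have "\<bar>ln (chordal_form v 0 (Z (\<sigma> w) w)) / 2\<bar> \<le> \<bar>ln \<kappa>\<bar> + \<bar>ln B\<bar>" if w: "w \<in> space M" for w
    proof -
      have 1: "\<kappa> \<le> chordal_form v 0 (Z (\<sigma> w) w)" using out[OF w \<sigma>(1)[OF w] order_refl v] .
      moreover have 2: "chordal_form v 0 (Z (\<sigma> w) w) \<le> B" using B[OF sph[OF w]] by simp
      ultimately have "ln \<kappa> \<le> ln (chordal_form v 0 (Z (\<sigma> w) w))" "ln (chordal_form v 0 (Z (\<sigma> w) w)) \<le> ln B"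
        using \<kappa>(1) by (auto intro!: ln_mono)
      then show ?thesis by linarith
    qed
    ultimately show ?thesis by (intro integrable_const_bound[of _ "\<bar>ln \<kappa>\<bar> + \<bar>ln B\<bar>"] AE_I2) simp_all
  qed
  then show int2: "integrable M (\<lambda>w. mean_log_chordal S (Z (\<sigma> w) w))"
    unfolding mean_log_chordal_def by auto
  have int\<sigma>: "integrable M \<sigma>" unfolding \<sigma>_def C_def[symmetric] by (rule integrable_stopped_time[of 1, OF _ C T]) simp
  have le: "(\<integral>w. mean_log_chordal S (Z (\<sigma> w) w) + \<sigma> w / 4 \<partial>M) \<le> e / \<kappa>\<^sup>2 * T / 4" if e: "e > 0" for e
  proof -
    have i3: "integrable M (\<lambda>w. log_chordal v e (Z (\<sigma> w) w) + \<sigma> w / 4)" for v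
      using integrable_log_chordal_stopped[OF e C T, of v] int\<sigma> by (auto simp: \<sigma>_def C_def)
    have i4: "(\<integral>w. log_chordal v e (Z (\<sigma> w) w) + \<sigma> w / 4 \<partial>M) \<le> e / \<kappa>\<^sup>2 * T / 4" if v: "v \<in> S" for v
      unfolding \<sigma>_def C_def[symmetric]
    proof (rule log_chordal_stopped_le[OF e C T])
      fix w u assume w: "w \<in> space M" and u: "0 \<le> u" "u < stopped_time Z C T w"
      have "\<kappa> \<le> chordal_form v 0 (Z u w)" using out[OF w u(1) _ v] u by (simp add: \<sigma>_def C_def)
      also have "\<dots> \<le> chordal_form v e (Z u w)" using e by (intro chordal_form_0_le Z_sphere w u) simp
      finally show "e / (chordal_form v e (Z u w))\<^sup>2 \<le> e / \<kappa>\<^sup>2"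
        using \<kappa>(1) e by (intro divide_left_mono power_mono) auto
    qed (use e in simp)
    have "(\<integral>w. mean_log_chordal S (Z (\<sigma> w) w) + \<sigma> w / 4 \<partial>M) \<le>
        (\<integral>w. (\<Sum>v\<in>S. log_chordal v e (Z (\<sigma> w) w) + \<sigma> w / 4) / card S \<partial>M)"
    proof (rule integral_mono)
      fix w assume w: "w \<in> space M"
      have "ln (chordal_form v 0 (Z (\<sigma> w) w)) / 2 \<le> log_chordal v e (Z (\<sigma> w) w)" if v: "v \<in> S" for v
      proof -
        have "0 < chordal_form v 0 (Z (\<sigma> w) w)" using out[OF w \<sigma>(1)[OF w] order_refl v] \<kappa>(1) by linarith
        then show ?thesis unfolding log_chordal_sphere[OF sph[OF w]]
          using chordal_form_0_le[OF less_imp_le[OF e] sph[OF w], of v] by (simp add: ln_mono)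
      qed
      then have "(\<Sum>v\<in>S. ln (chordal_form v 0 (Z (\<sigma> w) w)) / 2) \<le> (\<Sum>v\<in>S. log_chordal v e (Z (\<sigma> w) w))"
        by (rule sum_mono)
      then have "mean_log_chordal S (Z (\<sigma> w) w) \<le> (\<Sum>v\<in>S. log_chordal v e (Z (\<sigma> w) w)) / card S"
        unfolding mean_log_chordal_def by (rule divide_right_mono) simp
      then show "mean_log_chordal S (Z (\<sigma> w) w) + \<sigma> w / 4 \<le>
          (\<Sum>v\<in>S. log_chordal v e (Z (\<sigma> w) w) + \<sigma> w / 4) / card S"
        using S by (simp add: sum.distrib add_divide_distrib)
    qed (use int2 int\<sigma> i3 in auto)
    also have "\<dots> = (\<Sum>v\<in>S. (\<integral>w. log_chordal v e (Z (\<sigma> w) w) + \<sigma> w / 4 \<partial>M)) / card S"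
      using Bochner_Integration.integral_sum[of S M "\<lambda>v w. log_chordal v e (Z (\<sigma> w) w) + \<sigma> w / 4"] i3 by simp
    also have "\<dots> \<le> (\<Sum>v\<in>S. e / \<kappa>\<^sup>2 * T / 4) / card S"
      by (intro divide_right_mono sum_mono i4) auto
    also have "\<dots> = e / \<kappa>\<^sup>2 * T / 4" using S by simp
    finally show ?thesis .
  qed
  show "(\<integral>w. mean_log_chordal S (Z (\<sigma> w) w) + \<sigma> w / 4 \<partial>M) \<le> 0"
  proof (rule field_le_epsilon)
    fix \<epsilon> :: real assume "\<epsilon> > 0"
    \<comment> \<open>For this value of \<open>e\<close> the error
      \<open>e / \<kappa>\<^sup>2 * T / 4\<close> is exactly \<epsilon>.\<close>
    then have "4 * \<epsilon> * \<kappa>\<^sup>2 / T > 0" using \<kappa> T by simp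
    from le[OF this] show "(\<integral>w. mean_log_chordal S (Z (\<sigma> w) w) + \<sigma> w / 4 \<partial>M) \<le> 0 + \<epsilon>"
      using \<kappa>(1) T by simp
  qed
qed

end

section \<open>First entry into a decreasing intersection of compact sets\<close>

lemma to_sphere_inj: "to_sphere x = to_sphere y \<longleftrightarrow> x = y"
  by (metis from_sphere_to_sphere)

lemma from_sphere_measurable: "from_sphere \<in> borel_measurable borel"
  unfolding from_sphere_def
  by (intro borel_measurable_divide borel_measurable_continuous_onI continuous_intros)

lemma stopped_time_antimono:
  assumes "C \<subseteq> D" "T \<ge> 0"
  shows "stopped_time Z D T w \<le> stopped_time Z C T w"
  unfolding stopped_time_def
  by (rule cInf_superset_mono) (use assms in \<open>auto intro!: bdd_belowI[of _ 0]\<close>)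

context sphere_brownian
begin

text \<open>The hitting times increase to some \<open>L\<close>. If \<open>L\<close> is smaller than
  the hitting time of the intersection, then it lies before the cap, so each \<open>Y n\<close> has
  really been hit; closedness and nesting put the path at time \<open>L\<close> into every
  \<open>Y m\<close>, a contradiction.\<close>

lemma stopped_time_decreasing_sets:
  assumes w: "w \<in> space M" and Y: "\<And>n. compact (Y n)" "\<And>n. Y (Suc n) \<subseteq> Y n" and T: "T \<ge> 0"
  shows "(\<lambda>n. stopped_time Z (to_sphere ` Y n) T w) \<longlonglongrightarrow> stopped_time Z (to_sphere ` (\<Inter>n. Y n)) T w"
proof -
  define s where "s n = stopped_time Z (to_sphere ` Y n) T w" for n
  define \<sigma> where "\<sigma> = stopped_time Z (to_sphere ` (\<Inter>n. Y n)) T w"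
  have C: "closed (to_sphere ` Y n)" for n
    by (intro compact_imp_closed compact_continuous_image continuous_on_to_sphere Y)
  have s_le: "s n \<le> \<sigma>" for n
    unfolding s_def \<sigma>_def by (intro stopped_time_antimono image_mono T) auto
  have s_mono: "incseq s"
    unfolding s_def by (intro incseq_SucI stopped_time_antimono image_mono Y T)
  have s_range: "0 \<le> s n" "s n \<le> T" for n
    using stopped_time_in[OF w C T] by (auto simp: s_def)
  obtain L where L: "s \<longlonglongrightarrow> L" "\<And>n. s n \<le> L"
    using incseq_convergent[OF s_mono, of \<sigma>] s_le by blast
  have L0: "0 \<le> L" "L \<le> \<sigma>"
    using L(2)[of 0] s_range[of 0] LIMSEQ_le_const2[OF L(1)] s_le by auto
  have \<sigma>T: "\<sigma> \<le> T" unfolding \<sigma>_def stopped_time_def using T by (intro cInf_lower bdd_belowI[of _ 0]) auto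
  have "L = \<sigma>"
  proof (rule ccontr)
    assume "L \<noteq> \<sigma>"
    with L0 \<sigma>T have "L < \<sigma>" "L < T" by auto
    have hit: "Z (s n) w \<in> to_sphere ` Y n" for n
      unfolding s_def
      by (rule stopped_time_hits[of Z w "to_sphere ` Y n" T, OF Z_cont[OF w] C T])
         (use L(2)[of n] \<open>L < T\<close> in \<open>simp add: s_def\<close>)
    have lim: "(\<lambda>n. Z (s n) w) \<longlonglongrightarrow> Z L w"
      by (rule continuous_on_tendsto_compose[OF Z_cont[OF w] L(1)]) (use L0 s_range in auto)
    have ZL: "Z L w \<in> to_sphere ` Y m" for m
    proof (rule Lim_in_closed_set[OF C _ _ lim])
      show "eventually (\<lambda>n. Z (s n) w \<in> to_sphere ` Y m) sequentially"
        using eventually_ge_at_top[of m]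
      proof eventually_elim
        case (elim n)
        have "Y n \<subseteq> Y m" using lift_Suc_antimono_le[of Y, OF Y(2) elim] .
        then show ?case using hit[of n] by blast
      qed
    qed simp
    then have "from_sphere (Z L w) \<in> Y m" for m
      using from_sphere_to_sphere by (metis imageE)
    then have "Z L w \<in> to_sphere ` (\<Inter>n. Y n)"
      using ZL[of 0] from_sphere_to_sphere by (metis INT_I imageE imageI)
    then have "\<sigma> \<le> L" unfolding \<sigma>_def
      using stopped_time_le[of L T Z w "to_sphere ` (\<Inter>n. Y n)"] L0 \<open>L < T\<close> by auto
    with \<open>L < \<sigma>\<close> show False by simp
  qed
  with L(1) show ?thesis by (simp add: s_def[abs_def] \<sigma>_def)
qed

text \<open>Two estimates with the same time term are subtracted: a pole \<open>v\<close> outside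
  \<open>K\<close> gives an expectation of at least - E \<sigma> / 4, and the poles in
  \<open>S n\<close> give one of at most - E \<sigma> / 4 in the limit. The limits are taken in the
  order \<open>n\<close> to infinity, so that \<open>Y n\<close> shrinks to \<open>K\<close>, then
  \<open>T\<close> to infinity, then \<open>e\<close> to 0. The bound \<open>lb1\<close> is applied
  to paths that have entered \<open>K\<close>, and \<open>lb2\<close> to those still outside at time
  \<open>T\<close>.\<close>

lemma entry_potential_ge:
  fixes Y S :: "nat \<Rightarrow> complex set"
  assumes Y: "\<And>n. compact (Y n)" "\<And>n. Y (Suc n) \<subseteq> Y n" and K: "K = (\<Inter>n. Y n)" "k0 \<in> K"
    and S: "\<And>n. finite (S n)" "\<And>n. S n \<noteq> {}" "\<And>n. S n \<subseteq> interior (Y n)"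
    and lb1: "\<And>n z. z \<in> closure (- Y n) \<Longrightarrow> mean_log (S n) z \<ge> - g n"
    and lb2: "\<And>n z. z \<in> closure (- Y n) \<Longrightarrow> mean_log (S n) z \<ge> ln (1 + (norm z)\<^sup>2) / 2 - C1"
    and C1: "C1 \<ge> 0" and g: "g \<longlonglongrightarrow> \<gamma>"
  defines "X \<equiv> \<lambda>w. if enters Z K w then first_entry_point Z K w else k0"
  shows "{w \<in> space M. enters Z K w} \<in> sets M"
    and "AE w in M. enters Z K w"
    and "X \<in> borel_measurable M"
    and "\<And>w. w \<in> space M \<Longrightarrow> X w \<in> K"
    and "\<And>w. w \<in> space M \<Longrightarrow> enters Z K w \<Longrightarrow> X w \<in> frontier K"
    and "\<And>v. v \<notin> K \<Longrightarrow> (\<integral>w. ln (norm (X w - v)) \<partial>M) \<ge> - \<gamma>"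
proof -
  define CK where "CK = to_sphere ` K"
  define \<sigma> where "\<sigma> T = stopped_time Z CK T" for T
  define \<sigma>n where "\<sigma>n n T = stopped_time Z (to_sphere ` Y n) T" for n T
  define hit where "hit T w \<longleftrightarrow> (\<exists>t\<in>{0..T}. Z t w \<in> CK)" for T w
  define XT where "XT T w = (if hit T w then from_sphere (Z (\<sigma> T w) w) else k0)" for T w
  have KY: "K \<subseteq> Y n" for n using K by auto
  have Kc: "compact K" unfolding K(1) using Y(1) by (intro compact_Inter) auto
  have CK: "closed CK" "CK \<noteq> {}"
    unfolding CK_def using K(2) by (auto intro!: compact_imp_closed compact_continuous_image continuous_on_to_sphere Kc)
  have Cn: "closed (to_sphere ` Y n)" "to_sphere ` Y n \<noteq> {}" for n
    using K(2) KY by (auto intro!: compact_imp_closed compact_continuous_image continuous_on_to_sphere Y)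
  have not_inf: "to_sphere z \<noteq> sphere_infinity" for z using to_sphere_in_sphere[of z] by simp
  have \<sigma>_range: "0 \<le> \<sigma> T w" "\<sigma> T w \<le> T" if "w \<in> space M" "T > 0" for T w
    using stopped_time_in[OF that(1) CK(1), of T] that(2) by (auto simp: \<sigma>_def)
  have \<sigma>n_range: "0 \<le> \<sigma>n n T w" "\<sigma>n n T w \<le> T" if "w \<in> space M" "T > 0" for T w n
    using stopped_time_in[OF that(1) Cn(1), of T] that(2) by (auto simp: \<sigma>n_def)
  have hit_entry: "enters Z K w" "X w = XT T w" "to_sphere (X w) = Z (\<sigma> T w) w" "X w \<in> K"
    if w: "w \<in> space M" and h: "hit T w" for w T
  proof -
    from h obtain t where t: "0 \<le> t" "t \<le> T" "Z t w \<in> to_sphere ` K" by (auto simp: hit_def CK_def)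
    note e = stopped_time_eq_first_entry[OF w CK(1)[unfolded CK_def] t]
    show en: "enters Z K w" using t by (auto simp: enters_def)
    show X: "X w = XT T w" using e(3) en h by (simp add: X_def XT_def \<sigma>_def CK_def)
    obtain z where "z \<in> K" "Z (\<sigma> T w) w = to_sphere z" using e(2) by (auto simp: \<sigma>_def CK_def)
    then show "to_sphere (X w) = Z (\<sigma> T w) w" "X w \<in> K"
      unfolding X XT_def using h by (simp_all add: from_sphere_to_sphere)
  qed
  have enters_hit: "\<exists>N. \<forall>T\<ge>real N. hit T w" if en: "enters Z K w" for w
  proof -
    have "\<exists>t\<ge>0. Z t w \<in> CK" using en by (simp only: enters_def CK_def)
    then obtain t where t: "t \<ge> 0" "Z t w \<in> CK" by (elim exE conjE)
    obtain N where "t \<le> real N" using real_arch_simple by blast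
    then show ?thesis using t by (intro exI[of _ N]) (auto simp: hit_def)
  qed
  have hit_sets: "{w \<in> space M. hit T w} \<in> sets M" if T: "T \<ge> 0" for T
  proof -
    \<comment> \<open>The horizon is \<open>T + 1\<close> because a time capped at \<open>T\<close>
      equals \<open>T\<close> both for a path that hits exactly at \<open>T\<close> and for one that
      has not hit at all.\<close>
    have eq: "{w \<in> space M. hit T w} = space M - {w \<in> space M. T < \<sigma> (T + 1) w}"
      using less_stopped_time_iff[of Z _ CK T "T + 1", OF Z_cont CK(1) T] by (auto simp: hit_def \<sigma>_def)
    have "\<sigma> (T + 1) \<in> borel_measurable M"
      unfolding \<sigma>_def using stopped_time_measurable[OF CK, of "T + 1"] T by simp
    then have "{w \<in> space M. T < \<sigma> (T + 1) w} \<in> sets M" by simp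
    then show ?thesis unfolding eq by (rule sets.compl_sets)
  qed
  have enters_eq: "{w \<in> space M. enters Z K w} = (\<Union>N. {w \<in> space M. hit (real N) w})"
  proof (intro set_eqI iffI)
    fix w assume "w \<in> {w \<in> space M. enters Z K w}"
    then have w: "w \<in> space M" and "enters Z K w" by simp_all
    from enters_hit[OF this(2)] obtain N where "hit (real N) w" by (meson order_refl)
    with w show "w \<in> (\<Union>N. {w \<in> space M. hit (real N) w})" by (intro UN_I[of N]) simp_all
  next
    fix w assume "w \<in> (\<Union>N. {w \<in> space M. hit (real N) w})"
    then have "\<exists>N::nat. w \<in> space M \<and> hit (real N) w" by simp
    then obtain N :: nat where "w \<in> space M" "hit (real N) w" by (elim exE conjE)
    then show "w \<in> {w \<in> space M. enters Z K w}" using hit_entry(1) by simp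
  qed
  show enters_sets: "{w \<in> space M. enters Z K w} \<in> sets M"
    unfolding enters_eq using hit_sets by (intro sets.countable_UN) auto
  have XT_meas: "XT T \<in> borel_measurable M" if T: "T \<ge> 0" for T
  proof -
    have "(\<lambda>w. from_sphere (Z (\<sigma> T w) w)) \<in> borel_measurable M"
      unfolding \<sigma>_def by (rule measurable_compose[OF Z_stopped_measurable[OF CK T] from_sphere_measurable])
    then show ?thesis unfolding XT_def using hit_sets[OF T]
      by (intro measurable_If) auto
  qed
  have XT_lim: "eventually (\<lambda>N. XT (real N) w = X w) sequentially" if w: "w \<in> space M" for w
  proof (cases "enters Z K w")
    case True
    then obtain N where "\<forall>T\<ge>real N. hit T w" using enters_hit by blast
    then have "XT (real n) w = X w" if "N \<le> n" for n
      using hit_entry(2)[OF w, of "real n"] that by simp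
    then show ?thesis by (rule eventually_sequentiallyI)
  next
    case False
    then have "\<not> hit T w" for T using hit_entry(1)[OF w] by blast
    with False show ?thesis by (simp add: XT_def X_def)
  qed
  show X_meas: "X \<in> borel_measurable M"
    by (rule borel_measurable_LIMSEQ_metric[where f="\<lambda>N. XT (real N)"])
       (use XT_meas tendsto_eventually[OF XT_lim] in auto)
  show XK: "X w \<in> K" if "w \<in> space M" for w
    using that enters_hit hit_entry(4)[OF that] K(2) by (cases "enters Z K w") (auto simp: X_def)
  show "X w \<in> frontier K" if w: "w \<in> space M" and en: "enters Z K w" for w
  proof -
    obtain N where N: "hit (real (Suc N)) w" using enters_hit[OF en] by (meson le_SucI of_nat_le_iff order_refl)
    have "Z (\<sigma> (Suc N) w) w = sphere_infinity \<or> (\<exists>z\<in>closure (- K). Z (\<sigma> (Suc N) w) w = to_sphere z)"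
      unfolding \<sigma>_def CK_def
      by (rule Z_stopped_outside[OF w Kc]) (use \<sigma>_range[OF w, of "Suc N"] in \<open>auto simp: \<sigma>_def CK_def\<close>)
    then have "X w \<in> closure (- K)"
      using hit_entry(3)[OF w N] not_inf[of "X w"] to_sphere_inj by metis
    with XK[OF w] show ?thesis by (simp add: frontier_closures closure_subset[THEN subsetD])
  qed
  obtain r where r: "r > 0" "\<And>z. z \<in> Y 0 \<Longrightarrow> norm z \<le> r"
    using compact_imp_bounded[OF Y(1)[of 0]] by (auto simp: bounded_pos)
  have Yn0: "Y n \<subseteq> Y 0" for n using lift_Suc_antimono_le[of Y, OF Y(2), of 0 n] by simp
  have ln_r: "0 \<le> ln (1 + (norm z)\<^sup>2) / 2" "ln (1 + (norm z)\<^sup>2) / 2 \<le> ln (1 + r\<^sup>2) / 2" if "z \<in> Y 0" for z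
  proof -
    have "(norm z)\<^sup>2 \<le> r\<^sup>2" using r(2)[OF that] by (intro power_mono) auto
    moreover have "1 + (norm z)\<^sup>2 > 0" by (simp add: add_pos_nonneg)
    ultimately show "0 \<le> ln (1 + (norm z)\<^sup>2) / 2" "ln (1 + (norm z)\<^sup>2) / 2 \<le> ln (1 + r\<^sup>2) / 2"
      by (auto intro!: ln_mono ln_ge_zero)
  qed
  obtain B where B: "\<And>n. \<bar>g n\<bar> \<le> B"
    using convergent_imp_Bseq[of g] g by (auto simp: convergent_def Bseq_def)
  have B\<gamma>: "\<bar>\<gamma>\<bar> \<le> B" using LIMSEQ_le_const2[OF tendsto_rabs[OF g]] B by blast
  \<comment> \<open>A common bound for \<open>G\<close> and \<open>Ginf\<close>. It does not depend
    on \<open>T\<close>, which is what makes the later estimate of the expected stopping time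
    useful.\<close>
  define B' where "B' = B + ln (1 + r\<^sup>2) / 2 + C1"
  have r1: "ln (1 + r\<^sup>2) \<ge> 0" by (simp add: ln_ge_zero)
  have B'0: "B' \<ge> 0" "B \<ge> 0" using B[of 0] r1 C1 by (auto simp: B'_def)
  \<comment> \<open>A lower bound for \<open>mean_log_chordal (S n)\<close> at the stopped point,
    chosen so that it converges as \<open>n\<close> grows: on paths that hit \<open>K\<close> by
    time \<open>T\<close> it comes from \<open>lb1\<close>, on the others it is the constant from
    \<open>lb2\<close>, which also covers the point at infinity.\<close>
  define G where "G n T w = (if hit T w then - g n - ln (1 + (norm (from_sphere (Z (\<sigma>n n T w) w)))\<^sup>2) / 2 else - C1)" for n T w
  define Ginf where "Ginf T w = (if hit T w then - \<gamma> - ln (1 + (norm (X w))\<^sup>2) / 2 else - C1)" for T w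
  have hit_n: "\<exists>z\<in>Y n. Z (\<sigma>n n T w) w = to_sphere z" if w: "w \<in> space M" and h: "hit T w" for n T w
  proof -
    from h obtain t where t0: "t \<in> {0..T}" "Z t w \<in> CK" unfolding hit_def by blast
    have "CK \<subseteq> to_sphere ` Y n" unfolding CK_def by (intro image_mono KY)
    then have t: "0 \<le> t" "t \<le> T" "Z t w \<in> to_sphere ` Y n" using t0 by auto
    from stopped_time_eq_first_entry(2)[OF w Cn(1) t] show ?thesis by (auto simp: \<sigma>n_def)
  qed
  have G_bound: "\<bar>G n T w\<bar> \<le> B'" if w: "w \<in> space M" for n T w
  proof (cases "hit T w")
    case True
    then obtain z where z: "z \<in> Y n" "Z (\<sigma>n n T w) w = to_sphere z" using hit_n[OF w] by blast
    have "z \<in> Y 0" using z(1) Yn0 by blast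
    moreover have "G n T w = - g n - ln (1 + (norm z)\<^sup>2) / 2"
      using True z(2) by (simp add: G_def from_sphere_to_sphere)
    ultimately show ?thesis using ln_r[of z] B[of n] C1 unfolding B'_def by linarith
  next
    case False then show ?thesis using r1 C1 B'0 by (simp add: G_def B'_def)
  qed
  have Ginf_bound: "\<bar>Ginf T w\<bar> \<le> B'" if w: "w \<in> space M" for T w
  proof -
    have "X w \<in> Y 0" using XK[OF w] KY[of 0] by blast
    then have "\<bar>- \<gamma> - ln (1 + (norm (X w))\<^sup>2) / 2\<bar> \<le> B'"
      using ln_r[of "X w"] B\<gamma> C1 unfolding B'_def by linarith
    then show ?thesis using C1 r1 B'0(2) by (auto simp: Ginf_def B'_def)
  qed
  have \<sigma>n_meas: "\<sigma>n n T \<in> borel_measurable M" if "T > 0" for n T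
    unfolding \<sigma>n_def using stopped_time_measurable[OF Cn, of T] that by simp
  have \<sigma>_meas: "\<sigma> T \<in> borel_measurable M" if "T > 0" for T
    unfolding \<sigma>_def using stopped_time_measurable[OF CK, of T] that by simp
  have G_meas: "G n T \<in> borel_measurable M" if T: "T > 0" for n T
  proof -
    have "(\<lambda>w. from_sphere (Z (\<sigma>n n T w) w)) \<in> borel_measurable M"
      unfolding \<sigma>n_def using T by (intro measurable_compose[OF Z_stopped_measurable[OF Cn] from_sphere_measurable]) simp
    then have m: "(\<lambda>w. - g n - ln (1 + (norm (from_sphere (Z (\<sigma>n n T w) w)))\<^sup>2) / 2) \<in> borel_measurable M"
      by measurable
    show ?thesis unfolding G_def using hit_sets[of T] T
      by (intro measurable_If m) auto
  qed
  have Ginf_meas: "Ginf T \<in> borel_measurable M" if T: "T > 0" for T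
  proof -
    have m: "(\<lambda>w. - \<gamma> - ln (1 + (norm (X w))\<^sup>2) / 2) \<in> borel_measurable M"
      using X_meas by measurable
    show ?thesis unfolding Ginf_def using hit_sets[of T] T
      by (intro measurable_If m) auto
  qed
  have int\<sigma>n: "integrable M (\<sigma>n n T)" if "T > 0" for n T
    using \<sigma>n_range that by (intro integrable_const_bound[OF _ \<sigma>n_meas[OF that], where B="T"]) auto
  have int\<sigma>: "integrable M (\<sigma> T)" if "T > 0" for T
    using \<sigma>_range that by (intro integrable_const_bound[OF _ \<sigma>_meas[OF that], where B="T"]) auto
  have intG: "integrable M (G n T)" if "T > 0" for n T
    using G_bound by (intro integrable_const_bound[OF _ G_meas[OF that], where B="B'"]) auto
  have intGinf: "integrable M (Ginf T)" if "T > 0" for T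
    using Ginf_bound by (intro integrable_const_bound[OF _ Ginf_meas[OF that], where B="B'"]) auto
  have EG: "(\<integral>w. G n T w + \<sigma>n n T w / 4 \<partial>M) \<le> 0" if T: "T > 0" for n T
  proof -
    note st = mean_log_chordal_stopped[OF Y(1)[of n] S(1)[of n] S(2)[of n] S(3)[of n] T, folded \<sigma>n_def]
    have "(\<integral>w. G n T w + \<sigma>n n T w / 4 \<partial>M) \<le> (\<integral>w. mean_log_chordal (S n) (Z (\<sigma>n n T w) w) + \<sigma>n n T w / 4 \<partial>M)"
    proof (rule integral_mono)
      show "integrable M (\<lambda>w. G n T w + \<sigma>n n T w / 4)" using intG[OF T] int\<sigma>n[OF T] by simp
      show "integrable M (\<lambda>w. mean_log_chordal (S n) (Z (\<sigma>n n T w) w) + \<sigma>n n T w / 4)" using st(1) int\<sigma>n[OF T] by simp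
      fix w assume w: "w \<in> space M"
      have out: "Z (\<sigma>n n T w) w = sphere_infinity \<or> (\<exists>z\<in>closure (- Y n). Z (\<sigma>n n T w) w = to_sphere z)"
        unfolding \<sigma>n_def
        by (rule Z_stopped_outside[OF w Y(1) T]) (use \<sigma>n_range[OF w T] in \<open>auto simp: \<sigma>n_def\<close>)
      have val: "mean_log_chordal (S n) (to_sphere z) = mean_log (S n) z - ln (1 + (norm z)\<^sup>2) / 2"
        if "z \<in> closure (- Y n)" for z
        using that S(3)[of n] by (intro mean_log_chordal_to_sphere S) (auto simp: closure_complement)
      have "G n T w \<le> mean_log_chordal (S n) (Z (\<sigma>n n T w) w)"
      proof (cases "hit T w")
        case True
        then obtain z where z: "z \<in> Y n" "Z (\<sigma>n n T w) w = to_sphere z" using hit_n[OF w] by blast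
        then have "z \<in> closure (- Y n)" using out not_inf to_sphere_inj by metis
        then show ?thesis using lb1[of z n] True by (simp add: z(2) G_def from_sphere_to_sphere val)
      next
        case False
        from out show ?thesis
        proof
          assume "Z (\<sigma>n n T w) w = sphere_infinity"
          then show ?thesis using False C1 by (simp add: G_def mean_log_chordal_infinity)
        next
          assume "\<exists>z\<in>closure (- Y n). Z (\<sigma>n n T w) w = to_sphere z"
          then obtain z where z: "z \<in> closure (- Y n)" "Z (\<sigma>n n T w) w = to_sphere z" by blast
          then show ?thesis using False lb2[OF z(1)] by (simp add: G_def val)
        qed
      qed
      then show "G n T w + \<sigma>n n T w / 4 \<le> mean_log_chordal (S n) (Z (\<sigma>n n T w) w) + \<sigma>n n T w / 4" by simp
    qed
    also have "\<dots> \<le> 0" by (rule st(2))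
    finally show ?thesis .
  qed
  have EGinf: "(\<integral>w. Ginf T w + \<sigma> T w / 4 \<partial>M) \<le> 0" if T: "T > 0" for T
  proof (rule LIMSEQ_le_const2)
    show "(\<lambda>n. \<integral>w. G n T w + \<sigma>n n T w / 4 \<partial>M) \<longlonglongrightarrow> (\<integral>w. Ginf T w + \<sigma> T w / 4 \<partial>M)"
    proof (rule integral_dominated_convergence[where w="\<lambda>_. B' + T"])
      show "AE w in M. (\<lambda>n. G n T w + \<sigma>n n T w / 4) \<longlonglongrightarrow> Ginf T w + \<sigma> T w / 4"
      proof (rule AE_I2)
        fix w assume w: "w \<in> space M"
        have \<sigma>lim: "(\<lambda>n. \<sigma>n n T w) \<longlonglongrightarrow> \<sigma> T w"
          unfolding \<sigma>n_def \<sigma>_def CK_def K(1) using T by (intro stopped_time_decreasing_sets w Y) simp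
        have "(\<lambda>n. G n T w) \<longlonglongrightarrow> Ginf T w"
        proof (cases "hit T w")
          case True
          have Zlim: "(\<lambda>n. Z (\<sigma>n n T w) w) \<longlonglongrightarrow> Z (\<sigma> T w) w"
            by (rule continuous_on_tendsto_compose[OF Z_cont[OF w] \<sigma>lim]) (use \<sigma>_range[OF w T] \<sigma>n_range[OF w T] in auto)
          have "(\<lambda>n. from_sphere (Z (\<sigma>n n T w) w)) \<longlonglongrightarrow> from_sphere (Z (\<sigma> T w) w)"
          proof (rule continuous_on_tendsto_compose[OF continuous_on_from_sphere Zlim])
            show "Z (\<sigma> T w) w \<in> sphere 0 1 - {sphere_infinity}"
              using hit_entry(3)[OF w True] to_sphere_in_sphere[of "X w"] by simp
            show "\<forall>\<^sub>F n in sequentially. Z (\<sigma>n n T w) w \<in> sphere 0 1 - {sphere_infinity}"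
              using hit_n[OF w True] to_sphere_in_sphere by (intro always_eventually) metis
          qed
          also have "from_sphere (Z (\<sigma> T w) w) = X w"
            using hit_entry(2)[OF w True] True by (simp add: XT_def)
          finally have "(\<lambda>n. - g n - ln (1 + (norm (from_sphere (Z (\<sigma>n n T w) w)))\<^sup>2) / 2) \<longlonglongrightarrow> - \<gamma> - ln (1 + (norm (X w))\<^sup>2) / 2"
            by (intro tendsto_intros g) (auto simp: add_pos_nonneg order_less_imp_not_eq2)
          then show ?thesis using True by (simp add: G_def[abs_def] Ginf_def)
        qed (simp add: G_def Ginf_def)
        then show "(\<lambda>n. G n T w + \<sigma>n n T w / 4) \<longlonglongrightarrow> Ginf T w + \<sigma> T w / 4"
          by (intro tendsto_intros \<sigma>lim) auto
      qed
      show "AE w in M. norm (G n T w + \<sigma>n n T w / 4) \<le> B' + T" for n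
      proof (rule AE_I2)
        fix w assume w: "w \<in> space M"
        show "norm (G n T w + \<sigma>n n T w / 4) \<le> B' + T"
          using G_bound[OF w, of n T] \<sigma>n_range[OF w T, of n] by (simp add: abs_le_iff)
      qed
    qed (use intG[OF T] int\<sigma>n[OF T] intGinf[OF T] int\<sigma>[OF T] in auto)
  qed (use EG[OF T] in blast)
  \<comment> \<open>The bound is uniform in \<open>T\<close>, while \<sigma> equals \<open>T\<close>
    on every path that never enters \<open>K\<close>. Hence these paths have probability
    zero.\<close>
  have E\<sigma>: "(\<integral>w. \<sigma> T w \<partial>M) \<le> 4 * B'" if T: "T > 0" for T
  proof -
    have "(\<integral>w. \<sigma> T w / 4 \<partial>M) \<le> (\<integral>w. (Ginf T w + \<sigma> T w / 4) + B' \<partial>M)"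
    proof (rule integral_mono)
      fix w assume w: "w \<in> space M"
      show "\<sigma> T w / 4 \<le> Ginf T w + \<sigma> T w / 4 + B'" using Ginf_bound[OF w, of T] by linarith
    qed (use intGinf[OF T] int\<sigma>[OF T] in auto)
    also have "\<dots> = (\<integral>w. Ginf T w + \<sigma> T w / 4 \<partial>M) + B'"
      using intGinf[OF T] int\<sigma>[OF T] by (subst Bochner_Integration.integral_add) (auto simp: prob_space)
    also have "\<dots> \<le> B'" using EGinf[OF T] by simp
    finally show ?thesis by simp
  qed
  show AE_enters: "AE w in M. enters Z K w"
  proof -
    define A where "A = {w \<in> space M. \<not> enters Z K w}"
    have A: "A \<in> sets M"
    proof -
      have "A = space M - {w \<in> space M. enters Z K w}" by (auto simp: A_def)
      then show ?thesis using enters_sets by simp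
    qed
    have le: "T * measure M A \<le> 4 * B'" if T: "T > 0" for T
    proof -
      have "T * measure M A = (\<integral>w. T * indicator A w \<partial>M)" using A by simp
      also have "\<dots> \<le> (\<integral>w. \<sigma> T w \<partial>M)"
      proof (rule integral_mono)
        fix w assume w: "w \<in> space M"
        have "\<sigma> T w = T" if "w \<in> A"
        proof -
          have "\<not> hit T w" using hit_entry(1)[OF w] that by (auto simp: A_def)
          then show ?thesis
            using stopped_time_mem[of Z w CK T, OF Z_cont[OF w] CK(1)] T by (auto simp: \<sigma>_def hit_def)
        qed
        then show "T * indicator A w \<le> \<sigma> T w" using \<sigma>_range[OF w T] by (cases "w \<in> A") auto
      qed (use A int\<sigma>[OF T] in \<open>auto simp: emeasure_eq_measure\<close>)
      also have "\<dots> \<le> 4 * B'" by (rule E\<sigma>[OF T])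
      finally show ?thesis .
    qed
    have "measure M A = 0"
    proof (rule ccontr)
      assume "measure M A \<noteq> 0"
      then have "measure M A > 0" by (simp add: zero_less_measure_iff)
      then show False using le[of "(4 * B' + 1) / measure M A"] B'0 by simp
    qed
    then have "emeasure M A = 0" by (simp add: emeasure_eq_measure)
    then show ?thesis using A by (intro AE_I'[of A]) (auto simp: A_def null_sets_def)
  qed
  fix v assume v: "v \<notin> K"
  have ball: "\<exists>\<delta>>0. \<forall>z\<in>K. norm (z - v) \<ge> \<delta>"
  proof -
    have "setdist {v} K > 0" using v Kc K(2) by (subst setdist_gt_0_compact_closed) (auto intro: compact_imp_closed)
    moreover have "norm (z - v) \<ge> setdist {v} K" if "z \<in> K" for z
      using setdist_le_dist[of v "{v}" z K] that by (simp add: dist_norm norm_minus_commute)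
    ultimately show ?thesis by blast
  qed
  then obtain \<delta> where \<delta>: "\<delta> > 0" "\<And>z. z \<in> K \<Longrightarrow> norm (z - v) \<ge> \<delta>" by blast
  \<comment> \<open>Here \<open>T\<close> tends to infinity. A path that enters \<open>K\<close> is
    stopped at \<open>X w\<close> for all large \<open>T\<close>, so the integrands are eventually
    constant, and the two terms \<open>ln (1 + (norm (X w))\<^sup>2) / 2\<close> cancel.\<close>
  have E1: "(\<integral>w. ln ((norm (X w - v))\<^sup>2 + e) / 2 + \<gamma> \<partial>M) \<ge> 0" if e: "e > 0" for e
  proof -
    obtain B1 where B1: "\<And>y. y \<in> sphere 0 1 \<Longrightarrow> \<bar>log_chordal v e y\<bar> \<le> B1"
      using continuous_on_compact_bounded[OF continuous_on_log_chordal_sphere[OF e] compact_sphere] by blast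
    have sph: "Z (\<sigma> T w) w \<in> sphere 0 1" if "w \<in> space M" "T > 0" for T w
      using Z_sphere[OF that(1)] \<sigma>_range[OF that] by blast
    have iL: "integrable M (\<lambda>w. log_chordal v e (Z (\<sigma> T w) w))" if "T > 0" for T
      unfolding \<sigma>_def by (rule integrable_log_chordal_stopped[OF e CK that])
    have ge: "(\<integral>w. log_chordal v e (Z (\<sigma> T w) w) - Ginf T w \<partial>M) \<ge> 0" if T: "T > 0" for T
    proof -
      have "(\<integral>w. log_chordal v e (Z (\<sigma> T w) w) - Ginf T w \<partial>M) =
          (\<integral>w. (log_chordal v e (Z (\<sigma> T w) w) + \<sigma> T w / 4) - (Ginf T w + \<sigma> T w / 4) \<partial>M)"
        by (rule Bochner_Integration.integral_cong) auto
      also have "\<dots> = (\<integral>w. log_chordal v e (Z (\<sigma> T w) w) + \<sigma> T w / 4 \<partial>M) - (\<integral>w. Ginf T w + \<sigma> T w / 4 \<partial>M)"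
        by (rule Bochner_Integration.integral_diff) (use iL[OF T] int\<sigma>[OF T] intGinf[OF T] in auto)
      also have "\<dots> \<ge> 0"
        using EGinf[OF T] log_chordal_stopped_ge[OF e CK T, of v] by (simp add: \<sigma>_def)
      finally show ?thesis .
    qed
    have lim: "AE w in M. (\<lambda>N. log_chordal v e (Z (\<sigma> (Suc N) w) w) - Ginf (Suc N) w)
        \<longlonglongrightarrow> ln ((norm (X w - v))\<^sup>2 + e) / 2 + \<gamma>"
      using AE_enters
    proof (rule AE_mp, intro AE_I2 impI)
      fix w assume w: "w \<in> space M" and en: "enters Z K w"
      then obtain N0 where N0: "\<forall>T\<ge>real N0. hit T w" using enters_hit by blast
      have "log_chordal v e (Z (\<sigma> (Suc N) w) w) - Ginf (Suc N) w = ln ((norm (X w - v))\<^sup>2 + e) / 2 + \<gamma>" if "N \<ge> N0" for N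
      proof -
        have h: "hit (Suc N) w" using N0 that by auto
        have p: "(norm (X w - v))\<^sup>2 + e > 0" "1 + (norm (X w))\<^sup>2 > 0" using e by (auto simp: add_nonneg_pos add_pos_nonneg)
        have "log_chordal v e (Z (\<sigma> (Suc N) w) w) = ln (chordal_form v e (to_sphere (X w))) / 2"
          using hit_entry(3)[OF w h] sph[OF w, of "Suc N"] by (subst log_chordal_sphere) auto
        then show ?thesis using h p by (simp add: Ginf_def chordal_form_to_sphere ln_div diff_divide_distrib)
      qed
      then show "(\<lambda>N. log_chordal v e (Z (\<sigma> (Suc N) w) w) - Ginf (Suc N) w) \<longlonglongrightarrow> ln ((norm (X w - v))\<^sup>2 + e) / 2 + \<gamma>"
        by (intro tendsto_eventually) (auto simp: eventually_sequentially)
    qed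
    show ?thesis
    proof (rule LIMSEQ_le_const)
      show "(\<lambda>N. \<integral>w. log_chordal v e (Z (\<sigma> (Suc N) w) w) - Ginf (Suc N) w \<partial>M) \<longlonglongrightarrow>
          (\<integral>w. ln ((norm (X w - v))\<^sup>2 + e) / 2 + \<gamma> \<partial>M)"
      proof (rule integral_dominated_convergence[where w="\<lambda>_. B1 + B'", OF _ _ _ lim])
        show "(\<lambda>w. ln ((norm (X w - v))\<^sup>2 + e) / 2 + \<gamma>) \<in> borel_measurable M" using X_meas by measurable
        show "(\<lambda>w. log_chordal v e (Z (\<sigma> (Suc N) w) w) - Ginf (Suc N) w) \<in> borel_measurable M" for N
          by (rule borel_measurable_diff[OF borel_measurable_integrable[OF iL] Ginf_meas]) simp_all
        show "AE w in M. norm (log_chordal v e (Z (\<sigma> (Suc N) w) w) - Ginf (Suc N) w) \<le> B1 + B'" for N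
        proof (rule AE_I2)
          fix w assume w: "w \<in> space M"
          show "norm (log_chordal v e (Z (\<sigma> (Suc N) w) w) - Ginf (Suc N) w) \<le> B1 + B'"
            using B1[OF sph[OF w, of "Suc N"]] Ginf_bound[OF w, of "Suc N"] by (simp add: abs_le_iff)
        qed
      qed simp
    qed (use ge in auto)
  qed
  \<comment> \<open>Now \<open>e = 1 / Suc k\<close> tends to 0; the positive distance \<delta> from
    \<open>v\<close> to \<open>K\<close> keeps the logarithms bounded.\<close>
  have E2: "(\<integral>w. ln (norm (X w - v)) + \<gamma> \<partial>M) \<ge> 0"
  proof (rule LIMSEQ_le_const)
    define R where "R = (r + norm v)\<^sup>2 + 1"
    have XR: "\<delta>\<^sup>2 \<le> (norm (X w - v))\<^sup>2" "(norm (X w - v))\<^sup>2 \<le> (r + norm v)\<^sup>2" if w: "w \<in> space M" for w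
    proof -
      show "\<delta>\<^sup>2 \<le> (norm (X w - v))\<^sup>2" using \<delta>(1) \<delta>(2)[OF XK[OF w]] by (intro power_mono) auto
      have "norm (X w - v) \<le> r + norm v"
        using norm_triangle_ineq4[of "X w" v] r(2)[of "X w"] XK[OF w] KY[of 0] by auto
      then show "(norm (X w - v))\<^sup>2 \<le> (r + norm v)\<^sup>2" by (intro power_mono) auto
    qed
    show "(\<lambda>k. \<integral>w. ln ((norm (X w - v))\<^sup>2 + 1 / Suc k) / 2 + \<gamma> \<partial>M) \<longlonglongrightarrow> (\<integral>w. ln (norm (X w - v)) + \<gamma> \<partial>M)"
    proof (rule integral_dominated_convergence[where w="\<lambda>_. \<bar>ln (\<delta>\<^sup>2)\<bar> + \<bar>ln R\<bar> + \<bar>\<gamma>\<bar>"])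
      show "(\<lambda>w. ln (norm (X w - v)) + \<gamma>) \<in> borel_measurable M" using X_meas by measurable
      show "(\<lambda>w. ln ((norm (X w - v))\<^sup>2 + 1 / Suc k) / 2 + \<gamma>) \<in> borel_measurable M" for k using X_meas by measurable
      show "AE w in M. (\<lambda>k. ln ((norm (X w - v))\<^sup>2 + 1 / Suc k) / 2 + \<gamma>) \<longlonglongrightarrow> ln (norm (X w - v)) + \<gamma>"
      proof (rule AE_I2)
        fix w assume w: "w \<in> space M"
        have p: "norm (X w - v) > 0" using \<delta>(1) \<delta>(2)[OF XK[OF w]] by linarith
        have "(\<lambda>k. ln ((norm (X w - v))\<^sup>2 + 1 / Suc k) / 2 + \<gamma>) \<longlonglongrightarrow> ln ((norm (X w - v))\<^sup>2 + 0) / 2 + \<gamma>"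
          using p by (intro tendsto_intros LIMSEQ_Suc[OF lim_const_over_n[of 1]]) auto
        then show "(\<lambda>k. ln ((norm (X w - v))\<^sup>2 + 1 / Suc k) / 2 + \<gamma>) \<longlonglongrightarrow> ln (norm (X w - v)) + \<gamma>"
          using p by (simp add: ln_realpow)
      qed
      show "AE w in M. norm (ln ((norm (X w - v))\<^sup>2 + 1 / Suc k) / 2 + \<gamma>) \<le> \<bar>ln (\<delta>\<^sup>2)\<bar> + \<bar>ln R\<bar> + \<bar>\<gamma>\<bar>" for k
      proof (rule AE_I2)
        fix w assume w: "w \<in> space M"
        have k: "0 \<le> 1 / real (Suc k)" "1 / real (Suc k) \<le> 1" by auto
        have "ln (\<delta>\<^sup>2) \<le> ln ((norm (X w - v))\<^sup>2 + 1 / Suc k)"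
        proof (rule ln_mono)
          show "\<delta>\<^sup>2 \<le> (norm (X w - v))\<^sup>2 + 1 / Suc k" using XR(1)[OF w] k by linarith
        qed (use \<delta>(1) in simp)
        moreover have "ln ((norm (X w - v))\<^sup>2 + 1 / Suc k) \<le> ln R"
        proof (rule ln_mono)
          have "\<delta>\<^sup>2 > 0" using \<delta>(1) by simp
          then show "0 < (norm (X w - v))\<^sup>2 + 1 / Suc k" using XR(1)[OF w] k by linarith
          show "(norm (X w - v))\<^sup>2 + 1 / Suc k \<le> R" using XR(2)[OF w] k unfolding R_def by linarith
        qed
        ultimately show "norm (ln ((norm (X w - v))\<^sup>2 + 1 / Suc k) / 2 + \<gamma>) \<le> \<bar>ln (\<delta>\<^sup>2)\<bar> + \<bar>ln R\<bar> + \<bar>\<gamma>\<bar>"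
          unfolding real_norm_def by linarith
      qed
    qed simp
  qed (use E1 in auto)
  have "integrable M (\<lambda>w. ln (norm (X w - v)))"
  proof (rule integrable_const_bound)
    show "(\<lambda>w. ln (norm (X w - v))) \<in> borel_measurable M" using X_meas by measurable
    show "AE w in M. norm (ln (norm (X w - v))) \<le> \<bar>ln \<delta>\<bar> + \<bar>ln (r + norm v)\<bar>"
    proof (rule AE_I2)
      fix w assume w: "w \<in> space M"
      have "norm (X w - v) \<le> r + norm v"
        using norm_triangle_ineq4[of "X w" v] r(2)[of "X w"] XK[OF w] KY[of 0] by auto
      then have "ln \<delta> \<le> ln (norm (X w - v))" "ln (norm (X w - v)) \<le> ln (r + norm v)"
        using \<delta>(1) \<delta>(2)[OF XK[OF w]] by (auto intro!: ln_mono)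
      then show "norm (ln (norm (X w - v))) \<le> \<bar>ln \<delta>\<bar> + \<bar>ln (r + norm v)\<bar>"
        unfolding real_norm_def by linarith
    qed
  qed
  then show "(\<integral>w. ln (norm (X w - v)) \<partial>M) \<ge> - \<gamma>"
    using E2 by (simp add: prob_space)
qed

end

section \<open>Iterated polynomials\<close>

primrec iter_poly :: "complex poly \<Rightarrow> nat \<Rightarrow> complex poly" where
  "iter_poly f 0 = [:0, 1:]"
| "iter_poly f (Suc n) = pcompose f (iter_poly f n)"

lemma poly_iter_poly: "poly (iter_poly f n) = poly f ^^ n"
  by (induction n) (auto simp: poly_pcompose fun_eq_iff)

lemma degree_iter_poly: "degree (iter_poly f n) = degree f ^ n"
  by (induction n) (auto simp: degree_pcompose)

text \<open>In f(z) = c + z q(z) the factor \<open>q\<close> has positive degree, so its modulus is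
  eventually at least \<open>3 + norm c\<close>; for \<open>norm z \<ge> 2\<close> the surplus
  \<open>norm c\<close> pays for the constant term.\<close>

lemma exists_escape_radius:
  fixes f :: "complex poly"
  assumes "degree f \<ge> 2"
  obtains R where "R \<ge> 2" "\<And>z. norm z \<ge> R \<Longrightarrow> norm (poly f z) \<ge> 2 * norm z"
proof -
  obtain c q where f: "f = pCons c q" by (cases f)
  have "degree q > 0" using assms by (auto simp: f split: if_splits)
  then have "filterlim (poly q) at_infinity at_infinity" by (rule filterlim_poly_at_infinity)
  then have "eventually (\<lambda>z. 3 + norm c \<le> norm (poly q z)) at_infinity"
    using filterlim_at_infinity[of "0::real" "poly q" at_infinity] by (auto simp: add_pos_nonneg)
  then obtain b where b: "\<And>z. norm z \<ge> b \<Longrightarrow> 3 + norm c \<le> norm (poly q z)"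
    by (auto simp: eventually_at_infinity)
  show ?thesis
  proof (rule that[of "max 2 b"])
    fix z :: complex assume z: "norm z \<ge> max 2 b"
    have "norm z * (3 + norm c) \<le> norm z * norm (poly q z)" using b z by (intro mult_left_mono) auto
    moreover have "norm c * 1 \<le> norm c * norm z" using z by (intro mult_left_mono) auto
    moreover have "norm (z * poly q z) - norm c \<le> norm (poly f z)"
      using norm_diff_ineq[of "z * poly q z" c] by (simp add: f add.commute)
    ultimately show "norm (poly f z) \<ge> 2 * norm z" using z by (simp add: norm_mult algebra_simps)
  qed simp
qed

lemma simple_roots_product:
  fixes p :: "complex poly"
  assumes "degree p > 0" and "\<And>z. poly p z = 0 \<Longrightarrow> poly (pderiv p) z \<noteq> 0"
  shows "card {z. poly p z = 0} = degree p"
    and "poly p x = lead_coeff p * (\<Prod>z | poly p z = 0. x - z)"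
proof -
  have eq: "smult (lead_coeff p) (\<Prod>z|poly p z = 0. [:-z, 1:]) = p"
    using assms by (intro complex_poly_decompose_rsquarefree) (auto simp: rsquarefree_roots)
  have p0: "p \<noteq> 0" using assms by auto
  have "degree p = degree (smult (lead_coeff p) (\<Prod>z|poly p z = 0. [:-z, 1:]))" by (simp only: eq)
  also have "\<dots> = card {z. poly p z = 0}" using p0 by (simp add: degree_prod_sum_eq)
  finally show "card {z. poly p z = 0} = degree p" by simp
  have "poly p x = poly (smult (lead_coeff p) (\<Prod>z|poly p z = 0. [:-z, 1:])) x" by (simp only: eq)
  then show "poly p x = lead_coeff p * (\<Prod>z | poly p z = 0. x - z)" by (simp add: poly_prod)
qed

lemma degree_diff_less:
  fixes p q :: "'a::ab_group_add poly"
  assumes "degree q < degree p"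
  shows "degree (p - q) = degree p" "lead_coeff (p - q) = lead_coeff p"
proof -
  show 1: "degree (p - q) = degree p"
    using degree_add_eq_left[of "- q" p] assms by (simp only: diff_conv_add_uminus degree_minus)
  show "lead_coeff (p - q) = lead_coeff p"
    unfolding 1 using assms by (simp add: coeff_eq_0)
qed

lemma card_UN_le_bound:
  assumes "finite I" "card I \<le> k" "\<And>i. i \<in> I \<Longrightarrow> card (A i) \<le> l"
  shows "card (\<Union>i\<in>I. A i) \<le> k * l"
proof -
  have "card (\<Union>i\<in>I. A i) \<le> (\<Sum>i\<in>I. card (A i))" by (rule card_UN_le[OF assms(1)])
  also have "\<dots> \<le> of_nat (card I) * l" using assms(3) by (rule sum_bounded_above)
  also have "\<dots> \<le> k * l" using assms(2) by simp
  finally show ?thesis .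
qed

lemma uniform_limit_dist:
  assumes "uniform_limit A \<phi> g sequentially" "\<And>k. v k \<in> A"
  shows "(\<lambda>k. dist (\<phi> k (v k)) (g (v k))) \<longlonglongrightarrow> 0"
proof (rule tendstoI)
  fix e :: real assume "e > 0"
  from uniform_limitD[OF assms(1) this] show "eventually (\<lambda>k. dist (dist (\<phi> k (v k)) (g (v k))) 0 < e) sequentially"
    by eventually_elim (use assms(2) in auto)
qed

section \<open>Sublevel sets of the iterates\<close>

locale escaping_poly =
  fixes f :: "complex poly" and R :: real
  assumes deg: "degree f \<ge> 2" and R2: "R \<ge> 2"
    and escape: "\<And>z. norm z \<ge> R \<Longrightarrow> norm (poly f z) \<ge> 2 * norm z"
begin

abbreviation d where "d \<equiv> degree f"

definition F :: "nat \<Rightarrow> complex \<Rightarrow> complex" where "F n = poly f ^^ n"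

definition U :: "nat \<Rightarrow> complex set" where "U n = {z. norm (F n z) < R}"

definition L :: "nat \<Rightarrow> complex set" where "L n = {z. norm (F n z) \<le> R}"

lemma F_0 [simp]: "F 0 z = z"
  and F_Suc: "F (Suc n) z = poly f (F n z)"
  and F_Suc': "F (Suc n) z = F n (poly f z)"
  and F_add: "F (m + n) z = F m (F n z)"
  by (simp_all add: F_def funpow_add) (simp add: funpow_swap1)

lemma F_1: "F (Suc 0) = poly f"
  by (simp add: F_def)

lemma F_poly: "F n = poly (iter_poly f n)"
  by (simp add: F_def poly_iter_poly)

lemma holomorphic_F: "F n holomorphic_on S"
  unfolding F_poly by (intro holomorphic_intros)

lemma continuous_on_F: "continuous_on S (F n)"
  unfolding F_poly by (intro continuous_intros)

lemma open_U: "open (U n)"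
  unfolding U_def by (intro open_Collect_less continuous_on_norm continuous_on_F continuous_on_const)

lemma closed_L: "closed (L n)"
  unfolding L_def by (intro closed_Collect_le continuous_on_norm continuous_on_F continuous_on_const)

lemma escape_grow: "norm (F n z) \<ge> R \<Longrightarrow> norm (F (n + k) z) \<ge> 2 ^ k * R"
proof (induction k)
  case (Suc k)
  then have IH: "norm (F (n + k) z) \<ge> 2 ^ k * R" by simp
  have "2 ^ k * R \<ge> 1 * R" using R2 by (intro mult_right_mono) auto
  with IH have "norm (F (n + k) z) \<ge> R" by simp
  from escape[OF this] IH show ?case by (simp add: F_Suc)
qed simp

lemma U_subset_L: "U n \<subseteq> L n"
  by (auto simp: U_def L_def)

text \<open>Beyond radius \<open>R\<close> the modulus at least doubles in one step. Interleaving
  the two families makes them interchangeable in the limit: the closed sets \<open>L n\<close>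
  provide compactness, the open sets \<open>U n\<close> provide open components.\<close>

lemma L_Suc_subset_U: "L (Suc n) \<subseteq> U n"
proof
  fix z assume z: "z \<in> L (Suc n)"
  show "z \<in> U n"
  proof (rule ccontr)
    assume "z \<notin> U n"
    then have "norm (F n z) \<ge> R" by (simp add: U_def)
    from escape_grow[OF this, of 1] z R2 show False by (simp add: L_def)
  qed
qed

lemma L_Suc_subset: "L (Suc n) \<subseteq> L n" and U_Suc_subset: "U (Suc n) \<subseteq> U n"
  using L_Suc_subset_U U_subset_L by blast+

lemma L_antimono: "m \<le> n \<Longrightarrow> L n \<subseteq> L m" and U_antimono: "m \<le> n \<Longrightarrow> U n \<subseteq> U m"
  using lift_Suc_antimono_le[of L] lift_Suc_antimono_le[of U] L_Suc_subset U_Suc_subset by auto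

lemma U_0: "U 0 = ball 0 R" and L_0: "L 0 = cball 0 R"
  by (auto simp: U_def L_def)

lemma compact_L: "compact (L n)"
  using closed_L L_antimono[of 0 n] by (simp add: L_0) (meson bounded_cball bounded_subset compact_eq_bounded_closed)

lemma filled_julia_eq: "filled_julia f = (\<Inter>n. L n)"
proof (intro equalityI subsetI)
  fix z assume "z \<in> filled_julia f"
  then obtain B where B: "\<And>n. norm (F n z) \<le> B" by (auto simp: filled_julia_def bdd_above_def F_def)
  show "z \<in> (\<Inter>n. L n)"
  proof (rule ccontr)
    assume "z \<notin> (\<Inter>n. L n)"
    then obtain n where "norm (F n z) \<ge> R" by (auto simp: L_def) (meson linorder_not_le order_less_imp_le)
    then have *: "2 ^ k * R \<le> B" for k using escape_grow[of n z k] B[of "n + k"] by linarith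
    obtain k where "B < 2 ^ k" using real_arch_pow[of 2 B] by auto
    moreover have "(2::real) ^ k * 1 \<le> 2 ^ k * R" using R2 by (intro mult_left_mono) auto
    ultimately show False using *[of k] by simp
  qed
next
  fix z assume "z \<in> (\<Inter>n. L n)"
  then show "z \<in> filled_julia f" by (auto simp: filled_julia_def bdd_above_def F_def L_def)
qed

lemma filled_julia_eq_U: "filled_julia f = (\<Inter>n. U n)"
  unfolding filled_julia_eq using L_Suc_subset_U U_subset_L by blast

lemma compact_filled_julia: "compact (filled_julia f)"
  unfolding filled_julia_eq by (intro compact_Inter) (auto intro: compact_L)

text \<open>A fixed point of \<open>f\<close>, that is a root of f(z) - z, has a bounded
  orbit.\<close>

lemma filled_julia_nonempty: "filled_julia f \<noteq> {}"
proof -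
  have "degree (f - [:0, 1:]) > 0"
    using deg degree_diff_less(1)[of "[:0, 1:]" f] by simp
  then obtain z where "poly (f - [:0, 1:]) z = 0"
    using fundamental_theorem_of_algebra_alt[of "f - [:0, 1:]"]
    by (metis degree_pCons_0 fundamental_theorem_of_algebra constant_degree less_irrefl)
  then have fz: "poly f z = z" by simp
  have "(poly f ^^ n) z = z" for n by (induction n) (auto simp: fz)
  then have "z \<in> filled_julia f" by (simp add: filled_julia_def)
  then show ?thesis by blast
qed

lemma d_pos: "d ^ n > 0" using deg by simp

lemma U_preimage: "z \<in> U (m + n) \<longleftrightarrow> F n z \<in> U m"
  by (simp add: U_def F_add)

lemma closure_compl_L: "z \<in> closure (- L n) \<Longrightarrow> norm (F n z) \<ge> R"
proof -
  assume "z \<in> closure (- L n)"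
  moreover have "closed {z. R \<le> norm (F n z)}"
    by (intro closed_Collect_le continuous_on_norm continuous_on_F continuous_on_const)
  moreover have "- L n \<subseteq> {z. R \<le> norm (F n z)}" by (auto simp: L_def)
  ultimately show ?thesis using closure_minimal by blast
qed

lemma finite_fibre: "finite {z. F n z = y}" and card_fibre_le: "card {z. F n z = y} \<le> d ^ n"
proof -
  have eq: "{z. F n z = y} = {z. poly (iter_poly f n - [:y:]) z = 0}" by (auto simp: F_poly)
  have dg: "degree (iter_poly f n - [:y:]) = d ^ n"
    using degree_diff_less(1)[of "[:y:]" "iter_poly f n"] d_pos[of n] by (simp add: degree_iter_poly)
  then have "iter_poly f n - [:y:] \<noteq> 0" using d_pos[of n] by fastforce
  then show "finite {z. F n z = y}" "card {z. F n z = y} \<le> d ^ n"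
    unfolding eq using poly_roots_finite card_poly_roots_bound dg by metis+
qed

text \<open>The leading coefficients obey a recursion that makes these values partial sums of a
  geometric series. The limit is ln |lead_coeff f| / (d - 1), the Robin constant of the filled Julia
  set.\<close>

definition \<gamma>n :: "nat \<Rightarrow> real" where
  "\<gamma>n n = ln (norm (lead_coeff (iter_poly f n))) / d ^ n"

lemma \<gamma>n_eq: "\<gamma>n n = (\<Sum>k<n. ln (norm (lead_coeff f)) / d * (1 / d) ^ k)"
proof (induction n)
  case (Suc n)
  have f0: "f \<noteq> 0" using deg by auto
  have l0: "lead_coeff (iter_poly f n) \<noteq> 0"
    using degree_iter_poly[of f n] d_pos[of n] by (metis degree_0 leading_coeff_0_iff less_irrefl)
  have "lead_coeff (iter_poly f (Suc n)) = lead_coeff f * lead_coeff (iter_poly f n) ^ d"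
    using lead_coeff_comp[of "iter_poly f n" f] d_pos[of n] by (simp add: degree_iter_poly)
  then have "ln (norm (lead_coeff (iter_poly f (Suc n)))) = ln (norm (lead_coeff f)) + d * ln (norm (lead_coeff (iter_poly f n)))"
    using f0 l0 by (simp add: norm_mult norm_power ln_mult ln_realpow)
  then have "\<gamma>n (Suc n) = \<gamma>n n + ln (norm (lead_coeff f)) / d * (1 / d) ^ n"
  proof -
    have "real d \<noteq> 0" using deg by simp
    then show ?thesis
      unfolding \<gamma>n_def \<open>ln _ = _\<close> by (simp add: add_divide_distrib power_one_over inverse_eq_divide)
  qed
  then show ?case using Suc by simp
qed (simp add: \<gamma>n_def)

lemma \<gamma>n_convergent: "convergent \<gamma>n"
proof -
  have "summable (\<lambda>k. ln (norm (lead_coeff f)) / d * (1 / d) ^ k)"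
    using deg by (intro summable_mult summable_geometric) auto
  moreover have "\<gamma>n = (\<lambda>n. \<Sum>k<n. ln (norm (lead_coeff f)) / d * (1 / d) ^ k)"
    by (rule ext) (rule \<gamma>n_eq)
  ultimately show ?thesis by (simp only: summable_iff_convergent)
qed

text \<open>A point outside the countable postcritical set has \<open>d ^ n\<close> distinct preimages under \<open>f ^ n\<close>.\<close>

lemma exists_generic_point:
  obtains a where "norm a < 1" "\<And>n z. F n z = a \<Longrightarrow> poly (pderiv (iter_poly f n)) z \<noteq> 0"
proof -
  define Bad where "Bad = (\<Union>n. F n ` {z. poly (pderiv (iter_poly f n)) z = 0})"
  have "finite {z. poly (pderiv (iter_poly f n)) z = 0}" for n
  proof (rule poly_roots_finite)
    show "pderiv (iter_poly f n) \<noteq> 0"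
      using d_pos[of n] by (simp add: pderiv_eq_0_iff degree_iter_poly)
  qed
  then have "countable Bad" unfolding Bad_def by (intro countable_UN countable_image countable_finite countableI_type)
  moreover have "uncountable (ball (0::complex) 1)" by (rule uncountable_ball) simp
  ultimately obtain a where "a \<in> ball 0 1" "a \<notin> Bad"
    using countable_subset[of "ball 0 1" Bad] by blast
  then show ?thesis using that[of a] by (auto simp: Bad_def)
qed

end

text \<open>The bound on \<open>a\<close> places the whole fibre inside \<open>U n\<close> and gives
  \<open>norm (F n z - a) \<ge> 1\<close> wherever \<open>norm (F n z) \<ge> R\<close>. Genericity
  makes all roots of \<open>F n z = a\<close> simple.\<close>

locale generic_escaping_poly = escaping_poly +
  fixes a :: complex
  assumes a1: "norm a < 1" and generic: "\<And>n z. F n z = a \<Longrightarrow> poly (pderiv (iter_poly f n)) z \<noteq> 0"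
begin

definition S :: "nat \<Rightarrow> complex set" where "S n = {z. F n z = a}"

lemma finite_S: "finite (S n)" and card_S: "card (S n) = d ^ n" and S_nonempty: "S n \<noteq> {}"
  and norm_F_diff: "norm (F n z - a) = norm (lead_coeff (iter_poly f n)) * (\<Prod>v\<in>S n. norm (z - v))"
proof -
  have eq: "S n = {z. poly (iter_poly f n - [:a:]) z = 0}" by (auto simp: S_def F_poly)
  have dg: "degree (iter_poly f n - [:a:]) = d ^ n" and lc: "lead_coeff (iter_poly f n - [:a:]) = lead_coeff (iter_poly f n)"
    using degree_diff_less[of "[:a:]" "iter_poly f n"] d_pos[of n] by (simp_all add: degree_iter_poly)
  have dp: "degree (iter_poly f n - [:a:]) > 0" unfolding dg by (rule d_pos)
  have sr: "poly (pderiv (iter_poly f n - [:a:])) z \<noteq> 0" if "poly (iter_poly f n - [:a:]) z = 0" for z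
    using generic[of n z] that by (simp add: F_poly pderiv_diff pderiv_pCons)
  show "finite (S n)" unfolding S_def by (rule finite_fibre)
  show c: "card (S n) = d ^ n" unfolding eq using simple_roots_product(1)[OF dp sr] dg by simp
  show "S n \<noteq> {}" using c d_pos[of n] by (metis card.empty less_irrefl)
  have "F n z - a = poly (iter_poly f n - [:a:]) z" by (simp add: F_poly)
  also have "\<dots> = lead_coeff (iter_poly f n) * (\<Prod>v\<in>S n. z - v)"
    using simple_roots_product(2)[OF dp sr, of z] unfolding lc eq[symmetric] .
  finally show "norm (F n z - a) = norm (lead_coeff (iter_poly f n)) * (\<Prod>v\<in>S n. norm (z - v))"
    by (simp add: norm_mult prod_norm)
qed

lemma S_subset_U: "S n \<subseteq> U n"
  using a1 R2 by (auto simp: S_def U_def)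

text \<open>Factoring \<open>F n z - a\<close> over its simple roots turns the mean of the
  logarithms into the usual approximation ln |F n z| / d^n of Green's function, up to the shift by
  \<open>a\<close> and the normalisation \<open>\<gamma>n n\<close>.\<close>

lemma mean_log_S:
  assumes "z \<notin> S n"
  shows "mean_log (S n) z = ln (norm (F n z - a)) / d ^ n - \<gamma>n n"
proof -
  have l0: "norm (lead_coeff (iter_poly f n)) > 0"
    using degree_iter_poly[of f n] d_pos[of n] by (metis degree_0 leading_coeff_0_iff less_irrefl zero_less_norm_iff)
  have pos: "norm (z - v) > 0" if "v \<in> S n" for v using that assms by auto
  have "ln (norm (F n z - a)) = ln (norm (lead_coeff (iter_poly f n))) + ln (\<Prod>v\<in>S n. norm (z - v))"
    unfolding norm_F_diff using l0 pos by (intro ln_mult_pos prod_pos) auto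
  also have "ln (\<Prod>v\<in>S n. norm (z - v)) = (\<Sum>v\<in>S n. ln (norm (z - v)))"
    using pos finite_S by (intro ln_prod) auto
  finally show ?thesis by (simp add: mean_log_def card_S \<gamma>n_def add_divide_distrib)
qed

lemma mean_log_S_ge:
  assumes "norm (F n z) \<ge> R"
  shows "mean_log (S n) z \<ge> - \<gamma>n n"
proof -
  have "norm (F n z - a) \<ge> 1" using norm_triangle_ineq2[of "F n z" a] a1 R2 assms by linarith
  then have "ln (norm (F n z - a)) / d ^ n \<ge> 0" by (intro divide_nonneg_nonneg ln_ge_zero) auto
  moreover have "z \<notin> S n" using assms a1 R2 by (auto simp: S_def)
  ultimately show ?thesis by (simp add: mean_log_S)
qed

text \<open>The constant must not depend on \<open>n\<close>. For \<open>norm z \<le> 2 * R\<close>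
  the bound \<open>- \<gamma>n n\<close> is enough, because the \<open>\<gamma>n\<close> are
  bounded; further out all points \<open>v\<close> of the fibre satisfy \<open>norm v < R\<close>,
  hence \<open>norm (z - v) \<ge> norm z / 2\<close>.\<close>

lemma mean_log_S_ge_chordal:
  obtains C1 where "C1 \<ge> 0" "\<And>n z. norm (F n z) \<ge> R \<Longrightarrow> mean_log (S n) z \<ge> ln (1 + (norm z)\<^sup>2) / 2 - C1"
proof -
  obtain B where B: "\<And>n. \<bar>\<gamma>n n\<bar> \<le> B"
    using convergent_imp_Bseq[OF \<gamma>n_convergent] by (auto simp: Bseq_def)
  define C1 where "C1 = B + ln (1 + (2 * R)\<^sup>2) / 2 + 2 * ln 2"
  have B0: "B \<ge> 0" using B[of 0] by linarith
  have l0: "ln (1 + (2 * R)\<^sup>2) \<ge> 0" by (rule ln_ge_zero) simp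
  show ?thesis
  proof (rule that[of C1])
    show "C1 \<ge> 0" using B0 l0 by (simp add: C1_def)
    fix n z assume z: "norm (F n z) \<ge> R"
    show "mean_log (S n) z \<ge> ln (1 + (norm z)\<^sup>2) / 2 - C1"
    proof (cases "norm z \<le> 2 * R")
      case True
      then have "(norm z)\<^sup>2 \<le> (2 * R)\<^sup>2" by (intro power_mono) auto
      then have "ln (1 + (norm z)\<^sup>2) \<le> ln (1 + (2 * R)\<^sup>2)" by (intro ln_mono) (auto simp: add_pos_nonneg)
      moreover have "ln 2 \<ge> (0::real)" by simp
      ultimately have "ln (1 + (norm z)\<^sup>2) / 2 - C1 \<le> - B" unfolding C1_def by linarith
      also have "- B \<le> - \<gamma>n n" using B[of n] by linarith
      finally show ?thesis using mean_log_S_ge[OF z] by linarith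
    next
      case False
      then have z1: "norm z \<ge> 1" using R2 by linarith
      have "ln (norm z / 2) \<le> ln (norm (z - v))" if "v \<in> S n" for v
      proof -
        have "norm v < R" using that S_subset_U[of n] U_antimono[of 0 n] by (auto simp: U_0 subset_iff)
        then have "norm z / 2 \<le> norm (z - v)" using False norm_triangle_ineq2[of z v] by linarith
        then show ?thesis using z1 by (intro ln_mono) auto
      qed
      then have "(\<Sum>v\<in>S n. ln (norm z / 2)) \<le> (\<Sum>v\<in>S n. ln (norm (z - v)))" by (rule sum_mono)
      then have "ln (norm z / 2) \<le> mean_log (S n) z"
        using d_pos[of n] by (simp add: mean_log_def card_S field_simps)
      moreover have "ln (1 + (norm z)\<^sup>2) \<le> ln (2 * (norm z)\<^sup>2)"
        using z1 power_mono[of 1 "norm z" 2] by (intro ln_mono) (auto simp: add_pos_nonneg)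
      then have "ln (1 + (norm z)\<^sup>2) \<le> ln 2 + 2 * ln (norm z)" using z1 by (subst (asm) ln_mult_pos) (auto simp: ln_realpow)
      moreover have "ln (norm z / 2) = ln (norm z) - ln 2" using z1 by (subst ln_divide_pos) auto
      moreover have "C1 \<ge> 2 * ln 2" using B0 l0 by (simp add: C1_def)
      moreover have "ln 2 \<ge> (0::real)" by simp
      ultimately show ?thesis by linarith
    qed
  qed
qed

end

lemma (in sphere_brownian) filled_julia_entry:
  assumes "generic_escaping_poly f R a" and k0: "k0 \<in> filled_julia f"
  defines "X \<equiv> \<lambda>w. if enters Z (filled_julia f) w then first_entry_point Z (filled_julia f) w else k0"
  shows "{w \<in> space M. enters Z (filled_julia f) w} \<in> sets M"
    and "AE w in M. enters Z (filled_julia f) w"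
    and "X \<in> borel_measurable M"
    and "\<And>w. w \<in> space M \<Longrightarrow> X w \<in> filled_julia f"
    and "\<And>w. w \<in> space M \<Longrightarrow> enters Z (filled_julia f) w \<Longrightarrow> X w \<in> frontier (filled_julia f)"
    and "\<And>v. v \<notin> filled_julia f \<Longrightarrow> (\<integral>w. ln (norm (X w - v)) \<partial>M) \<ge> - lim (escaping_poly.\<gamma>n f)"
proof -
  interpret generic_escaping_poly f R a by fact
  obtain C1 where C1: "C1 \<ge> 0" "\<And>n z. norm (F n z) \<ge> R \<Longrightarrow> mean_log (S n) z \<ge> ln (1 + (norm z)\<^sup>2) / 2 - C1"
    by (rule mean_log_S_ge_chordal) blast
  have int: "S n \<subseteq> interior (L n)" for n
    using S_subset_U open_U U_subset_L by (meson interior_maximal order_trans)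
  note * = entry_potential_ge[OF compact_L L_Suc_subset filled_julia_eq k0 finite_S S_nonempty int
      mean_log_S_ge[OF closure_compl_L] C1(2)[OF closure_compl_L] C1(1) \<gamma>n_convergent[unfolded convergent_LIMSEQ_iff]]
  show "{w \<in> space M. enters Z (filled_julia f) w} \<in> sets M" by (rule *(1))
  show "AE w in M. enters Z (filled_julia f) w" by (rule *(2))
  show "X \<in> borel_measurable M" unfolding X_def by (rule *(3))
  show "\<And>w. w \<in> space M \<Longrightarrow> X w \<in> filled_julia f" unfolding X_def by (rule *(4))
  show "\<And>w. w \<in> space M \<Longrightarrow> enters Z (filled_julia f) w \<Longrightarrow> X w \<in> frontier (filled_julia f)" unfolding X_def by (rule *(5))
  show "\<And>v. v \<notin> filled_julia f \<Longrightarrow> (\<integral>w. ln (norm (X w - v)) \<partial>M) \<ge> - lim \<gamma>n" unfolding X_def by (rule *(6))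
qed

section \<open>Logarithmic potentials and Cauchy transforms\<close>

lemma one_minus_not_neg:
  assumes "norm (z::complex) < 1"
  shows "1 - z \<notin> \<real>\<^sub>\<le>\<^sub>0" "1 - z \<noteq> 0" "norm (1 - z) \<ge> 1 - norm z"
proof -
  have "Re (1 - z) > 0" using assms complex_Re_le_cmod[of z] by simp
  then show "1 - z \<notin> \<real>\<^sub>\<le>\<^sub>0" "1 - z \<noteq> 0" by (auto simp: complex_nonpos_Reals_iff complex_eq_iff)
  show "norm (1 - z) \<ge> 1 - norm z" using norm_triangle_ineq2[of 1 z] by simp
qed

definition log_pot :: "'b measure \<Rightarrow> ('b \<Rightarrow> complex) \<Rightarrow> complex \<Rightarrow> real" where
  "log_pot N X v = (\<integral>w. ln (norm (v - X w)) \<partial>N)"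

definition cauchy_tr :: "'b measure \<Rightarrow> ('b \<Rightarrow> complex) \<Rightarrow> complex \<Rightarrow> complex" where
  "cauchy_tr N X v = (\<integral>w. 1 / (v - X w) \<partial>N)"

text \<open>One setting for both sides of the comparison: the entry point on the path space, and the
  identity under the uniform distribution on a finite set of preimages.\<close>

locale compact_rv = prob_space N for N :: "'b measure" +
  fixes X :: "'b \<Rightarrow> complex" and K :: "complex set"
  assumes compact_K: "compact K" and X_meas: "X \<in> borel_measurable N"
    and X_in: "w \<in> space N \<Longrightarrow> X w \<in> K"
begin

lemma integrable_comp:
  fixes \<phi> :: "complex \<Rightarrow> 'c::{banach,second_countable_topology}"
  assumes "continuous_on K \<phi>"
  shows "integrable N (\<lambda>w. \<phi> (X w))"
proof -
  have "bounded (\<phi> ` K)" by (intro compact_imp_bounded compact_continuous_image assms compact_K)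
  then obtain B where B: "\<And>x. x \<in> K \<Longrightarrow> norm (\<phi> x) \<le> B" by (auto simp: bounded_iff)
  have "X \<in> measurable N (restrict_space borel K)"
    by (rule measurable_restrict_space2[OF _ X_meas]) (use X_in in auto)
  then have "(\<lambda>w. \<phi> (X w)) \<in> borel_measurable N"
    by (rule measurable_compose) (rule borel_measurable_continuous_on_restrict[OF assms])
  then show ?thesis using B X_in by (intro integrable_const_bound[where B=B] AE_I2) auto
qed

text \<open>Taylor's formula with the bound \<open>B\<close> for \<open>k2\<close> estimates the
  error of the linear approximation by \<open>B * norm (v - v0) ^ 2\<close>, uniformly on
  \<open>K\<close>. This may be integrated, and dividing by \<open>v - v0\<close> leaves an error
  that tends to 0.\<close>

lemma has_field_derivative_integral:
  fixes k0 k1 k2 :: "complex \<Rightarrow> complex \<Rightarrow> complex"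
  assumes r: "r > 0"
    and k0: "\<And>v x. v \<in> ball v0 r \<Longrightarrow> x \<in> K \<Longrightarrow> (k0 x has_field_derivative k1 x v) (at v)"
    and k1: "\<And>v x. v \<in> ball v0 r \<Longrightarrow> x \<in> K \<Longrightarrow> (k1 x has_field_derivative k2 x v) (at v)"
    and B: "\<And>v x. v \<in> ball v0 r \<Longrightarrow> x \<in> K \<Longrightarrow> norm (k2 x v) \<le> B"
    and c0: "\<And>v. v \<in> ball v0 r \<Longrightarrow> continuous_on K (\<lambda>x. k0 x v)"
    and c1: "continuous_on K (\<lambda>x. k1 x v0)"
  shows "((\<lambda>v. \<integral>w. k0 (X w) v \<partial>N) has_field_derivative (\<integral>w. k1 (X w) v0 \<partial>N)) (at v0)"
proof -
  define g where "g v = (\<integral>w. k0 (X w) v \<partial>N)" for v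
  define D where "D = (\<integral>w. k1 (X w) v0 \<partial>N)"
  have taylor: "norm (k0 x v - (k0 x v0 + k1 x v0 * (v - v0))) \<le> B * norm (v - v0) ^ 2"
    if v: "v \<in> ball v0 r" and x: "x \<in> K" for v x
  proof -
    define h where "h i = (if i = 0 then k0 x else if i = 1 then k1 x else k2 x)" for i :: nat
    have "norm (h 0 v - (\<Sum>i\<le>1. h i v0 * (v - v0) ^ i / fact i)) \<le> B * norm (v - v0) ^ (Suc 1) / fact 1"
    proof (rule complex_Taylor[where S="ball v0 r"])
      fix i :: nat and u assume u: "u \<in> ball v0 r" and i: "i \<le> 1"
      have "i = 0 \<or> i = 1" using i by auto
      then show "(h i has_field_derivative h (Suc i) u) (at u within ball v0 r)"
        using has_field_derivative_at_within[OF k0[OF u x]] has_field_derivative_at_within[OF k1[OF u x]]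
        by (auto simp: h_def)
    qed (use v x r B in \<open>auto simp: h_def\<close>)
    then show ?thesis by (simp add: h_def numeral_2_eq_2)
  qed
  have bound: "norm ((g v - g v0) / (v - v0) - D) \<le> B * norm (v - v0)" if v: "v \<in> ball v0 r" "v \<noteq> v0" for v
  proof -
    have v0: "v0 \<in> ball v0 r" using r by simp
    have i0: "integrable N (\<lambda>w. k0 (X w) v)" "integrable N (\<lambda>w. k0 (X w) v0)"
      by (intro integrable_comp c0 v v0)+
    have i1: "integrable N (\<lambda>w. k1 (X w) v0)" by (intro integrable_comp c1)
    have "norm (g v - (g v0 + D * (v - v0))) =
        norm (\<integral>w. k0 (X w) v - (k0 (X w) v0 + k1 (X w) v0 * (v - v0)) \<partial>N)"
      unfolding g_def D_def using i0 i1 by simp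
    also have "\<dots> \<le> (\<integral>w. B * norm (v - v0) ^ 2 \<partial>N)"
      by (rule order_trans[OF integral_norm_bound integral_mono]) (use i0 i1 taylor[OF v(1) X_in] in auto)
    also have "\<dots> = B * norm (v - v0) ^ 2" by (simp add: prob_space)
    finally have *: "norm (g v - (g v0 + D * (v - v0))) \<le> B * norm (v - v0) ^ 2" .
    have "(g v - g v0) / (v - v0) - D = (g v - (g v0 + D * (v - v0))) / (v - v0)"
      using v by (simp add: field_simps)
    then have "norm ((g v - g v0) / (v - v0) - D) = norm (g v - (g v0 + D * (v - v0))) / norm (v - v0)"
      by (simp add: norm_divide)
    also have "\<dots> \<le> B * norm (v - v0) ^ 2 / norm (v - v0)" by (intro divide_right_mono *) simp
    also have "\<dots> = B * norm (v - v0)" using v by (simp add: power2_eq_square)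
    finally show ?thesis .
  qed
  have "((\<lambda>v. (g v - g v0) / (v - v0) - D) \<longlongrightarrow> 0) (at v0)"
  proof (rule Lim_null_comparison)
    show "((\<lambda>v. B * norm (v - v0)) \<longlongrightarrow> 0) (at v0)"
      by (rule tendsto_eq_intros refl | simp)+
    have "eventually (\<lambda>v. v \<in> ball v0 r) (at v0)"
      using r by (intro eventually_at_in_open') auto
    then show "eventually (\<lambda>v. norm ((g v - g v0) / (v - v0) - D) \<le> B * norm (v - v0)) (at v0)"
      using eventually_neq_at_within[of v0 v0 UNIV] by eventually_elim (rule bound)
  qed
  then have "((\<lambda>v. (g v - g v0) / (v - v0)) \<longlongrightarrow> D) (at v0)" by (simp add: LIM_zero_iff)
  then show ?thesis by (simp add: has_field_derivative_iff g_def[abs_def] D_def)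
qed

lemma integral_Re:
  assumes "continuous_on K \<phi>"
  shows "Re (\<integral>w. \<phi> (X w) \<partial>N) = (\<integral>w. Re (\<phi> (X w)) \<partial>N)"
  using integral_bounded_linear[OF bounded_linear_Re integrable_comp[OF assms]] by simp

text \<open>For \<open>v\<close> in the ball the quotient (v - x) / (v0 - x) stays in the unit disc
  about 1, so its principal logarithm is holomorphic in \<open>v\<close> for every \<open>x\<close>
  in \<open>K\<close>. Integrating over \<open>X\<close> yields \<open>g\<close>.\<close>

lemma log_pot_local:
  assumes "ball v0 r \<inter> K = {}"
  obtains g where "g holomorphic_on ball v0 r" "g v0 = 0" "\<And>v. v \<in> ball v0 r \<Longrightarrow> Re (g v) = log_pot N X v - log_pot N X v0"
proof (cases "r > 0")
  case False
  then show ?thesis using that[of "\<lambda>_. 0"] by (auto simp: ball_empty)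
next
  case r: True
  define q where "q x v = 1 - (v - v0) / (x - v0)" for x v
  have x0: "norm (x - v0) \<ge> r" "x \<noteq> v0" if "x \<in> K" for x
  proof -
    have "x \<notin> ball v0 r" using assms that by auto
    then show "norm (x - v0) \<ge> r" by (simp add: dist_norm norm_minus_commute)
    then show "x \<noteq> v0" using r by auto
  qed
  have small: "norm ((v - v0) / (x - v0)) < 1" if "v \<in> ball v0 r" "x \<in> K" for v x
    using that x0[OF that(2)] r by (auto simp: norm_divide dist_norm norm_minus_commute divide_simps)
  have nz: "v \<noteq> x" if "v \<in> ball v0 r" "x \<in> K" for v x using assms that by auto
  define g where "g v = (\<integral>w. Ln (q (X w) v) \<partial>N)" for v
  have cont: "continuous_on K (\<lambda>x. Ln (q x v))" if "v \<in> ball v0 r" for v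
    unfolding q_def using x0 one_minus_not_neg(1)[OF small[OF that]]
    by (intro continuous_intros) auto
  have "(g has_field_derivative (\<integral>w. 1 / (v1 - X w) \<partial>N)) (at v1)" if v1: "v1 \<in> ball v0 r" for v1
  proof -
    define s where "s = (r - norm (v1 - v0)) / 2"
    have s: "s > 0" using v1 by (simp add: s_def dist_norm norm_minus_commute)
    have sub: "v \<in> ball v0 r" and far: "x \<in> K \<Longrightarrow> norm (v - x) \<ge> s" if "v \<in> ball v1 s" for v x
    proof -
      have "norm (v - v0) < r - s"
        using that norm_triangle_ineq[of "v - v1" "v1 - v0"] by (simp add: dist_norm norm_minus_commute s_def field_simps)
      then show "v \<in> ball v0 r" using s by (simp add: dist_norm norm_minus_commute)
      assume "x \<in> K"
      then have "r \<le> norm (x - v0)" by (rule x0)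
      then show "norm (v - x) \<ge> s"
        using \<open>norm (v - v0) < r - s\<close> norm_triangle_ineq[of "x - v" "v - v0"] by (simp add: norm_minus_commute)
    qed
    show ?thesis unfolding g_def
    proof (rule has_field_derivative_integral[where ?k0.0="\<lambda>x v. Ln (q x v)" and ?k1.0="\<lambda>x v. 1 / (v - x)"
        and ?k2.0="\<lambda>x v. - 1 / (v - x)\<^sup>2" and B="1 / s\<^sup>2" and r=s])
      fix v x assume vx: "v \<in> ball v1 s" "x \<in> K"
      note vx' = sub[OF vx(1)] vx(2)
      have q': "(q x has_field_derivative - 1 / (x - v0)) (at v)"
        unfolding q_def using x0[OF vx(2)] by (auto intro!: derivative_eq_intros)
      have "inverse (q x v) * (- 1 / (x - v0)) = 1 / (v - x)"
        using x0[OF vx(2)] nz[OF vx'] by (simp add: q_def field_simps)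
      then show "((\<lambda>v. Ln (q x v)) has_field_derivative 1 / (v - x)) (at v)"
        using DERIV_chain2[OF has_field_derivative_Ln q'] one_minus_not_neg(1)[OF small[OF vx']] by (simp add: q_def)
      show "((\<lambda>v. 1 / (v - x)) has_field_derivative - 1 / (v - x)\<^sup>2) (at v)"
        using nz[OF vx'] by (auto intro!: derivative_eq_intros simp: power2_eq_square)
      have "norm (v - x) ^ 2 \<ge> s ^ 2" using far[OF vx] s by (intro power_mono) auto
      then show "norm (- 1 / (v - x)\<^sup>2) \<le> 1 / s\<^sup>2"
        using s nz[OF vx'] by (auto simp: norm_divide norm_power intro!: divide_left_mono)
    next
      fix v assume "v \<in> ball v1 s"
      from cont[OF sub[OF this]] show "continuous_on K (\<lambda>x. Ln (q x v))" .
    next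
      show "continuous_on K (\<lambda>x. 1 / (v1 - x))" using nz[OF v1] by (intro continuous_intros) auto
    qed (rule s)
  qed
  then have "g holomorphic_on ball v0 r"
    by (meson field_differentiable_at_within field_differentiable_def holomorphic_onI)
  moreover have "g v0 = 0" by (simp add: g_def q_def)
  moreover have "Re (g v) = log_pot N X v - log_pot N X v0" if v: "v \<in> ball v0 r" for v
  proof -
    have v0: "v0 \<in> ball v0 r" using r by simp
    have eq: "Re (Ln (q x v)) = ln (norm (v - x)) - ln (norm (v0 - x))" if x: "x \<in> K" for x
    proof -
      have "q x v = (v - x) / (v0 - x)" using x0[OF x] by (simp add: q_def field_simps)
      moreover have "q x v \<noteq> 0" using one_minus_not_neg(2)[OF small[OF v x]] by (simp add: q_def)
      ultimately show ?thesis using x0(2)[OF x] nz[OF v x] by (simp add: norm_divide ln_div)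
    qed
    have c: "continuous_on K (\<lambda>x. ln (norm (u - x)))" if "u \<in> ball v0 r" for u
      using nz[OF that] by (intro continuous_intros) auto
    have "Re (g v) = (\<integral>w. ln (norm (v - X w)) - ln (norm (v0 - X w)) \<partial>N)"
      unfolding g_def integral_Re[OF cont[OF v]]
      by (rule Bochner_Integration.integral_cong) (use eq X_in in auto)
    also have "\<dots> = log_pot N X v - log_pot N X v0"
      unfolding log_pot_def
      by (rule Bochner_Integration.integral_diff) (rule integrable_comp[OF c[OF v]] integrable_comp[OF c[OF v0]])+
    finally show ?thesis .
  qed
  ultimately show ?thesis using that by blast
qed

lemma continuous_on_log_pot: "continuous_on (- K) (log_pot N X)"
proof (subst continuous_on_eq_continuous_at)
  show "open (- K)" using compact_K by (simp add: compact_imp_closed open_Compl)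
  show "\<forall>v0\<in>- K. isCont (log_pot N X) v0"
  proof
    fix v0 assume "v0 \<in> - K"
    then obtain e where e: "e > 0" "ball v0 e \<subseteq> - K"
      using compact_imp_closed[OF compact_K] open_contains_ball_eq[of "- K"] by (auto simp: open_Compl)
    then have "ball v0 e \<inter> K = {}" by auto
    then obtain g where g: "g holomorphic_on ball v0 e"
      "\<And>v. v \<in> ball v0 e \<Longrightarrow> Re (g v) = log_pot N X v - log_pot N X v0" by (rule log_pot_local) blast
    have "continuous_on (ball v0 e) (\<lambda>v. Re (g v) + log_pot N X v0)"
      by (intro continuous_intros holomorphic_on_imp_continuous_on g)
    then have "continuous_on (ball v0 e) (log_pot N X)"
      by (rule continuous_on_eq) (simp add: g)
    then show "isCont (log_pot N X) v0" using e by (simp add: continuous_on_eq_continuous_at)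
  qed
qed

text \<open>In the coordinate z = 1/v the kernel becomes 1 - z x, which is near 1, so the principal
  logarithm applies again. That \<open>h 0 = 0\<close> expresses the common behaviour of all
  probability potentials at infinity; differentiating \<open>h\<close> turns the potential into the
  Cauchy transform.\<close>

lemma log_pot_at_infinity:
  assumes \<rho>: "\<rho> > 0" "K \<subseteq> cball 0 \<rho>"
  obtains h where "h holomorphic_on ball 0 (1 / \<rho>)" "h 0 = 0"
    "\<And>z. z \<in> ball 0 (1 / \<rho>) \<Longrightarrow> z \<noteq> 0 \<Longrightarrow> Re (h z) = log_pot N X (1 / z) + ln (norm z)"
    "\<And>z. z \<in> ball 0 (1 / \<rho>) \<Longrightarrow> z \<noteq> 0 \<Longrightarrow> cauchy_tr N X (1 / z) = z - z\<^sup>2 * deriv h z"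
proof -
  define q where "q x z = 1 - z * x" for x z :: complex
  have xr: "norm x \<le> \<rho>" if "x \<in> K" for x using \<rho> that by auto
  have small: "norm (z * x) \<le> norm z * \<rho>" if "x \<in> K" for z x
    unfolding norm_mult by (intro mult_left_mono xr that) simp
  have small1: "norm (z * x) < 1" if "x \<in> K" "z \<in> ball 0 (1 / \<rho>)" for z x
  proof -
    have "norm z * \<rho> < 1" using that \<rho> by (simp add: field_simps)
    then show ?thesis using small[OF that(1), of z] by linarith
  qed
  define h where "h z = (\<integral>w. Ln (q (X w) z) \<partial>N)" for z
  have cont: "continuous_on K (\<lambda>x. Ln (q x z))" if "z \<in> ball 0 (1 / \<rho>)" for z
    unfolding q_def using one_minus_not_neg(1)[OF small1[OF _ that]]
    by (intro continuous_intros) auto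
  have cont1: "continuous_on K (\<lambda>x. - x / q x z)" if "z \<in> ball 0 (1 / \<rho>)" for z
    unfolding q_def using one_minus_not_neg(2)[OF small1[OF _ that]]
    by (intro continuous_intros) auto
  have der: "(h has_field_derivative (\<integral>w. - X w / q (X w) z1 \<partial>N)) (at z1)" if z1: "z1 \<in> ball 0 (1 / \<rho>)" for z1
  proof -
    define s where "s = (1 / \<rho> - norm z1) / 2"
    have s: "s > 0" using z1 by (simp add: s_def)
    have sub: "norm z < 1 / \<rho> - s" if "z \<in> ball z1 s" for z
      using that norm_triangle_ineq[of "z - z1" z1] by (simp add: dist_norm norm_minus_commute s_def field_simps)
    have sub1: "z \<in> ball 0 (1 / \<rho>)" if "z \<in> ball z1 s" for z using sub[OF that] s by simp
    have far: "norm (q x z) \<ge> s * \<rho>" if "z \<in> ball z1 s" "x \<in> K" for z x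
    proof -
      have "norm z * \<rho> \<le> (1 / \<rho> - s) * \<rho>" using sub[OF that(1)] \<rho> by (intro mult_right_mono) auto
      also have "\<dots> = 1 - s * \<rho>" using \<rho> by (simp add: field_simps)
      finally show ?thesis using small[OF that(2), of z] norm_triangle_ineq2[of 1 "z * x"] by (simp add: q_def)
    qed
    show ?thesis unfolding h_def
    proof (rule has_field_derivative_integral[where ?k0.0="\<lambda>x z. Ln (q x z)" and ?k1.0="\<lambda>x z. - x / q x z"
        and ?k2.0="\<lambda>x z. - x\<^sup>2 / (q x z)\<^sup>2" and B="\<rho>\<^sup>2 / (s * \<rho>)\<^sup>2" and r=s])
      fix z x assume zx: "z \<in> ball z1 s" "x \<in> K"
      have q0: "q x z \<noteq> 0" "q x z \<notin> \<real>\<^sub>\<le>\<^sub>0" using one_minus_not_neg[OF small1[OF zx(2) sub1[OF zx(1)]]] by (auto simp: q_def)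
      have q': "(q x has_field_derivative - x) (at z)"
        unfolding q_def by (auto intro!: derivative_eq_intros)
      show "((\<lambda>z. Ln (q x z)) has_field_derivative - x / q x z) (at z)"
        using DERIV_chain2[OF has_field_derivative_Ln[OF q0(2)] q'] by (simp add: divide_inverse mult.commute)
      show "((\<lambda>z. - x / q x z) has_field_derivative - x\<^sup>2 / (q x z)\<^sup>2) (at z)"
        using q0(1) by (auto intro!: derivative_eq_intros q' simp: power2_eq_square)
      have "norm (q x z) ^ 2 \<ge> (s * \<rho>) ^ 2" using far[OF zx] s \<rho> by (intro power_mono) auto
      moreover have "norm x ^ 2 \<le> \<rho>\<^sup>2" using xr[OF zx(2)] by (intro power_mono) auto
      ultimately show "norm (- x\<^sup>2 / (q x z)\<^sup>2) \<le> \<rho>\<^sup>2 / (s * \<rho>)\<^sup>2"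
        using s \<rho> by (auto simp: norm_divide norm_power intro!: frac_le)
    next
      fix z assume "z \<in> ball z1 s"
      from cont[OF sub1[OF this]] show "continuous_on K (\<lambda>x. Ln (q x z))" .
    next
      show "continuous_on K (\<lambda>x. - x / q x z1)" by (rule cont1[OF z1])
    qed (rule s)
  qed
  show ?thesis
  proof (rule that[of h])
    show "h holomorphic_on ball 0 (1 / \<rho>)"
      using der by (meson field_differentiable_at_within field_differentiable_def holomorphic_onI)
    show "h 0 = 0" by (simp add: h_def q_def)
    fix z :: complex assume z: "z \<in> ball 0 (1 / \<rho>)" "z \<noteq> 0"
    have nz: "1 / z \<noteq> x" if "x \<in> K" for x
      using one_minus_not_neg(2)[OF small1[OF that z(1)]] z by auto
    have c: "continuous_on K (\<lambda>x. ln (norm (1 / z - x)))"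
      using nz by (intro continuous_intros) auto
    have "Re (h z) = (\<integral>w. ln (norm (1 / z - X w)) + ln (norm z) \<partial>N)"
      unfolding h_def integral_Re[OF cont[OF z(1)]]
    proof (rule Bochner_Integration.integral_cong[OF refl])
      fix w assume w: "w \<in> space N"
      have "q (X w) z = z * (1 / z - X w)" using z by (simp add: q_def field_simps)
      moreover have "1 / z - X w \<noteq> 0" using nz[OF X_in[OF w]] by simp
      ultimately show "Re (Ln (q (X w) z)) = ln (norm (1 / z - X w)) + ln (norm z)"
        using z by (simp add: norm_mult ln_mult del: right_diff_distrib)
    qed
    also have "\<dots> = log_pot N X (1 / z) + ln (norm z)"
      unfolding log_pot_def using integrable_comp[OF c] by (simp add: prob_space)
    finally show "Re (h z) = log_pot N X (1 / z) + ln (norm z)" .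
    have "cauchy_tr N X (1 / z) = (\<integral>w. z - z\<^sup>2 * (- X w / q (X w) z) \<partial>N)"
      unfolding cauchy_tr_def
    proof (rule Bochner_Integration.integral_cong[OF refl])
      fix w assume w: "w \<in> space N"
      have "q (X w) z \<noteq> 0" using one_minus_not_neg(2)[OF small1[OF X_in[OF w] z(1)]] by (simp add: q_def)
      moreover have "1 / z - X w = q (X w) z / z" using z by (simp add: q_def field_simps)
      ultimately show "1 / (1 / z - X w) = z - z\<^sup>2 * (- X w / q (X w) z)"
      proof -
        have "z * q (X w) z + z\<^sup>2 * X w = z" by (simp add: q_def algebra_simps power2_eq_square)
        then have "z / q (X w) z = (z * q (X w) z + z\<^sup>2 * X w) / q (X w) z" by simp
        also have "\<dots> = z - z\<^sup>2 * (- X w / q (X w) z)"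
          using \<open>q (X w) z \<noteq> 0\<close> by (simp add: add_divide_distrib)
        finally show ?thesis using \<open>1 / z - X w = q (X w) z / z\<close> by simp
      qed
    qed
    also have "\<dots> = z - z\<^sup>2 * (\<integral>w. - X w / q (X w) z \<partial>N)"
    proof -
      have "(\<integral>w. z - z\<^sup>2 * (- X w / q (X w) z) \<partial>N) = (\<integral>w. z \<partial>N) - (\<integral>w. z\<^sup>2 * (- X w / q (X w) z) \<partial>N)"
        by (intro Bochner_Integration.integral_diff integrable_mult_right integrable_comp[OF cont1[OF z(1)]]) simp
      also have "(\<integral>w. z\<^sup>2 * (- X w / q (X w) z) \<partial>N) = z\<^sup>2 * (\<integral>w. - X w / q (X w) z \<partial>N)"
        by (rule Bochner_Integration.integral_mult_right_zero)
      finally show ?thesis by (simp add: prob_space)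
    qed
    also have "(\<integral>w. - X w / q (X w) z \<partial>N) = deriv h z" using DERIV_imp_deriv[OF der[OF z(1)]] by simp
    finally show "cauchy_tr N X (1 / z) = z - z\<^sup>2 * deriv h z" .
  qed
qed

end

text \<open>The minimum principle on an unbounded set. The difference \<open>H\<close> is harmonic
  off \<open>K1\<close> and \<open>K2\<close> and tends to 0 at infinity, so a value below - \<eta>
  would force an interior minimum. Among the minimum points one furthest from the origin is chosen;
  as \<open>H\<close> is constant near it, another minimum point lies still further out.\<close>

lemma log_pot_diff_minimum:
  fixes N1 :: "'b measure" and N2 :: "'c measure"
  assumes "compact_rv N1 X1 K1" and "compact_rv N2 X2 K2"
    and E: "closed E" "E \<inter> K1 = {}" "E \<inter> K2 = {}"
    and bd: "\<And>v. v \<in> E \<Longrightarrow> v \<in> interior E \<or> log_pot N1 X1 v - log_pot N2 X2 v \<ge> - \<eta>" and \<eta>: "\<eta> > 0"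
    and v: "v \<in> E"
  shows "log_pot N1 X1 v - log_pot N2 X2 v \<ge> - \<eta>"
proof (rule ccontr)
  assume neg: "\<not> ?thesis"
  interpret A: compact_rv N1 X1 K1 by fact
  interpret B: compact_rv N2 X2 K2 by fact
  define H where "H u = log_pot N1 X1 u - log_pot N2 X2 u" for u
  have bdd: "bounded (K1 \<union> K2)" using A.compact_K B.compact_K by (auto intro: compact_imp_bounded)
  then obtain \<rho> where \<rho>: "\<rho> > 0" "\<And>u. u \<in> K1 \<union> K2 \<Longrightarrow> norm u \<le> \<rho>" by (auto simp: bounded_pos)
  have sub: "K1 \<subseteq> cball 0 \<rho>" "K2 \<subseteq> cball 0 \<rho>" using \<rho> by auto
  obtain h1 where h1: "h1 holomorphic_on ball 0 (1 / \<rho>)" "h1 0 = 0"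
    "\<And>z. z \<in> ball 0 (1 / \<rho>) \<Longrightarrow> z \<noteq> 0 \<Longrightarrow> Re (h1 z) = log_pot N1 X1 (1 / z) + ln (norm z)"
    by (rule A.log_pot_at_infinity[OF \<rho>(1) sub(1)]) blast
  obtain h2 where h2: "h2 holomorphic_on ball 0 (1 / \<rho>)" "h2 0 = 0"
    "\<And>z. z \<in> ball 0 (1 / \<rho>) \<Longrightarrow> z \<noteq> 0 \<Longrightarrow> Re (h2 z) = log_pot N2 X2 (1 / z) + ln (norm z)"
    by (rule B.log_pot_at_infinity[OF \<rho>(1) sub(2)]) blast
  have "isCont (\<lambda>z. Re (h1 z) - Re (h2 z)) 0"
  proof -
    have "continuous_on (ball 0 (1 / \<rho>)) (\<lambda>z. Re (h1 z) - Re (h2 z))"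
      by (intro continuous_intros holomorphic_on_imp_continuous_on h1 h2)
    then show ?thesis using \<rho>(1) by (simp add: continuous_on_eq_continuous_at)
  qed
  then have "((\<lambda>z. Re (h1 z) - Re (h2 z)) \<longlongrightarrow> 0) (at 0)" by (simp add: isCont_def h1 h2)
  then have "eventually (\<lambda>z. dist (Re (h1 z) - Re (h2 z)) 0 < \<eta>) (at 0)" using \<eta> by (rule tendstoD)
  then obtain s where s: "s > 0" "\<And>z. z \<noteq> 0 \<Longrightarrow> norm z < s \<Longrightarrow> \<bar>Re (h1 z) - Re (h2 z)\<bar> < \<eta>"
    by (auto simp: eventually_at)
  \<comment> \<open>Beyond the first summand the values at infinity are controlled by
    \<open>s\<close> and \<rho>; \<open>norm v + 1\<close> is added so that \<open>v\<close> belongs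
    to the compact set \<open>C\<close>.\<close>
  define T where "T = 1 / min s (1 / \<rho>) + norm v + 1"
  have ms: "min s (1 / \<rho>) > 0" using s(1) \<rho>(1) by simp
  have big: "H u > - \<eta>" if u: "norm u \<ge> T" for u
  proof -
    have "norm u > 1 / min s (1 / \<rho>)" using u norm_ge_zero[of v] unfolding T_def by linarith
    moreover have "1 / min s (1 / \<rho>) > 0" using ms by simp
    ultimately have u0: "norm u > 0" and "1 / norm u < 1 / (1 / min s (1 / \<rho>))"
      by (linarith, intro divide_strict_left_mono mult_pos_pos) linarith+
    then have "1 / norm u < min s (1 / \<rho>)" by simp
    with u0 have "1 / u \<noteq> 0" "norm (1 / u) < s" "1 / u \<in> ball 0 (1 / \<rho>)" by (auto simp: norm_divide)
    then show ?thesis using s(2)[of "1 / u"] h1(3)[of "1 / u"] h2(3)[of "1 / u"] by (simp add: H_def)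
  qed
  have contH: "continuous_on E H"
    unfolding H_def
    by (intro continuous_intros continuous_on_subset[OF A.continuous_on_log_pot] continuous_on_subset[OF B.continuous_on_log_pot])
       (use E in auto)
  define C where "C = E \<inter> cball 0 T"
  have "compact C" unfolding C_def using E(1) by (intro closed_Int_compact) auto
  moreover have "v \<in> C" using v ms by (auto simp: C_def T_def)
  ultimately obtain m where m: "m \<in> C" "\<And>u. u \<in> C \<Longrightarrow> H m \<le> H u"
    using continuous_attains_inf[of C H] continuous_on_subset[OF contH] by (force simp: C_def)
  have Hm: "H m < - \<eta>" using m(2)[OF \<open>v \<in> C\<close>] neg by (simp add: H_def)
  define Q where "Q = {u \<in> C. H u = H m}"
  have "closed (C \<inter> H -` {H m})"
    by (intro continuous_closed_preimage continuous_on_subset[OF contH] compact_imp_closed \<open>compact C\<close>) (auto simp: C_def)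
  then have "compact Q" using \<open>compact C\<close> compact_Int_closed[of C "C \<inter> H -` {H m}"] by (simp add: Q_def vimage_def Int_def conj_ac)
  moreover have "m \<in> Q" using m by (simp add: Q_def)
  ultimately obtain u where u: "u \<in> Q" "\<And>x. x \<in> Q \<Longrightarrow> norm x \<le> norm u"
    using continuous_attains_sup[of Q norm] continuous_on_norm_id by blast
  have Hu: "H u = H m" and uC: "u \<in> C" using u(1) by (auto simp: Q_def)
  have uT: "norm u < T" using big[of u] Hu Hm by linarith
  have "u \<in> interior E" using bd[of u] Hu Hm uC by (auto simp: C_def H_def)
  then obtain r0 where r0: "r0 > 0" "ball u r0 \<subseteq> E" unfolding mem_interior by blast
  define r where "r = min r0 (T - norm u)"
  have r: "r > 0" "ball u r \<subseteq> E" using r0 uT by (auto simp: r_def)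
  have inC: "x \<in> C" if "x \<in> ball u r" for x
  proof -
    have "norm (x - u) < T - norm u" using that by (simp add: r_def dist_norm norm_minus_commute)
    then have "norm x \<le> T" using norm_triangle_ineq[of "x - u" u] by simp
    then show ?thesis using that r(2) by (auto simp: C_def)
  qed
  obtain g1 where g1: "g1 holomorphic_on ball u r" "g1 u = 0"
    "\<And>x. x \<in> ball u r \<Longrightarrow> Re (g1 x) = log_pot N1 X1 x - log_pot N1 X1 u"
    by (rule A.log_pot_local[of u r]) (use r(2) E(2) in blast)+
  obtain g2 where g2: "g2 holomorphic_on ball u r" "g2 u = 0"
    "\<And>x. x \<in> ball u r \<Longrightarrow> Re (g2 x) = log_pot N2 X2 x - log_pot N2 X2 u"
    by (rule B.log_pot_local[of u r]) (use r(2) E(3) in blast)+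
  \<comment> \<open>The modulus of \<phi> is \<open>exp (H u - H x)\<close>, so a minimum of
    \<open>H\<close> at \<open>u\<close> is a maximum of the modulus of a holomorphic
    function.\<close>
  define \<phi> where "\<phi> x = exp (g2 x - g1 x)" for x
  have norm\<phi>: "norm (\<phi> x) = exp (H u - H x)" if "x \<in> ball u r" for x
    using g1(3)[OF that] g2(3)[OF that] by (simp add: \<phi>_def H_def)
  have "\<phi> constant_on ball u r"
  proof (rule maximum_modulus_principle[where U="ball u r" and \<xi>=u])
    show "\<phi> holomorphic_on ball u r" unfolding \<phi>_def by (intro holomorphic_intros g1 g2)
    fix x assume x: "x \<in> ball u r"
    have "u \<in> ball u r" using r by simp
    from norm\<phi>[OF x] norm\<phi>[OF this] m(2)[OF inC[OF x]] Hu show "norm (\<phi> x) \<le> norm (\<phi> u)" by simp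
  qed (use r in auto)
  \<comment> \<open>A point of the ball further from the origin than \<open>u\<close>: a radial step
    outwards, or any small step if \<open>u\<close> is the origin itself.\<close>
  define x where "x = (if u = 0 then of_real (r / 2) else u + of_real (r / (2 * norm u)) * u)"
  have x: "x \<in> ball u r" "norm x > norm u"
  proof -
    show "x \<in> ball u r" using r by (auto simp: x_def dist_norm norm_mult norm_divide)
    show "norm x > norm u"
    proof (cases "u = 0")
      case False
      then have "x = of_real (1 + r / (2 * norm u)) * u" by (simp add: x_def algebra_simps)
      then have "norm x = \<bar>1 + r / (2 * norm u)\<bar> * norm u" by (simp only: norm_mult norm_of_real)
      also have "\<dots> = (1 + r / (2 * norm u)) * norm u" using r by simp
      also have "\<dots> = norm u + r / 2" using False by (simp add: algebra_simps)
      finally show ?thesis using r by simp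
    qed (use r in \<open>simp add: x_def\<close>)
  qed
  have "\<phi> x = \<phi> u" using \<open>\<phi> constant_on ball u r\<close> x r unfolding constant_on_def by (metis centre_in_ball)
  then have "H x = H u" using norm\<phi>[OF x(1)] norm\<phi>[of u] r by simp
  then have "x \<in> Q" using inC[OF x(1)] Hu by (simp add: Q_def)
  then show False using u(2) x(2) by fastforce
qed

text \<open>The map u / (u + 2 \<eta>) sends the half plane Re u > - \<eta> into the unit disc and
  fixes 0. Schwarz's lemma on the disc of half the radius gives
  \<open>norm (h u) \<le> 2 * \<eta>\<close>, and Cauchy's inequality on a circle of radius
  \<open>s / 4\<close> bounds the derivative.\<close>

lemma Schwarz_half_plane:
  assumes h: "h holomorphic_on ball 0 s" "h 0 = 0" and s: "s > 0"
    and Re: "\<And>z. z \<in> ball 0 s \<Longrightarrow> Re (h z) > - \<eta>" and \<eta>: "\<eta> > 0"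
    and z: "norm z < s / 4"
  shows "norm (deriv h z) \<le> 8 * \<eta> / s"
proof -
  define \<phi> where "\<phi> x = h (s * x) / (h (s * x) + 2 * \<eta>)" for x :: complex
  have sb: "s * x \<in> ball 0 s" if "norm x < 1" for x :: complex using that s by (simp add: norm_mult)
  have nz: "h (s * x) + 2 * \<eta> \<noteq> 0" if "norm x < 1" for x :: complex
  proof -
    have "Re (h (s * x) + 2 * \<eta>) > 0" using Re[OF sb[OF that]] \<eta> by simp
    then show ?thesis by (metis zero_complex.sel(1) less_irrefl)
  qed
  have lt: "norm u < norm (u + 2 * \<eta>)" if "Re u > - \<eta>" for u :: complex
  proof -
    have "\<eta> * (Re u + \<eta>) > 0" using that \<eta> by simp
    then have "(Re u)\<^sup>2 < (Re u + 2 * \<eta>)\<^sup>2" by (simp add: power2_eq_square algebra_simps)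
    then show ?thesis by (simp add: cmod_def)
  qed
  have S: "norm (\<phi> x) \<le> norm x" if x: "norm x < 1" for x
  proof (rule Schwarz_Lemma(1)[OF _ _ _ x])
    have "(\<lambda>x. h (s * x)) holomorphic_on ball 0 1"
    proof -
      have "(\<lambda>x. of_real s * x) ` ball 0 1 \<subseteq> ball (0::complex) s" using sb by (intro image_subsetI) auto
      moreover have "(\<lambda>x. of_real s * x) holomorphic_on ball (0::complex) 1" by (intro holomorphic_intros)
      ultimately show ?thesis
        using holomorphic_on_compose_gen[OF _ h(1)] by (fastforce simp: o_def)
    qed
    then show "\<phi> holomorphic_on ball 0 1"
      unfolding \<phi>_def using nz by (intro holomorphic_intros) auto
    show "\<phi> 0 = 0" using h(2) by (simp add: \<phi>_def)
    fix x :: complex assume "norm x < 1"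
    then show "norm (\<phi> x) < 1"
      using lt[OF Re[OF sb]] nz[of x] by (simp add: \<phi>_def norm_divide)
  qed
  have hb: "norm (h u) \<le> 2 * \<eta>" if u: "norm u \<le> s / 2" for u
  proof -
    define x where "x = u / s"
    have x: "norm x \<le> 1 / 2" "s * x = u" using u s by (auto simp: x_def norm_divide)
    have "norm (\<phi> x) \<le> 1 / 2" using S[of x] x by linarith
    moreover have "norm (h u + 2 * \<eta>) > 0" using nz[of x] x by simp
    ultimately have "norm (h u) \<le> norm (h u + 2 * \<eta>) / 2" using x by (simp add: \<phi>_def norm_divide field_simps)
    also have "\<dots> \<le> (norm (h u) + 2 * \<eta>) / 2" using norm_triangle_ineq[of "h u" "2 * \<eta>"] \<eta> by simp
    finally show ?thesis by simp
  qed
  have sub: "cball z (s / 4) \<subseteq> ball 0 s" and le: "norm u \<le> s / 2" if "u \<in> cball z (s / 4)" for u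
  proof -
    have *: "norm u \<le> s / 2" if "u \<in> cball z (s / 4)" for u
      using that z norm_triangle_ineq[of "u - z" z] by (simp add: dist_norm norm_minus_commute)
    show "norm u \<le> s / 2" by (rule *) fact
    show "cball z (s / 4) \<subseteq> ball 0 s" using * s by (auto dest!: *)
  qed
  have sub: "cball z (s / 4) \<subseteq> ball 0 s" using le s by fastforce
  have "norm ((deriv ^^ 1) h z) \<le> fact 1 * (2 * \<eta>) / (s / 4) ^ 1"
  proof (rule Cauchy_inequality)
    show "h holomorphic_on ball z (s / 4)" using h(1) sub ball_subset_cball holomorphic_on_subset by blast
    show "continuous_on (cball z (s / 4)) h"
      using h(1) sub holomorphic_on_imp_continuous_on holomorphic_on_subset by blast
    show "norm (h x) \<le> 2 * \<eta>" if "norm (z - x) = s / 4" for x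
      using that by (intro hb le) (simp add: dist_norm)
  qed (use s in simp)
  then show ?thesis by simp
qed

text \<open>A one-sided bound is enough: in the coordinate 1/v the holomorphic difference
  \<open>D\<close> of the potentials vanishes at 0 and has real part above
  \<open>- (2 * \<eta> n)\<close>, so its derivative, and with it the difference of the Cauchy
  transforms, is of order \<open>\<eta> n\<close>. Doubling \<open>\<eta> n\<close> makes the
  inequality strict.\<close>

lemma cauchy_tr_convergence:
  fixes N :: "'b measure" and N' :: "nat \<Rightarrow> 'c measure"
  assumes A: "compact_rv N X K" and B: "\<And>n. compact_rv (N' n) (X' n) (K' n)"
    and \<rho>: "\<rho> > 0" "K \<subseteq> cball 0 \<rho>" "\<And>n. K' n \<subseteq> cball 0 \<rho>"
    and E: "\<And>n. closed (E n)" "\<And>n. E n \<inter> K = {}" "\<And>n. E n \<inter> K' n = {}" "\<And>n. - cball 0 \<rho> \<subseteq> E n"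
    and bd: "\<And>n v. v \<in> E n \<Longrightarrow> v \<in> interior (E n) \<or> log_pot N X v - log_pot (N' n) (X' n) v \<ge> - \<eta> n"
    and \<eta>: "\<And>n. \<eta> n > 0" "\<eta> \<longlonglongrightarrow> 0"
    and v: "norm v > 4 * \<rho>"
  shows "(\<lambda>n. cauchy_tr (N' n) (X' n) v) \<longlonglongrightarrow> cauchy_tr N X v"
proof -
  define z where "z = 1 / v"
  have v0: "norm v > 0" using v \<rho>(1) by linarith
  then have z: "z \<noteq> 0" "norm z < (1 / \<rho>) / 4" "1 / z = v"
    using v \<rho>(1) by (auto simp: z_def norm_divide divide_simps)
  have "1 / \<rho> / 4 < 1 / \<rho>" using \<rho>(1) by (simp add: divide_simps)
  then have "norm z < 1 / \<rho>" using z(2) by (rule less_trans[rotated])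
  then have zb: "z \<in> ball 0 (1 / \<rho>)" by simp
  obtain h where h: "h holomorphic_on ball 0 (1 / \<rho>)" "h 0 = 0"
    "\<And>z. z \<in> ball 0 (1 / \<rho>) \<Longrightarrow> z \<noteq> 0 \<Longrightarrow> Re (h z) = log_pot N X (1 / z) + ln (norm z)"
    "\<And>z. z \<in> ball 0 (1 / \<rho>) \<Longrightarrow> z \<noteq> 0 \<Longrightarrow> cauchy_tr N X (1 / z) = z - z\<^sup>2 * deriv h z"
    by (rule compact_rv.log_pot_at_infinity[OF A \<rho>(1,2)]) blast
  have bound: "norm (cauchy_tr (N' n) (X' n) v - cauchy_tr N X v) \<le> 16 * \<rho> * (norm z)\<^sup>2 * \<eta> n" for n
  proof -
    obtain k where k: "k holomorphic_on ball 0 (1 / \<rho>)" "k 0 = 0"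
      "\<And>z. z \<in> ball 0 (1 / \<rho>) \<Longrightarrow> z \<noteq> 0 \<Longrightarrow> Re (k z) = log_pot (N' n) (X' n) (1 / z) + ln (norm z)"
      "\<And>z. z \<in> ball 0 (1 / \<rho>) \<Longrightarrow> z \<noteq> 0 \<Longrightarrow> cauchy_tr (N' n) (X' n) (1 / z) = z - z\<^sup>2 * deriv k z"
      by (rule compact_rv.log_pot_at_infinity[OF B \<rho>(1,3)]) blast
    define D where "D x = h x - k x" for x
    have "norm (deriv D z) \<le> 8 * (2 * \<eta> n) / (1 / \<rho>)"
    proof (rule Schwarz_half_plane[OF _ _ _ _ _ z(2)])
      show "D holomorphic_on ball 0 (1 / \<rho>)" unfolding D_def by (intro holomorphic_intros h k)
      fix x :: complex assume x: "x \<in> ball 0 (1 / \<rho>)"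
      show "Re (D x) > - (2 * \<eta> n)"
      proof (cases "x = 0")
        case False
        then have "norm (1 / x) > \<rho>" using x \<rho>(1) by (simp add: norm_divide field_simps)
        then have "1 / x \<in> E n" using E(4)[of n] by auto
        from log_pot_diff_minimum[OF A B E(1-3) bd \<eta>(1) this]
        have "log_pot N X (1 / x) - log_pot (N' n) (X' n) (1 / x) \<ge> - \<eta> n" .
        then show ?thesis using h(3)[OF x False] k(3)[OF x False] \<eta>(1)[of n] by (simp add: D_def)
      qed (simp add: D_def h k \<eta>)
    qed (use \<rho>(1) \<eta>(1) in \<open>auto simp: D_def h k\<close>)
    moreover have "deriv D z = deriv h z - deriv k z"
      unfolding D_def using h(1) k(1) zb
      by (intro deriv_diff holomorphic_on_imp_differentiable_at[OF _ open_ball]) auto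
    ultimately have "norm (deriv h z - deriv k z) \<le> 16 * \<rho> * \<eta> n" by (simp add: mult_ac)
    then have "(norm z)\<^sup>2 * norm (deriv h z - deriv k z) \<le> (norm z)\<^sup>2 * (16 * \<rho> * \<eta> n)" by (rule mult_left_mono) simp
    moreover have "cauchy_tr (N' n) (X' n) v - cauchy_tr N X v = z\<^sup>2 * (deriv h z - deriv k z)"
      using h(4)[OF zb z(1)] k(4)[OF zb z(1)] z(3) by (simp add: algebra_simps)
    ultimately show ?thesis by (simp add: norm_mult norm_power mult_ac)
  qed
  have "(\<lambda>n. cauchy_tr (N' n) (X' n) v - cauchy_tr N X v) \<longlonglongrightarrow> 0"
  proof (rule Lim_null_comparison)
    show "(\<lambda>n. 16 * \<rho> * (norm z)\<^sup>2 * \<eta> n) \<longlonglongrightarrow> 0" using tendsto_mult_right_zero[OF \<eta>(2)] by simp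
  qed (use bound in simp)
  then show ?thesis by (simp add: LIM_zero_iff)
qed

section \<open>Mass of a part of the support from Cauchy transforms\<close>

definition partial_cauchy :: "'b measure \<Rightarrow> ('b \<Rightarrow> complex) \<Rightarrow> complex set \<Rightarrow> complex \<Rightarrow> complex" where
  "partial_cauchy N X A v = (\<integral>w. (if X w \<in> A then 1 / (v - X w) else 0) \<partial>N)"

text \<open>Since \<open>A\<close> and \<open>B\<close> are disjoint compact sets, cutting a kernel
  off outside \<open>A\<close> keeps it continuous on the whole support. The mass is recovered from
  the factor \<open>v\<close>, because v / (v - x) tends to 1 at infinity uniformly for
  \<open>x\<close> in \<open>A\<close>.\<close>

lemma
  assumes "compact_rv N X (A \<union> B)" and AB: "compact A" "compact B" "A \<inter> B = {}"
  shows partial_cauchy_holomorphic: "partial_cauchy N X A holomorphic_on - A"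
    and partial_cauchy_bound: "\<And>v \<delta>. \<delta> > 0 \<Longrightarrow> (\<And>x. x \<in> A \<Longrightarrow> \<delta> \<le> dist v x) \<Longrightarrow> norm (partial_cauchy N X A v) \<le> 1 / \<delta>"
    and partial_cauchy_mass: "\<And>v \<rho>. \<rho> > 0 \<Longrightarrow> A \<subseteq> cball 0 \<rho> \<Longrightarrow> norm v > \<rho> \<Longrightarrow>
          norm (v * partial_cauchy N X A v - of_real (measure N {w \<in> space N. X w \<in> A})) \<le> \<rho> / (norm v - \<rho>)"
    and partial_cauchy_sum: "\<And>v. v \<notin> A \<union> B \<Longrightarrow> partial_cauchy N X A v + partial_cauchy N X B v = cauchy_tr N X v"
proof -
  interpret compact_rv N X "A \<union> B" by fact
  have cont: "continuous_on (A \<union> B) (\<lambda>x. if x \<in> A then k x else 0)" if "continuous_on A k" for k :: "complex \<Rightarrow> complex"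
    using AB that by (intro continuous_on_cases compact_imp_closed) auto
  have cont': "continuous_on (A \<union> B) (\<lambda>x. if x \<in> B then k x else 0)" if "continuous_on B k" for k :: "complex \<Rightarrow> complex"
  proof -
    have "continuous_on (B \<union> A) (\<lambda>x. if x \<in> B then k x else 0)"
      using AB that by (intro continuous_on_cases compact_imp_closed) auto
    then show ?thesis by (simp add: Un_commute)
  qed
  have c1: "continuous_on A (\<lambda>x. 1 / (v - x))" if "v \<notin> A" for v using that by (intro continuous_intros) auto
  show "partial_cauchy N X A holomorphic_on - A"
  proof (rule holomorphic_onI)
    fix v0 assume v0: "v0 \<in> - A"
    obtain e where e: "e > 0" "ball v0 e \<subseteq> - A"
      using v0 compact_imp_closed[OF AB(1)] open_contains_ball_eq[of "- A"] by (auto simp: open_Compl)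
    define r where "r = e / 2"
    have r: "r > 0" using e by (simp add: r_def)
    have far: "norm (v - x) \<ge> r" if "v \<in> ball v0 r" "x \<in> A" for v x
    proof (rule ccontr)
      assume "\<not> ?thesis"
      then have "norm (v0 - x) < e" using that norm_triangle_ineq[of "v0 - v" "v - x"] by (simp add: dist_norm r_def)
      then show False using e(2) that by (auto simp: dist_norm subset_iff)
    qed
    have nz: "v \<noteq> x" if "v \<in> ball v0 r" "x \<in> A" for v x using far[OF that] r by auto
    have "((\<lambda>v. \<integral>w. (if X w \<in> A then 1 / (v - X w) else 0) \<partial>N) has_field_derivative
        (\<integral>w. (if X w \<in> A then - 1 / (v0 - X w)\<^sup>2 else 0) \<partial>N)) (at v0)"
    proof (rule has_field_derivative_integral[where ?k0.0="\<lambda>x v. if x \<in> A then 1 / (v - x) else 0"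
          and ?k1.0="\<lambda>x v. if x \<in> A then - 1 / (v - x)\<^sup>2 else 0"
          and ?k2.0="\<lambda>x v. if x \<in> A then 2 / (v - x) ^ 3 else 0" and B="2 / r ^ 3" and r=r])
      fix v x assume vx: "v \<in> ball v0 r"
      show "((\<lambda>v. if x \<in> A then 1 / (v - x) else 0) has_field_derivative (if x \<in> A then - 1 / (v - x)\<^sup>2 else 0)) (at v)"
        using nz[OF vx] by (auto intro!: derivative_eq_intros simp: power2_eq_square)
      show "((\<lambda>v. if x \<in> A then - 1 / (v - x)\<^sup>2 else 0) has_field_derivative (if x \<in> A then 2 / (v - x) ^ 3 else 0)) (at v)"
      proof (cases "x \<in> A")
        case True
        then have "v - x \<noteq> 0" using nz[OF vx] by simp
        then have "((\<lambda>v. - 1 / (v - x)\<^sup>2) has_field_derivative - (- 1 * (2 * (v - x))) / ((v - x)\<^sup>2 * (v - x)\<^sup>2)) (at v)"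
          by (auto intro!: derivative_eq_intros) (metis minus_divide_left minus_diff_eq)
        moreover have "- (- 1 * (2 * (v - x))) / ((v - x)\<^sup>2 * (v - x)\<^sup>2) = 2 / (v - x) ^ 3"
          using \<open>v - x \<noteq> 0\<close> by (simp add: power2_eq_square power3_eq_cube divide_simps del: right_diff_distrib left_diff_distrib right_minus_eq)
        ultimately show ?thesis using True by simp
      qed simp
      show "norm (if x \<in> A then 2 / (v - x) ^ 3 else 0) \<le> 2 / r ^ 3"
      proof (cases "x \<in> A")
        case True
        have "norm (v - x) ^ 3 \<ge> r ^ 3" using far[OF vx True] r(1) by (intro power_mono) auto
        then show ?thesis using r(1) nz[OF vx] True by (auto simp: norm_divide norm_power intro!: divide_left_mono)
      qed (use r in simp)
    next
      fix v assume "v \<in> ball v0 r"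
      then show "continuous_on (A \<union> B) (\<lambda>x. if x \<in> A then 1 / (v - x) else 0)"
        using nz by (intro cont c1) auto
    next
      show "continuous_on (A \<union> B) (\<lambda>x. if x \<in> A then - 1 / (v0 - x)\<^sup>2 else 0)"
        using nz[of v0] r by (intro cont continuous_intros) auto
    qed (rule r)
    then show "partial_cauchy N X A field_differentiable at v0 within - A"
      unfolding partial_cauchy_def by (meson field_differentiable_at_within field_differentiable_def)
  qed
  show "norm (partial_cauchy N X A v) \<le> 1 / \<delta>" if \<delta>: "\<delta> > 0" "\<And>x. x \<in> A \<Longrightarrow> \<delta> \<le> dist v x" for v \<delta>
  proof -
    have "v \<notin> A" using \<delta>(1) \<delta>(2)[of v] by auto
    have "norm (partial_cauchy N X A v) \<le> (\<integral>w. 1 / \<delta> \<partial>N)"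
      unfolding partial_cauchy_def
    proof (rule order_trans[OF integral_norm_bound integral_mono])
      show "integrable N (\<lambda>w. norm (if X w \<in> A then 1 / (v - X w) else 0))"
        by (intro integrable_norm integrable_comp cont c1 \<open>v \<notin> A\<close>)
      fix w assume "w \<in> space N"
      show "norm (if X w \<in> A then 1 / (v - X w) else 0) \<le> 1 / \<delta>"
        using \<delta>(1) \<delta>(2)[of "X w"] by (auto simp: norm_divide dist_norm intro!: divide_left_mono mult_pos_pos)
    qed simp
    then show ?thesis by (simp add: prob_space)
  qed
  show "norm (v * partial_cauchy N X A v - of_real (measure N {w \<in> space N. X w \<in> A})) \<le> \<rho> / (norm v - \<rho>)"
    if \<rho>: "\<rho> > 0" "A \<subseteq> cball 0 \<rho>" "norm v > \<rho>" for v \<rho>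
  proof -
    have vA: "v \<notin> A" using \<rho> by auto
    have meas: "{w \<in> space N. X w \<in> A} \<in> sets N"
      using X_meas compact_imp_closed[OF AB(1)] measurable_sets[of X N borel A] by (simp add: vimage_def Int_def conj_commute)
    have i1: "integrable N (\<lambda>w. if X w \<in> A then 1 / (v - X w) else 0)" by (intro integrable_comp cont c1 vA)
    have i2: "integrable N (\<lambda>w. complex_of_real (indicator {w \<in> space N. X w \<in> A} w))"
      using meas by (intro integrable_const_bound[where B=1]) (auto simp: indicator_def)
    have "v * partial_cauchy N X A v - of_real (measure N {w \<in> space N. X w \<in> A}) =
        (\<integral>w. v * (if X w \<in> A then 1 / (v - X w) else 0) - of_real (indicator {w \<in> space N. X w \<in> A} w) \<partial>N)"
    proof -
      have "(\<integral>w. complex_of_real (indicator {w \<in> space N. X w \<in> A} w) \<partial>N) = of_real (measure N {w \<in> space N. X w \<in> A})"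
        unfolding integral_complex_of_real using meas by simp
      then show ?thesis
        unfolding partial_cauchy_def using i1 i2
        by (subst Bochner_Integration.integral_diff) simp_all
    qed
    also have "norm \<dots> \<le> (\<integral>w. \<rho> / (norm v - \<rho>) \<partial>N)"
    proof (rule order_trans[OF integral_norm_bound integral_mono])
      show "integrable N (\<lambda>w. norm (v * (if X w \<in> A then 1 / (v - X w) else 0) - of_real (indicator {w \<in> space N. X w \<in> A} w)))"
        by (intro integrable_norm Bochner_Integration.integrable_diff integrable_mult_right i1 i2)
      fix w assume w: "w \<in> space N"
      show "norm (v * (if X w \<in> A then 1 / (v - X w) else 0) - of_real (indicator {w \<in> space N. X w \<in> A} w)) \<le> \<rho> / (norm v - \<rho>)"
      proof (cases "X w \<in> A")
        case True
        then have ne: "v - X w \<noteq> 0" using vA by auto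
        have Xr: "norm (X w) \<le> \<rho>" using True \<rho> by auto
        have "v * (1 / (v - X w)) - 1 = X w / (v - X w)" using ne by (simp add: field_simps)
        then have "norm (v * (1 / (v - X w)) - 1) = norm (X w) / norm (v - X w)" by (simp add: norm_divide)
        also have "\<dots> \<le> \<rho> / (norm v - \<rho>)"
          using Xr \<rho> norm_triangle_ineq2[of v "X w"] by (intro frac_le) auto
        finally show ?thesis using True w by simp
      qed (use \<rho> in simp)
    qed simp
    finally show ?thesis by (simp add: prob_space)
  qed
  show "partial_cauchy N X A v + partial_cauchy N X B v = cauchy_tr N X v" if v: "v \<notin> A \<union> B" for v
  proof -
    have i1: "integrable N (\<lambda>w. if X w \<in> A then 1 / (v - X w) else 0)" using v by (intro integrable_comp cont c1) auto
    have "continuous_on B (\<lambda>x. 1 / (v - x))" using v by (intro continuous_intros) auto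
    then have i2: "integrable N (\<lambda>w. if X w \<in> B then 1 / (v - X w) else 0)" by (intro integrable_comp cont')
    have "partial_cauchy N X A v + partial_cauchy N X B v =
        (\<integral>w. (if X w \<in> A then 1 / (v - X w) else 0) + (if X w \<in> B then 1 / (v - X w) else 0) \<partial>N)"
      unfolding partial_cauchy_def using i1 i2 by simp
    also have "\<dots> = cauchy_tr N X v"
      unfolding cauchy_tr_def by (rule Bochner_Integration.integral_cong) (use X_in AB(3) in auto)
    finally show ?thesis .
  qed
qed

text \<open>On a compact set at distance \<delta> from \<open>A\<close> every difference is bounded
  by 2 / \<delta>, so the family is normal.\<close>

lemma partial_cauchy_Montel:
  fixes N :: "'b measure" and N' :: "nat \<Rightarrow> 'c measure"
  assumes rv: "compact_rv N X (A \<union> B)" "\<And>n. compact_rv (N' n) (X' n) (A \<union> B)"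
    and AB: "compact A" "compact B" "A \<inter> B = {}"
  obtains g r where "g holomorphic_on - A" "strict_mono (r :: nat \<Rightarrow> nat)"
    "\<And>v. v \<in> - A \<Longrightarrow> (\<lambda>n. partial_cauchy N X A v - partial_cauchy (N' (r n)) (X' (r n)) A v) \<longlonglongrightarrow> g v"
proof -
  define G where "G n v = partial_cauchy N X A v - partial_cauchy (N' n) (X' n) A v" for n v
  have op: "open (- A)" using AB by (intro open_Compl compact_imp_closed)
  obtain g r where "g holomorphic_on - A" "strict_mono (r :: nat \<Rightarrow> nat)" "\<And>x. x \<in> - A \<Longrightarrow> ((\<lambda>n. G (r n) x) \<longlongrightarrow> g x) sequentially"
  proof (rule Montel[OF op, of "range G" G])
    show "h holomorphic_on - A" if "h \<in> range G" for h
    proof -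
      obtain n where "h = G n" using \<open>h \<in> range G\<close> by blast
      then show ?thesis unfolding G_def
        by (auto intro!: holomorphic_intros partial_cauchy_holomorphic[OF rv(1) AB] partial_cauchy_holomorphic[OF rv(2) AB])
    qed
    show "\<exists>C. \<forall>h\<in>range G. \<forall>z\<in>Q. norm (h z) \<le> C" if Q: "compact Q" "Q \<subseteq> - A" for Q
    proof -
      obtain \<delta> where \<delta>: "\<delta> > 0" "\<And>x y. x \<in> Q \<Longrightarrow> y \<in> A \<Longrightarrow> \<delta> \<le> dist x y"
        using separate_compact_closed[OF Q(1) compact_imp_closed[OF AB(1)]] Q(2) by blast
      have "norm (G n z) \<le> 1 / \<delta> + 1 / \<delta>" if z: "z \<in> Q" for n z
        unfolding G_def
        using norm_triangle_ineq4[of "partial_cauchy N X A z" "partial_cauchy (N' n) (X' n) A z"]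
          partial_cauchy_bound[OF rv(1) AB \<delta>(1) \<delta>(2)[OF z]] partial_cauchy_bound[OF rv(2) AB \<delta>(1) \<delta>(2)[OF z], of n]
        by linarith
      then show ?thesis by blast
    qed
  qed auto
  then show ?thesis using that unfolding G_def by blast
qed

text \<open>
  Limits of the parts of the Cauchy transforms belonging to \<open>A\<close> and to \<open>B\<close> cancel outside \<open>A \<union> B\<close>, so
  they glue to an entire function that vanishes at infinity.
\<close>

lemma mass_le_of_cauchy_convergence:
  fixes N :: "'b measure" and N' :: "nat \<Rightarrow> 'c measure"
  assumes rv: "compact_rv N X (A \<union> B)" "\<And>n. compact_rv (N' n) (X' n) (A \<union> B)"
    and AB: "compact A" "compact B" "A \<inter> B = {}" and conn: "connected (- (A \<union> B))"
    and conv: "\<And>v. norm v > \<rho>0 \<Longrightarrow> (\<lambda>n. cauchy_tr (N' n) (X' n) v) \<longlonglongrightarrow> cauchy_tr N X v"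
    and mass: "\<And>n. measure (N' n) {w \<in> space (N' n). X' n w \<in> A} \<le> \<beta>"
  shows "measure N {w \<in> space N. X w \<in> A} \<le> \<beta>"
proof -
  have BA: "compact B" "compact A" "B \<inter> A = {}" using AB by auto
  have rv': "compact_rv N X (B \<union> A)" "\<And>n. compact_rv (N' n) (X' n) (B \<union> A)" using rv by (simp_all add: Un_commute)
  obtain g1 r1 where g1: "g1 holomorphic_on - A" "strict_mono (r1 :: nat \<Rightarrow> nat)"
    "\<And>v. v \<in> - A \<Longrightarrow> (\<lambda>n. partial_cauchy N X A v - partial_cauchy (N' (r1 n)) (X' (r1 n)) A v) \<longlonglongrightarrow> g1 v"
    by (rule partial_cauchy_Montel[where N'=N' and X'=X', OF rv AB]) blast
  obtain g2 r2 where g2: "g2 holomorphic_on - B" "strict_mono (r2 :: nat \<Rightarrow> nat)"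
    "\<And>v. v \<in> - B \<Longrightarrow> (\<lambda>n. partial_cauchy N X B v - partial_cauchy (N' (r1 (r2 n))) (X' (r1 (r2 n))) B v) \<longlonglongrightarrow> g2 v"
    by (rule partial_cauchy_Montel[where N'="\<lambda>n. N' (r1 n)" and X'="\<lambda>n. X' (r1 n)", OF rv'(1) rv'(2) BA]) blast
  \<comment> \<open>A subsequence along which the parts for \<open>A\<close> and for
    \<open>B\<close> both converge.\<close>
  define r where "r n = r1 (r2 n)" for n
  have r: "strict_mono r" using g1(2) g2(2) by (simp add: r_def strict_mono_def)
  have lim1: "(\<lambda>n. partial_cauchy N X A v - partial_cauchy (N' (r n)) (X' (r n)) A v) \<longlonglongrightarrow> g1 v" if "v \<in> - A" for v
    using LIMSEQ_subseq_LIMSEQ[OF g1(3)[OF that] g2(2)] by (simp add: o_def r_def)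
  have lim2: "(\<lambda>n. partial_cauchy N X B v - partial_cauchy (N' (r n)) (X' (r n)) B v) \<longlonglongrightarrow> g2 v" if "v \<in> - B" for v
    using g2(3)[OF that] by (simp add: r_def)
  have bdd: "bounded (A \<union> B)" using AB by (auto intro: compact_imp_bounded)
  then obtain b where b: "b > 0" "\<And>x. x \<in> A \<union> B \<Longrightarrow> norm x \<le> b" by (auto simp: bounded_pos)
  have far0: "g1 v + g2 v = 0" if v: "norm v > max \<rho>0 b" for v
  proof -
    have vAB: "v \<notin> A \<union> B" using b(2)[of v] v by auto
    have "(\<lambda>n. cauchy_tr N X v - cauchy_tr (N' (r n)) (X' (r n)) v) \<longlonglongrightarrow> cauchy_tr N X v - cauchy_tr N X v"
      using LIMSEQ_subseq_LIMSEQ[OF conv r] v by (intro tendsto_intros) (auto simp: o_def)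
    moreover have "(\<lambda>n. cauchy_tr N X v - cauchy_tr (N' (r n)) (X' (r n)) v) \<longlonglongrightarrow> g1 v + g2 v"
    proof -
      have "cauchy_tr N X v - cauchy_tr (N' (r n)) (X' (r n)) v =
          (partial_cauchy N X A v - partial_cauchy (N' (r n)) (X' (r n)) A v) + (partial_cauchy N X B v - partial_cauchy (N' (r n)) (X' (r n)) B v)" for n
        using partial_cauchy_sum[OF rv(1) AB vAB] partial_cauchy_sum[OF rv(2) AB vAB, of "r n"] by (simp add: algebra_simps)
      then show ?thesis using tendsto_add[OF lim1 lim2] vAB by auto
    qed
    ultimately show ?thesis using LIMSEQ_unique by fastforce
  qed
  define T where "T = max \<rho>0 b + 1"
  have T: "T > max \<rho>0 b" "T > 0" using b(1) by (auto simp: T_def)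
  \<comment> \<open>The full Cauchy transforms are compared only far out; connectedness of the
    complement of \<open>A \<union> B\<close> carries the cancellation up to the two sets.\<close>
  have sum0: "g1 v + g2 v = 0" if v: "v \<in> - (A \<union> B)" for v
  proof (rule analytic_continuation[of "\<lambda>v. g1 v + g2 v" "- (A \<union> B)" "- cball 0 (max \<rho>0 b)" "of_real T"])
    show "(\<lambda>v. g1 v + g2 v) holomorphic_on - (A \<union> B)"
      by (intro holomorphic_intros holomorphic_on_subset[OF g1(1)] holomorphic_on_subset[OF g2(1)]) auto
    show "open (- (A \<union> B))" using AB by (intro open_Compl compact_imp_closed compact_Un)
    show "- cball 0 (max \<rho>0 b) \<subseteq> - (A \<union> B)" using b(2) by fastforce
    show "of_real T \<in> - (A \<union> B)" using b(2)[of "of_real T"] T by auto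
    have "of_real T \<in> - cball (0::complex) (max \<rho>0 b)" using T by auto
    then show "of_real T islimpt - cball (0::complex) (max \<rho>0 b)"
      by (intro interior_limit_point) (auto simp: interior_open open_Compl)
    show "g1 z + g2 z = 0" if "z \<in> - cball 0 (max \<rho>0 b)" for z
    proof (rule far0)
      show "norm z > max \<rho>0 b" using that by (simp only: Compl_iff mem_cball_0 not_le)
    qed
  qed (use conn v in auto)
  \<comment> \<open>On \<open>A\<close> the function \<open>g1\<close> is replaced by
    \<open>- g2\<close>, which is holomorphic there because \<open>A\<close> and \<open>B\<close>
    are disjoint.\<close>
  define H where "H v = (if v \<in> - A then g1 v else - g2 v)" for v
  have H2: "H v = - g2 v" if "v \<in> - B" for v
    using sum0[of v] that by (auto simp: H_def eq_neg_iff_add_eq_0)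
  have holH: "H holomorphic_on UNIV"
  proof -
    have "H holomorphic_on - A" by (rule holomorphic_transform[OF g1(1)]) (simp add: H_def)
    moreover have "H holomorphic_on - B"
      by (rule holomorphic_transform[of "\<lambda>v. - g2 v"]) (intro holomorphic_intros g2(1), simp add: H2)
    ultimately have "H holomorphic_on (- A \<union> - B)"
      using AB by (intro holomorphic_on_Un open_Compl compact_imp_closed)
    moreover have "- A \<union> - B = UNIV" using AB(3) by auto
    ultimately show ?thesis by simp
  qed
  have g1_bound: "norm (g1 v) \<le> 2 / (norm v - b)" if v: "norm v > b" for v
  proof (rule LIMSEQ_le_const2)
    have vA: "v \<in> - A" using b(2)[of v] v by auto
    show "(\<lambda>n. norm (partial_cauchy N X A v - partial_cauchy (N' (r n)) (X' (r n)) A v)) \<longlonglongrightarrow> norm (g1 v)"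
      by (intro tendsto_norm lim1 vA)
    have pos: "norm v - b > 0" using v by simp
    have ds: "norm v - b \<le> dist v x" if "x \<in> A" for x
      using b(2)[of x] that norm_triangle_ineq2[of v x] by (auto simp: dist_norm)
    have "norm (partial_cauchy N X A v - partial_cauchy (N' (r n)) (X' (r n)) A v) \<le> 2 / (norm v - b)" for n
      using norm_triangle_ineq4[of "partial_cauchy N X A v" "partial_cauchy (N' (r n)) (X' (r n)) A v"]
        partial_cauchy_bound[OF rv(1) AB pos ds] partial_cauchy_bound[OF rv(2) AB pos ds, of "r n"]
      by simp
    then show "\<exists>M. \<forall>n\<ge>M. norm (partial_cauchy N X A v - partial_cauchy (N' (r n)) (X' (r n)) A v) \<le> 2 / (norm v - b)" by blast
  qed
  have "(H \<longlongrightarrow> 0) at_infinity"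
  proof (rule Lim_null_comparison)
    show "eventually (\<lambda>v. norm (H v) \<le> 2 / (norm v - b)) at_infinity"
      unfolding eventually_at_infinity
    proof (intro exI allI impI)
      fix v :: complex assume "norm v \<ge> b + 1"
      then show "norm (H v) \<le> 2 / (norm v - b)" using g1_bound[of v] b(2)[of v] by (auto simp: H_def)
    qed
    have "filterlim (\<lambda>v::complex. norm v - b) at_top at_infinity"
      using filterlim_tendsto_add_at_top[OF tendsto_const filterlim_norm_at_top, of "- b"] by simp
    then show "((\<lambda>v::complex. 2 / (norm v - b)) \<longlongrightarrow> 0) at_infinity"
      by (intro tendsto_divide_0[OF tendsto_const] filterlim_at_top_imp_at_infinity)
  qed
  then have H0: "H v = 0" for v using Liouville_weak[OF holH] by blast
  show ?thesis
  proof (rule field_le_epsilon)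
    fix \<epsilon> :: real assume \<epsilon>: "\<epsilon> > 0"
    \<comment> \<open>Chosen so that both errors \<open>b / (norm v - b)\<close> in recovering a
      mass equal \<open>\<epsilon> / 2\<close>.\<close>
    define v :: complex where "v = of_real (b + 2 * b / \<epsilon>)"
    have nv: "norm v - b = 2 * b / \<epsilon>" "norm v > b" using b(1) \<epsilon> by (auto simp: v_def norm_of_real simp del: of_real_add)
    have vA: "v \<in> - A" using b(2)[of v] nv by auto
    have Ab: "A \<subseteq> cball 0 b" using b(2) by auto
    have le: "measure N {w \<in> space N. X w \<in> A} - \<beta> - \<epsilon> \<le>
        norm v * norm (partial_cauchy N X A v - partial_cauchy (N' (r n)) (X' (r n)) A v)" for n
    proof -
      let ?m = "measure N {w \<in> space N. X w \<in> A}" and ?m' = "measure (N' (r n)) {w \<in> space (N' (r n)). X' (r n) w \<in> A}"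
      let ?c = "v * partial_cauchy N X A v" and ?c' = "v * partial_cauchy (N' (r n)) (X' (r n)) A v"
      have e1: "norm (?c - of_real ?m) \<le> \<epsilon> / 2"
        using partial_cauchy_mass[OF rv(1) AB b(1) Ab nv(2)] nv(1) b(1) \<epsilon> by simp
      have e2: "norm (?c' - of_real ?m') \<le> \<epsilon> / 2"
        using partial_cauchy_mass[OF rv(2) AB b(1) Ab nv(2), of "r n"] nv(1) b(1) \<epsilon> by simp
      have eq: "of_real (?m - ?m') = (?c - ?c') - (?c - of_real ?m) + (?c' - of_real ?m')" by simp
      have "\<bar>?m - ?m'\<bar> = norm (of_real (?m - ?m') :: complex)" by (simp only: norm_of_real)
      also have "\<dots> = norm ((?c - ?c') - (?c - of_real ?m) + (?c' - of_real ?m'))" by (simp only: eq)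
      also have "\<dots> \<le> norm (?c - ?c') + norm (?c - of_real ?m) + norm (?c' - of_real ?m')"
        using norm_triangle_ineq[of "(?c - ?c') - (?c - of_real ?m)" "?c' - of_real ?m'"]
          norm_triangle_ineq4[of "?c - ?c'" "?c - of_real ?m"] by linarith
      also have "norm (?c - ?c') = norm v * norm (partial_cauchy N X A v - partial_cauchy (N' (r n)) (X' (r n)) A v)"
        by (simp add: norm_mult flip: right_diff_distrib)
      finally show ?thesis using e1 e2 mass[of "r n"] by linarith
    qed
    have "(\<lambda>n. norm v * norm (partial_cauchy N X A v - partial_cauchy (N' (r n)) (X' (r n)) A v)) \<longlonglongrightarrow> norm v * norm (g1 v)"
      by (intro tendsto_intros lim1 vA)
    moreover have "g1 v = 0" using H0[of v] vA by (simp add: H_def)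
    ultimately have "(\<lambda>n. norm v * norm (partial_cauchy N X A v - partial_cauchy (N' (r n)) (X' (r n)) A v)) \<longlonglongrightarrow> 0" by simp
    then have "measure N {w \<in> space N. X w \<in> A} - \<beta> - \<epsilon> \<le> 0"
      by (rule LIMSEQ_le_const) (use le in blast)
    then show "measure N {w \<in> space N. X w \<in> A} \<le> \<beta> + \<epsilon>" by simp
  qed
qed

section \<open>Mass of clopen parts of the filled Julia set\<close>

context escaping_poly
begin

lemma norm_gt_escapes: "norm z > R \<Longrightarrow> norm (F n z) > R"
proof (induction n)
  case (Suc n)
  then show ?case using escape[of "F n z"] R2 by (simp add: F_Suc)
qed simp

text \<open>A component of the complement contained in the disc would be bounded with
  \<open>norm (F n z) \<le> R\<close> on its frontier; the maximum modulus principle then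
  contradicts membership in the complement. So every component meets the connected outside of the
  disc.\<close>

lemma connected_compl_L: "connected (- L n)"
proof -
  have out: "- cball 0 R \<subseteq> - L n" using L_antimono[of 0 n] by (auto simp: L_0)
  have conn_out: "connected (- cball (0::complex) R)"
    by (intro connected_complement_bounded_convex) auto
  have meets: "connected_component_set (- L n) x \<inter> - cball 0 R \<noteq> {}" if x: "x \<in> - L n" for x
  proof
    define C where "C = connected_component_set (- L n) x"
    assume "connected_component_set (- L n) x \<inter> - cball 0 R = {}"
    then have C: "C \<subseteq> cball 0 R" by (auto simp: C_def)
    have "frontier C \<subseteq> frontier (- L n)" unfolding C_def by (rule frontier_of_connected_component_subset)
    also have "\<dots> \<subseteq> L n" using closed_L[of n] by (simp add: frontier_complement frontier_subset_closed)
    finally have fr: "norm (F n z) \<le> R" if "z \<in> frontier C" for z using that by (auto simp: L_def)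
    have "x \<in> C" using x by (simp add: C_def)
    have "norm (F n x) \<le> R"
    proof (rule maximum_modulus_frontier[of "F n" C])
      show "F n holomorphic_on interior C" by (rule holomorphic_F)
      show "continuous_on (closure C) (F n)" by (rule continuous_on_F)
      show "bounded C" using C bounded_subset bounded_cball by blast
    qed (use fr \<open>x \<in> C\<close> in auto)
    then show False using x by (simp add: L_def)
  qed
  have "connected_component (- L n) x y" if x: "x \<in> - L n" and y: "y \<in> - L n" for x y
  proof -
    obtain x' where x': "connected_component (- L n) x x'" "x' \<in> - cball 0 R" using meets[OF x] by auto
    obtain y' where y': "connected_component (- L n) y y'" "y' \<in> - cball 0 R" using meets[OF y] by auto
    have "connected_component (- L n) x' y'"
      unfolding connected_component_def using conn_out out x' y' by blast
    with x' y' show ?thesis by (meson connected_component_sym connected_component_trans)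
  qed
  then show ?thesis unfolding connected_iff_connected_component by blast
qed

end

context generic_escaping_poly
begin

lemma finite_S_Int: "finite (S n \<inter> V)" using finite_S by simp

text \<open>Because \<open>V\<close> is open and closed in \<open>U m\<close>, it cuts the compact
  set \<open>L (Suc m)\<close> into two compact parts \<open>A\<close> and \<open>B\<close> with
  connected complement of the union. The entry point is compared with uniform distributions on
  fibres, for which the mass of \<open>A\<close> is a proportion of preimages.\<close>

lemma clopen_mass_le:
  fixes \<beta> :: real
  assumes rv: "compact_rv N X (filled_julia f)"
    and pot: "\<And>v. v \<notin> filled_julia f \<Longrightarrow> (\<integral>w. ln (norm (X w - v)) \<partial>N) \<ge> - lim \<gamma>n"
    and V: "open V" "V \<subseteq> U m" "open (U m - V)"
    and card: "\<And>n. n > m \<Longrightarrow> real (card (S n \<inter> V)) \<le> \<beta> * d ^ n"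
  shows "measure N {w \<in> space N. X w \<in> V} \<le> \<beta>"
proof -
  interpret compact_rv N X "filled_julia f" by fact
  define A where "A = V \<inter> L (Suc m)"
  define B where "B = (U m - V) \<inter> L (Suc m)"
  \<comment> \<open>The shift guarantees that the fibres lie in \<open>L (Suc m)\<close> and that
    the counting hypothesis, which asks for levels above \<open>m\<close>, applies to every
    term.\<close>
  define k where "k n = n + Suc m" for n
  have AB: "A \<union> B = L (Suc m)" "A \<inter> B = {}" using L_Suc_subset_U[of m] by (auto simp: A_def B_def)
  have "A = L (Suc m) - (U m - V)" "B = L (Suc m) - V" using L_Suc_subset_U[of m] by (auto simp: A_def B_def)
  then have comp: "compact A" "compact B" using compact_L V by (auto intro!: compact_diff)
  have KL: "filled_julia f \<subseteq> L n" for n by (auto simp: filled_julia_eq)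
  have SL: "S (k n) \<subseteq> L (Suc m)" for n
    using S_subset_U[of "k n"] U_antimono[of "Suc m" "k n"] U_subset_L[of "Suc m"] by (auto simp: k_def)
  define N' where "N' n = uniform_count_measure (S (k n))" for n
  have sp: "space (N' n) = S (k n)" for n by (simp add: N'_def space_uniform_count_measure)
  have prob: "prob_space (N' n)" for n
    unfolding N'_def by (intro prob_space_uniform_count_measure finite_S S_nonempty)
  have meas: "(\<lambda>x. x) \<in> borel_measurable (N' n)" for n
    by (auto simp: N'_def measurable_def space_uniform_count_measure sets_uniform_count_measure)
  have rvL: "compact_rv N X (A \<union> B)"
    unfolding AB by unfold_locales (use X_meas X_in KL compact_L in auto)
  have rv': "compact_rv (N' n) (\<lambda>x. x) C" if "compact C" "S (k n) \<subseteq> C" for n C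
    using prob[of n] meas[of n] that sp[of n] by (auto simp: compact_rv_def compact_rv_axioms_def)
  have int': "log_pot (N' n) (\<lambda>x. x) v = mean_log (S (k n)) v" for n v
    unfolding log_pot_def N'_def mean_log_def using finite_S[of "k n"] by (rule integral_uniform_count_measure)
  \<comment> \<open>The first term compares \<open>\<gamma>n\<close> with its limit, and the second
    comes from \<open>norm (F (k n) v - a) \<le> R + 1\<close> on the level curve. The third keeps
    the sum positive.\<close>
  define \<eta> where "\<eta> n = \<bar>lim \<gamma>n - \<gamma>n (k n)\<bar> + ln (R + 1) * (1 / d) ^ k n + 1 / real (Suc n)" for n
  have R1: "ln (R + 1) \<ge> 0" using R2 by (intro ln_ge_zero) simp
  have k_lim: "filterlim k at_top sequentially" unfolding k_def by (rule filterlim_add_const_nat_at_top)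
  have \<eta>: "\<eta> n > 0" for n using R1 by (auto simp: \<eta>_def intro!: add_nonneg_pos)
  have \<eta>_lim: "\<eta> \<longlonglongrightarrow> 0"
  proof -
    have 1: "(\<lambda>n. \<gamma>n (k n)) \<longlonglongrightarrow> lim \<gamma>n"
      using filterlim_compose[OF \<gamma>n_convergent[unfolded convergent_LIMSEQ_iff] k_lim] .
    have 2: "(\<lambda>n. (1 / real d) ^ k n) \<longlonglongrightarrow> 0"
      using deg by (intro filterlim_compose[OF LIMSEQ_power_zero k_lim]) auto
    have "(\<lambda>n. \<bar>lim \<gamma>n - \<gamma>n (k n)\<bar> + ln (R + 1) * (1 / d) ^ k n + 1 / real (Suc n)) \<longlonglongrightarrow> \<bar>lim \<gamma>n - lim \<gamma>n\<bar> + ln (R + 1) * 0 + 0"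
      by (intro tendsto_intros 1 2 LIMSEQ_Suc[OF lim_const_over_n[of 1]])
    then show ?thesis by (simp add: \<eta>_def[abs_def])
  qed
  define E where "E n = {v. R \<le> norm (F (k n) v)}" for n
  have conv: "(\<lambda>n. cauchy_tr (N' n) (\<lambda>x. x) v) \<longlonglongrightarrow> cauchy_tr N X v" if v: "norm v > 4 * R" for v
  proof (rule cauchy_tr_convergence[where K="filled_julia f" and K'="\<lambda>n. S (k n)" and E=E and \<eta>=\<eta> and \<rho>=R])
    show "compact_rv N X (filled_julia f)" by (rule rv)
    show "compact_rv (N' n) (\<lambda>x. x) (S (k n))" for n
      by (rule rv') (auto intro: finite_imp_compact finite_S)
    show "filled_julia f \<subseteq> cball 0 R" using KL[of 0] by (simp add: L_0)
    show "S (k n) \<subseteq> cball 0 R" for n using SL[of n] L_antimono[of 0 "Suc m"] by (auto simp: L_0)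
    show "closed (E n)" for n
      unfolding E_def by (intro closed_Collect_le continuous_on_norm continuous_on_F continuous_on_const)
    have EU: "E n \<inter> U (k n) = {}" for n by (auto simp: E_def U_def)
    show "E n \<inter> filled_julia f = {}" for n using EU[of n] by (auto simp: filled_julia_eq_U)
    show "E n \<inter> S (k n) = {}" for n using EU[of n] S_subset_U[of "k n"] by blast
    show "- cball 0 R \<subseteq> E n" for n
    proof
      fix v :: complex assume "v \<in> - cball 0 R"
      then have "norm v > R" by simp
      from norm_gt_escapes[OF this, of "k n"] show "v \<in> E n" by (simp add: E_def)
    qed
    \<comment> \<open>Points of \<open>E n\<close> with \<open>norm (F (k n) v) > R\<close> are
      interior, so the potentials have to be compared on the level curve only.\<close>
    show "v \<in> interior (E n) \<or> log_pot N X v - log_pot (N' n) (\<lambda>x. x) v \<ge> - \<eta> n" if vE: "v \<in> E n" for n v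
    proof (cases "norm (F (k n) v) = R")
      case False
      have "open {v. R < norm (F (k n) v)}"
        by (intro open_Collect_less continuous_on_norm continuous_on_F continuous_on_const)
      then have "{v. R < norm (F (k n) v)} \<subseteq> interior (E n)"
        by (intro interior_maximal) (auto simp: E_def)
      then show ?thesis using vE False by (auto simp: E_def)
    next
      case True
      then have "v \<notin> U (k n)" by (simp add: U_def)
      then have vK: "v \<notin> filled_julia f" and vS: "v \<notin> S (k n)"
        using S_subset_U[of "k n"] by (auto simp: filled_julia_eq_U)
      have "norm (F (k n) v - a) \<le> R + 1" using norm_triangle_ineq4[of "F (k n) v" a] a1 True by linarith
      moreover have "norm (F (k n) v - a) > 0" using vS by (simp add: S_def)
      ultimately have "ln (norm (F (k n) v - a)) \<le> ln (R + 1)" by (intro ln_mono) auto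
      then have "ln (norm (F (k n) v - a)) / d ^ k n \<le> ln (R + 1) / d ^ k n" by (intro divide_right_mono) auto
      then have "log_pot (N' n) (\<lambda>x. x) v \<le> ln (R + 1) * (1 / d) ^ k n - \<gamma>n (k n)"
        by (simp add: int' mean_log_S[OF vS] power_one_over)
      moreover have "log_pot N X v \<ge> - lim \<gamma>n"
        using pot[OF vK] by (simp add: log_pot_def norm_minus_commute)
      moreover have "1 / real (Suc n) > 0" by simp
      ultimately have "log_pot N X v - log_pot (N' n) (\<lambda>x. x) v \<ge> - \<eta> n" unfolding \<eta>_def by linarith
      then show ?thesis ..
    qed
  qed (use R2 \<eta> \<eta>_lim v in auto)
  have mass: "measure (N' n) {w \<in> space (N' n). w \<in> A} \<le> \<beta>" for n
  proof -
    have "measure (N' n) {w \<in> space (N' n). w \<in> A} = card (S (k n) \<inter> A) / card (S (k n))"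
    proof -
      have eq: "{w \<in> space (N' n). w \<in> A} = S (k n) \<inter> A" unfolding sp by blast
      show ?thesis
        unfolding eq unfolding N'_def by (rule measure_uniform_count_measure[OF finite_S Int_lower1])
    qed
    also have "\<dots> \<le> card (S (k n) \<inter> V) / card (S (k n))"
      by (intro divide_right_mono of_nat_mono card_mono finite_S_Int) (auto simp: A_def)
    also have "\<dots> \<le> \<beta>"
      using card[of "k n"] d_pos[of "k n"] by (simp add: card_S k_def divide_le_eq del: power_add power_Suc)
    finally show ?thesis .
  qed
  have "measure N {w \<in> space N. X w \<in> A} \<le> \<beta>"
  proof (rule mass_le_of_cauchy_convergence[where N'=N' and X'="\<lambda>n x. x" and A=A and B=B and ?\<rho>0.0="4 * R"])
    show "compact_rv (N' n) (\<lambda>x. x) (A \<union> B)" for n unfolding AB by (rule rv'[OF compact_L SL])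
    show "connected (- (A \<union> B))" unfolding AB by (rule connected_compl_L)
  qed (use rvL comp AB conv mass in auto)
  moreover have "{w \<in> space N. X w \<in> A} = {w \<in> space N. X w \<in> V}"
    using X_in KL[of "Suc m"] by (auto simp: A_def)
  ultimately show ?thesis by simp
qed

end

section \<open>Components of the sublevel sets\<close>

context escaping_poly
begin

definition piece :: "nat \<Rightarrow> complex \<Rightarrow> complex set" where
  "piece n x = connected_component_set (U n) x"

lemma open_piece: "open (piece n x)"
  unfolding piece_def by (intro open_connected_component open_U)

lemma connected_piece: "connected (piece n x)"
  unfolding piece_def by (rule connected_connected_component)

lemma piece_subset: "piece n x \<subseteq> U n"
  unfolding piece_def by (rule connected_component_subset)

lemma piece_refl: "x \<in> U n \<Longrightarrow> x \<in> piece n x"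
  unfolding piece_def by simp

lemma piece_maximal: "connected T \<Longrightarrow> T \<subseteq> U n \<Longrightarrow> x \<in> T \<Longrightarrow> T \<subseteq> piece n x"
  unfolding piece_def by (rule connected_component_maximal)

lemma piece_eq: "y \<in> piece n x \<Longrightarrow> piece n y = piece n x"
  unfolding piece_def by (metis connected_component_eq)

lemma U_diff_piece: "U n - piece n x = (\<Union>y\<in>U n - piece n x. piece n y)"
proof (intro equalityI subsetI)
  fix z assume "z \<in> (\<Union>y\<in>U n - piece n x. piece n y)"
  then obtain y where y: "y \<in> U n" "y \<notin> piece n x" "z \<in> piece n y" by auto
  have eq: "piece n z = piece n y" using y(3) by (rule piece_eq)
  have "z \<notin> piece n x"
  proof
    assume "z \<in> piece n x"
    then have "piece n z = piece n x" by (rule piece_eq)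
    then show False using eq piece_refl[OF y(1)] y(2) by simp
  qed
  moreover have "z \<in> U n" using y(3) piece_subset by blast
  ultimately show "z \<in> U n - piece n x" by simp
qed (use piece_refl in auto)

lemma open_U_diff_piece: "open (U n - piece n x)"
  by (subst U_diff_piece) (intro open_UN ballI open_piece)

text \<open>On a loop in the component \<open>norm (F n u)\<close> has a maximum below
  \<open>R\<close>, which by the maximum modulus principle also bounds it inside the loop. Thus the
  inside belongs to the same component, and a point outside the component has winding number
  zero.\<close>

lemma simply_connected_piece: "simply_connected (piece n x)"
  unfolding simply_connected_eq_winding_number_zero[OF open_piece]
proof (intro conjI allI impI connected_piece)
  fix g z assume g: "path g \<and> path_image g \<subseteq> piece n x \<and> pathfinish g = pathstart g \<and> z \<notin> piece n x"
  show "winding_number g z = 0"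
  proof (rule ccontr)
    assume nz: "winding_number g z \<noteq> 0"
    define I where "I = inside (path_image g)"
    have cp: "compact (path_image g)" "path_image g \<noteq> {}" using g by (auto intro: compact_path_image)
    have "z \<notin> outside (path_image g)" using winding_number_zero_in_outside[of g z] nz g by blast
    moreover have "z \<notin> path_image g" using g by blast
    ultimately have zI: "z \<in> I" using inside_Un_outside[of "path_image g"] unfolding I_def by blast
    have sub: "path_image g \<subseteq> U n" using g piece_subset by blast
    obtain w where w: "w \<in> path_image g" "\<And>u. u \<in> path_image g \<Longrightarrow> norm (F n u) \<le> norm (F n w)"
      using continuous_attains_sup[OF cp, of "\<lambda>u. norm (F n u)"] continuous_on_norm[OF continuous_on_F] by metis
    have bI: "bounded I" unfolding I_def by (intro bounded_inside compact_imp_bounded cp)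
    have fr: "frontier I \<subseteq> path_image g" unfolding I_def by (intro frontier_inside_subset compact_imp_closed cp)
    have "norm (F n u) \<le> norm (F n w)" if "u \<in> I" for u
      by (rule maximum_modulus_frontier[of "F n" I])
         (use that bI fr w(2) in \<open>auto intro: holomorphic_F continuous_on_F\<close>)
    moreover have "norm (F n w) < R" using sub w(1) by (auto simp: U_def)
    ultimately have "I \<subseteq> U n" by (force simp: U_def)
    then have "path_image g \<union> I \<subseteq> U n" using sub by blast
    moreover have "connected (path_image g \<union> I)"
      unfolding I_def using g by (intro connected_with_inside compact_imp_closed cp connected_path_image) blast
    ultimately have "path_image g \<union> I \<subseteq> piece n w" using w(1) by (intro piece_maximal) auto
    moreover have "piece n w = piece n x" using w(1) g by (intro piece_eq) blast
    ultimately show False using zI g by blast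
  qed
qed

text \<open>
  \<open>V\<close> is a union of components of the preimage of \<open>Q\<close>; this makes the restriction of \<open>f\<close> to \<open>V\<close> a
  proper map to \<open>Q\<close>.
\<close>

definition clopen_over :: "complex set \<Rightarrow> complex set \<Rightarrow> bool" where
  "clopen_over Q V \<longleftrightarrow> open Q \<and> Q \<subseteq> ball 0 R \<and> open V \<and> V \<subseteq> poly f -` Q \<and> open (poly f -` Q - V)"

text \<open>Within the preimage of \<open>Q\<close> the complement of \<open>V\<close> is open, so
  the set is a closed preimage minus an open set; points mapped into the disc of radius
  \<open>R\<close> lie in that disc, which bounds it.\<close>

lemma compact_clopen_over:
  assumes "clopen_over Q V" "compact C" "C \<subseteq> Q"
  shows "compact (V \<inter> poly f -` C)"
proof -
  have "V \<inter> poly f -` C = poly f -` C - (poly f -` Q - V)"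
    using assms by (auto simp: clopen_over_def)
  moreover have "closed (poly f -` C)"
    using assms by (intro continuous_closed_vimage compact_imp_closed) auto
  moreover have "bounded (poly f -` C)"
  proof (rule bounded_subset[OF bounded_cball])
    have "z \<in> U (Suc 0)" if "z \<in> poly f -` C" for z
      using that assms by (auto simp: clopen_over_def U_def F_1)
    then show "poly f -` C \<subseteq> cball 0 R" using U_antimono[of 0 "Suc 0"] by (force simp: U_0)
  qed
  ultimately show ?thesis using assms
    by (simp add: clopen_over_def closed_Diff compact_eq_bounded_closed bounded_subset)
qed

lemma not_constant: "open S \<Longrightarrow> S \<noteq> {} \<Longrightarrow> \<not> poly f constant_on S"
proof
  assume S: "open S" "S \<noteq> {}" and "poly f constant_on S"
  then obtain c where c: "\<And>z. z \<in> S \<Longrightarrow> poly f z = c" by (auto simp: constant_on_def)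
  obtain x where "x \<in> S" using S by blast
  then obtain e where e: "e > 0" "ball x e \<subseteq> S" using S openE by blast
  have "S \<subseteq> {z. F (Suc 0) z = c}" using c by (auto simp: F_1)
  then have "finite S" by (rule finite_subset) (rule finite_fibre)
  then have "finite (ball x e)" by (rule finite_subset[OF e(2)])
  then show False using uncountable_ball[OF e(1), of x] by (simp add: countable_finite)
qed

lemma open_image:
  assumes "open V"
  shows "open (poly f ` V)"
proof -
  have "open (poly f ` (V \<inter> UNIV))"
    by (rule open_mapping_thm[of _ UNIV]) (use assms not_constant[of UNIV] in \<open>auto intro: holomorphic_intros\<close>)
  then show ?thesis by simp
qed

text \<open>The image is open by the open mapping theorem, and its complement in \<open>Q\<close> is
  open because preimages of small closed balls are compact. Connectedness of \<open>Q\<close> leaves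
  only the whole of \<open>Q\<close>.\<close>

lemma image_clopen_over:
  assumes co: "clopen_over Q V" and "connected Q" "V \<noteq> {}"
  shows "poly f ` V = Q"
proof -
  have Q: "open Q" "open V" "V \<subseteq> poly f -` Q" using co by (auto simp: clopen_over_def)
  have "open (Q - poly f ` V)"
  proof (subst open_contains_ball, intro ballI)
    fix y assume y: "y \<in> Q - poly f ` V"
    then obtain s where s: "s > 0" "cball y s \<subseteq> Q" using Q(1) open_contains_cball by blast
    have "compact (poly f ` (V \<inter> poly f -` cball y s))"
      by (intro compact_continuous_image compact_clopen_over[OF co] continuous_intros) (use s in auto)
    then have "open (ball y s - poly f ` (V \<inter> poly f -` cball y s))"
      by (intro open_Diff compact_imp_closed) auto
    moreover have "y \<in> ball y s - poly f ` (V \<inter> poly f -` cball y s)" using s y by auto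
    ultimately obtain e where e: "e > 0" "ball y e \<subseteq> ball y s - poly f ` (V \<inter> poly f -` cball y s)"
      by (rule openE)
    have "ball y e \<subseteq> Q - poly f ` V"
    proof
      fix x assume "x \<in> ball y e"
      then have "x \<in> ball y s" "x \<notin> poly f ` (V \<inter> poly f -` cball y s)" using e(2) by auto
      then show "x \<in> Q - poly f ` V" using s(2) by (auto simp: subset_iff)
    qed
    then show "\<exists>e>0. ball y e \<subseteq> Q - poly f ` V" using e(1) by blast
  qed
  moreover have "open (poly f ` V)" by (rule open_image) (rule Q)
  ultimately have "poly f ` V \<inter> Q = {} \<or> (Q - poly f ` V) \<inter> Q = {}"
    using connectedD[OF \<open>connected Q\<close>, of "poly f ` V" "Q - poly f ` V"] by blast
  then show ?thesis using Q(3) \<open>V \<noteq> {}\<close> by blast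
qed

text \<open>Without critical points \<open>f\<close> is locally injective, and a proper local
  homeomorphism is a covering: the finitely many points over \<open>y\<close> get disjoint balls,
  and by compactness all nearby preimages fall into these balls.\<close>

lemma covering_clopen_over:
  assumes co: "clopen_over Q V" and "connected Q" "V \<noteq> {}"
    and crit: "\<And>z. z \<in> V \<Longrightarrow> poly (pderiv f) z \<noteq> 0"
  shows "covering_space V (poly f) Q"
proof
  show "continuous_on V (poly f)" by (intro continuous_intros)
  show im: "poly f ` V = Q" by (rule image_clopen_over[OF co]) fact+
  have Q: "open Q" "open V" "V \<subseteq> poly f -` Q" using co by (auto simp: clopen_over_def)
  fix y assume y: "y \<in> Q"
  define X where "X = V \<inter> poly f -` {y}"
  have finX: "finite X" using finite_fibre[of "Suc 0" y] by (rule finite_subset[rotated]) (auto simp: X_def F_1)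
  have "\<exists>r>0. ball x r \<subseteq> V \<and> inj_on (poly f) (ball x r)" if x: "x \<in> X" for x
  proof -
    have "deriv (poly f) x \<noteq> 0"
      using crit[of x] x DERIV_imp_deriv[OF poly_DERIV[of f x]] by (simp add: X_def)
    moreover have "poly f holomorphic_on V" by (intro holomorphic_intros)
    moreover have "x \<in> V" using x by (simp add: X_def)
    ultimately show ?thesis
      using has_complex_derivative_locally_injective[of "poly f" V x] Q(2) by metis
  qed
  then obtain \<rho> where \<rho>: "\<And>x. x \<in> X \<Longrightarrow> \<rho> x > 0" "\<And>x. x \<in> X \<Longrightarrow> ball x (\<rho> x) \<subseteq> V"
    "\<And>x. x \<in> X \<Longrightarrow> inj_on (poly f) (ball x (\<rho> x))" by metis
  obtain \<delta> where \<delta>: "\<delta> > 0" "\<And>x x'. x \<in> X \<Longrightarrow> x' \<in> X \<Longrightarrow> x \<noteq> x' \<Longrightarrow> \<delta> \<le> dist x x'"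
  proof -
    \<comment> \<open>Inserting 1 gives the minimum a value when the fibre has a single point and
      there are no pairs.\<close>
    define \<delta> where "\<delta> = Min (insert 1 ((\<lambda>(x, x'). dist x x') ` (X \<times> X - Id)))"
    have fin: "finite ((\<lambda>(x, x'). dist x x') ` (X \<times> X - Id))" using finX by auto
    have "\<delta> > 0" unfolding \<delta>_def using fin by (subst Min_gr_iff) auto
    moreover have "\<delta> \<le> dist x x'" if "x \<in> X" "x' \<in> X" "x \<noteq> x'" for x x'
      unfolding \<delta>_def using that by (intro Min_le) (auto intro!: fin image_eqI[where x="(x, x')"])
    ultimately show ?thesis using that by blast
  qed
  define r where "r x = min (\<rho> x) (\<delta> / 2)" for x
  have r: "r x > 0" "ball x (r x) \<subseteq> V" "inj_on (poly f) (ball x (r x))" if "x \<in> X" for x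
    using \<rho>[OF that] \<delta>(1) by (auto simp: r_def intro: inj_on_subset subset_ball)
  have disj: "ball x (r x) \<inter> ball x' (r x') = {}" if "x \<in> X" "x' \<in> X" "x \<noteq> x'" for x x'
  proof -
    have "r x + r x' \<le> dist x x'" using \<delta>(2)[OF that] by (simp add: r_def)
    then show ?thesis by (rule disjoint_ballI)
  qed
  obtain s where s: "s > 0" "cball y s \<subseteq> Q" using Q(1) y open_contains_cball by blast
  define W where "W = V \<inter> poly f -` cball y s - (\<Union>x\<in>X. ball x (r x))"
  have "compact W" unfolding W_def by (intro compact_diff compact_clopen_over[OF co] open_UN) (use s in auto)
  then have cW: "closed (poly f ` W)" by (intro compact_imp_closed compact_continuous_image continuous_intros)
  \<comment> \<open>The evenly covered neighbourhood: it lies in the image of each ball, so every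
    ball maps onto it, and it avoids the image of \<open>W\<close>, so no preimage in
    \<open>V\<close> lies outside the balls.\<close>
  define T where "T = ball y s \<inter> (\<Inter>x\<in>X. poly f ` ball x (r x)) - poly f ` W"
  have oT: "open T"
    unfolding T_def by (intro open_Diff open_Int cW open_INT finX ballI open_image) auto
  have yT: "y \<in> T"
  proof -
    have "y \<in> poly f ` ball x (r x)" if "x \<in> X" for x
      using r(1)[OF that] that by (intro image_eqI[of _ _ x]) (auto simp: X_def)
    moreover have "y \<notin> poly f ` W"
    proof
      assume "y \<in> poly f ` W"
      then obtain z where z: "z \<in> W" "y = poly f z" by blast
      then have "z \<in> X" by (auto simp: W_def X_def)
      then show False using z(1) r(1)[of z] by (auto simp: W_def)
    qed
    ultimately show ?thesis using s by (auto simp: T_def)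
  qed
  have TQ: "T \<subseteq> Q" using s(2) ball_subset_cball[of y s] by (auto simp: T_def)
  define v where "v = (\<lambda>x. ball x (r x) \<inter> poly f -` T) ` X"
  show "\<exists>T. y \<in> T \<and> openin (top_of_set Q) T \<and>
          (\<exists>v. \<Union> v = V \<inter> poly f -` T \<and> (\<forall>u\<in>v. openin (top_of_set V) u) \<and> pairwise disjnt v \<and>
             (\<forall>u\<in>v. \<exists>q. homeomorphism u T (poly f) q))"
  proof (intro exI[of _ T] exI[of _ v] conjI ballI)
    show "y \<in> T" by (rule yT)
    show "openin (top_of_set Q) T" using oT TQ by (simp add: openin_open_eq Q(1))
    show "\<Union> v = V \<inter> poly f -` T"
    proof (intro equalityI subsetI)
      fix z assume "z \<in> \<Union> v"
      then obtain x where "x \<in> X" "z \<in> ball x (r x)" "poly f z \<in> T" by (auto simp: v_def)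
      then show "z \<in> V \<inter> poly f -` T" using r(2) by blast
    next
      fix z assume z: "z \<in> V \<inter> poly f -` T"
      then have "z \<notin> W" "poly f z \<in> cball y s" using ball_subset_cball[of y s] by (auto simp: T_def)
      then have "z \<in> (\<Union>x\<in>X. ball x (r x))" using z unfolding W_def by blast
      then show "z \<in> \<Union> v" using z by (auto simp: v_def)
    qed
    show "openin (top_of_set V) u" if "u \<in> v" for u
    proof -
      from that obtain x where x: "x \<in> X" "u = ball x (r x) \<inter> poly f -` T" by (auto simp: v_def)
      have "open u" unfolding x(2) by (intro open_Int open_ball open_vimage oT continuous_intros)
      moreover have "u \<subseteq> V" using r(2)[OF x(1)] x(2) by blast
      ultimately show ?thesis by (simp add: openin_open_eq Q(2))
    qed
    show "pairwise disjnt v"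
    proof (rule pairwiseI)
      fix u u' assume u: "u \<in> v" "u' \<in> v" "u \<noteq> u'"
      obtain x where x: "x \<in> X" "u = ball x (r x) \<inter> poly f -` T" using u(1) by (auto simp: v_def)
      obtain x' where x': "x' \<in> X" "u' = ball x' (r x') \<inter> poly f -` T" using u(2) by (auto simp: v_def)
      have "x \<noteq> x'" using x x' u(3) by auto
      then show "disjnt u u'" using disj[OF x(1) x'(1)] x(2) x'(2) by (auto simp only: disjnt_def)
    qed
    show "\<exists>q. homeomorphism u T (poly f) q" if "u \<in> v" for u
    proof -
      from that obtain x where x: "x \<in> X" "u = ball x (r x) \<inter> poly f -` T" by (auto simp: v_def)
      obtain g where g: "g holomorphic_on (poly f ` ball x (r x))" "\<And>z. z \<in> ball x (r x) \<Longrightarrow> g (poly f z) = z"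
        by (rule holomorphic_has_inverse[of "poly f" "ball x (r x)"]) (auto intro!: holomorphic_intros r(3) x(1))
      have Tsub: "T \<subseteq> poly f ` ball x (r x)" using x(1) by (auto simp: T_def)
      have fu: "poly f ` u = T" using Tsub unfolding x(2) by blast
      have "homeomorphism u T (poly f) g"
        unfolding homeomorphism_def
      proof (intro conjI ballI)
        show "continuous_on T g" using g(1) Tsub holomorphic_on_imp_continuous_on continuous_on_subset by blast
        show gf: "g (poly f z) = z" if "z \<in> u" for z using g(2) that x(2) by blast
        show "g ` T = u" unfolding fu[symmetric] using gf by (force simp: image_iff)
        show "poly f (g z) = z" if "z \<in> T" for z using that gf unfolding fu[symmetric] by force
      qed (use fu in \<open>auto intro: continuous_intros\<close>)
      then show ?thesis by blast
    qed
  qed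
qed

text \<open>Over a simply connected base the identity lifts to a section \<open>g\<close> through
  \<open>x1\<close>. Its image is open by invariance of domain and relatively closed as the set
  where \<open>g (poly f z) = z\<close>; hence it is all of the connected \<open>V\<close>, and
  \<open>g\<close> inverts \<open>f\<close> there.\<close>

lemma inj_on_clopen_over:
  assumes co: "clopen_over Q V" and Q: "simply_connected Q" and V: "connected V" "V \<noteq> {}"
    and crit: "\<And>z. z \<in> V \<Longrightarrow> poly (pderiv f) z \<noteq> 0"
  shows "inj_on (poly f) V"
proof (rule inj_onI)
  fix x1 x2 assume x: "x1 \<in> V" "x2 \<in> V" "poly f x1 = poly f x2"
  have oQ: "open Q" "V \<subseteq> poly f -` Q" using co by (auto simp: clopen_over_def)
  have cov: "covering_space V (poly f) Q"
    by (intro covering_clopen_over co V(2) crit simply_connected_imp_connected Q)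
  obtain g where g: "continuous_on Q g" "g \<in> Q \<rightarrow> V" "g (poly f x1) = x1" "\<And>y. y \<in> Q \<Longrightarrow> poly f (g y) = y"
  proof (rule covering_space_lift_strong[OF cov x(1) _ Q, of "poly f x1" "\<lambda>y. y"])
    show "poly f x1 \<in> Q" using x(1) oQ by auto
    show "locally path_connected Q" using oQ(1) by (rule open_imp_locally_path_connected)
  qed (auto simp: continuous_on_id)
  have gQ: "open (g ` Q)"
    by (rule invariance_of_domain[OF g(1) oQ(1)]) (metis g(4) inj_onI)
  have eq: "g ` Q = {z \<in> V. g (poly f z) = z}"
    using g oQ(2) by (auto simp: image_iff) (metis vimage_eq subsetD)
  have "continuous_on V (\<lambda>z. g (poly f z) - z)"
    by (intro continuous_intros continuous_on_compose2[OF g(1)]) (use oQ(2) in auto)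
  then have "openin (top_of_set V) (V \<inter> (\<lambda>z. g (poly f z) - z) -` (- {0}))"
    by (intro continuous_openin_preimage_gen) auto
  then have "open (V \<inter> (\<lambda>z. g (poly f z) - z) -` (- {0}))"
    using co by (metis clopen_over_def openin_open_trans)
  moreover have "V \<inter> (\<lambda>z. g (poly f z) - z) -` (- {0}) = V - g ` Q" unfolding eq by auto
  ultimately have "open (V - g ` Q)" by simp
  then have "g ` Q \<inter> V = {} \<or> (V - g ` Q) \<inter> V = {}"
    using connectedD[OF V(1) gQ, of "V - g ` Q"] by blast
  moreover have "x1 \<in> g ` Q" unfolding eq using x(1) g(3) by simp
  ultimately have "V \<subseteq> g ` Q" using x(1) by blast
  then have "g (poly f x2) = x2" using x(2) unfolding eq by blast
  then show "x1 = x2" using g(3) x(3) by simp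
qed

end

section \<open>Counting preimages in a component\<close>

context escaping_poly
begin

lemma poly_in_U: "poly f z \<in> U m \<longleftrightarrow> z \<in> U (Suc m)"
  by (simp add: U_def F_Suc')

lemma poly_vimage_U: "poly f -` U m = U (Suc m)"
  using poly_in_U by auto

lemma clopen_over_piece:
  assumes x: "x \<in> U (Suc m)"
  shows "clopen_over (piece m (poly f x)) (piece (Suc m) x)"
proof -
  have "poly f ` piece (Suc m) x \<subseteq> piece m (poly f x)"
  proof (rule piece_maximal)
    show "connected (poly f ` piece (Suc m) x)"
      by (intro connected_continuous_image connected_piece continuous_intros)
    show "poly f ` piece (Suc m) x \<subseteq> U m" using piece_subset[of "Suc m" x] poly_in_U by auto
    show "poly f x \<in> poly f ` piece (Suc m) x" using piece_refl[OF x] by simp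
  qed
  moreover have "poly f -` piece m (poly f x) - piece (Suc m) x =
      poly f -` piece m (poly f x) \<inter> (U (Suc m) - piece (Suc m) x)"
    using piece_subset[of m "poly f x"] poly_in_U by auto
  moreover have "open (poly f -` piece m (poly f x))"
    by (intro open_vimage open_piece continuous_intros)
  moreover have "piece m (poly f x) \<subseteq> ball 0 R"
    using piece_subset[of m "poly f x"] U_antimono[of 0 m] by (auto simp: U_0)
  ultimately show ?thesis
    unfolding clopen_over_def using open_piece open_U_diff_piece by (auto intro!: open_Int)
qed

lemma image_piece: "x \<in> U (Suc m) \<Longrightarrow> poly f ` piece (Suc m) x = piece m (poly f x)"
  using image_clopen_over[OF clopen_over_piece connected_piece] piece_refl by blast

lemma F_image_piece: "x \<in> U (m + n) \<Longrightarrow> F n ` piece (m + n) x = piece m (F n x)"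
proof (induction n arbitrary: x)
  case (Suc n)
  have fx: "poly f x \<in> U (m + n)" using Suc.prems poly_in_U by simp
  have "F (Suc n) ` piece (m + Suc n) x = F n ` (poly f ` piece (Suc (m + n)) x)"
    by (simp add: F_Suc' image_image)
  also have "\<dots> = piece m (F n (poly f x))" using Suc.IH[OF fx] image_piece[of x "m + n"] Suc.prems by simp
  finally show ?case by (simp add: F_Suc')
qed simp

lemma card_Int_fibre_le: "card ({z. F n z = y} \<inter> A) \<le> d ^ n"
  using card_mono[OF finite_fibre[of n y], of "{z. F n z = y} \<inter> A"] card_fibre_le[of n y] by simp

text \<open>Let \<open>V\<close> be the rest of \<open>U (Suc N0)\<close> next to the component of
  \<open>x\<close>. It is nonempty, so \<open>f\<close> maps it onto the connected set
  \<open>U N0\<close>. From level \<open>Suc N0\<close> on, every point therefore has a preimage in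
  \<open>V\<close>, outside the component of \<open>x\<close>, and each step multiplies the count by
  at most \<open>d - 1\<close>. Before that level the trivial factor \<open>d\<close> is
  used.\<close>

lemma card_fibre_piece:
  assumes N0: "\<not> connected (U (Suc N0))" "connected (U N0)" and x: "x \<in> U m"
  shows "card ({z. F m z = y} \<inter> piece m x) \<le> d ^ Suc N0 * (d - 1) ^ (m - Suc N0)"
  using x
proof (induction m arbitrary: x)
  case 0
  have "card ({z. F 0 z = y} \<inter> piece 0 x) \<le> 1" using card_Int_fibre_le[of 0 y] by simp
  also have "1 \<le> d ^ Suc N0" using d_pos[of "Suc N0"] by linarith
  finally show ?case by simp
next
  case (Suc m)
  show ?case
  proof (cases "Suc m \<le> Suc N0")
    case True
    have "card ({z. F (Suc m) z = y} \<inter> piece (Suc m) x) \<le> d ^ Suc m" by (rule card_Int_fibre_le)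
    also have "\<dots> \<le> d ^ Suc N0" using True deg by (intro power_increasing) auto
    finally show ?thesis using True by simp
  next
    case False
    then have m: "m \<ge> Suc N0" by simp
    have fx: "poly f x \<in> U m" using Suc.prems poly_in_U by simp
    have xN: "x \<in> U (Suc N0)" using U_antimono[of "Suc N0" "Suc m"] m Suc.prems by auto
    define V where "V = U (Suc N0) - piece (Suc N0) x"
    have "V \<noteq> {}"
    proof
      assume "V = {}"
      then have "U (Suc N0) = piece (Suc N0) x" using piece_subset[of "Suc N0" x] by (auto simp: V_def)
      then show False using N0(1) connected_piece[of "Suc N0" x] by simp
    qed
    have "clopen_over (U N0) V"
      unfolding clopen_over_def poly_vimage_U
    proof (intro conjI)
      show "U N0 \<subseteq> ball 0 R" using U_antimono[of 0 N0] by (simp add: U_0)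
      have "U (Suc N0) - V = piece (Suc N0) x" using piece_subset[of "Suc N0" x] by (auto simp: V_def)
      then show "open (U (Suc N0) - V)" using open_piece by simp
    qed (auto simp: V_def open_U intro: open_U_diff_piece)
    then have fV: "poly f ` V = U N0" by (rule image_clopen_over) fact+
    \<comment> \<open>Deeper components lie in the component of \<open>x\<close> at level
      \<open>Suc N0\<close>, so a single set \<open>V\<close> serves all later levels.\<close>
    have sub: "piece (Suc m) x \<inter> V = {}"
    proof -
      have "piece (Suc m) x \<subseteq> piece (Suc N0) x"
        using piece_subset[of "Suc m" x] U_antimono[of "Suc N0" "Suc m"] m piece_refl[OF Suc.prems]
        by (intro piece_maximal connected_piece) auto
      then show ?thesis by (auto simp: V_def)
    qed
    have fib: "card ({z. poly f z = u} \<inter> piece (Suc m) x) \<le> d - 1" if u: "u \<in> U m" for u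
    proof -
      have "u \<in> U N0" using u U_antimono[of N0 m] m by auto
      then have "u \<in> poly f ` V" using fV by simp
      then obtain z' where "u = poly f z'" "z' \<in> V" by (rule imageE)
      then have z': "z' \<in> V" "poly f z' = u" by simp_all
      have fin: "finite {z. poly f z = u}" and c: "card {z. poly f z = u} \<le> d"
        using finite_fibre[of "Suc 0" u] card_fibre_le[of "Suc 0" u] by (simp_all add: F_1)
      have "{z. poly f z = u} \<inter> piece (Suc m) x \<subseteq> {z. poly f z = u} - {z'}" using sub z'(1) by blast
      then have "card ({z. poly f z = u} \<inter> piece (Suc m) x) \<le> card ({z. poly f z = u} - {z'})"
        using fin by (intro card_mono) auto
      also have "\<dots> = card {z. poly f z = u} - 1" using z'(2) fin by (intro card_Diff_singleton) auto
      finally show ?thesis using c by linarith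
    qed
    have "{z. F (Suc m) z = y} \<inter> piece (Suc m) x \<subseteq>
        (\<Union>u\<in>{u. F m u = y} \<inter> piece m (poly f x). {z. poly f z = u} \<inter> piece (Suc m) x)"
      using image_piece[OF Suc.prems] by (auto simp: F_Suc')
    then have "card ({z. F (Suc m) z = y} \<inter> piece (Suc m) x) \<le>
        card (\<Union>u\<in>{u. F m u = y} \<inter> piece m (poly f x). {z. poly f z = u} \<inter> piece (Suc m) x)"
      using finite_fibre[of "Suc 0"] by (intro card_mono finite_UN_I finite_Int disjI1 finite_fibre) (auto simp: F_1)
    also have "\<dots> \<le> (d ^ Suc N0 * (d - 1) ^ (m - Suc N0)) * (d - 1)"
    proof (rule card_UN_le_bound)
      show "finite ({u. F m u = y} \<inter> piece m (poly f x))" by (intro finite_Int disjI1 finite_fibre)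
      show "card ({u. F m u = y} \<inter> piece m (poly f x)) \<le> d ^ Suc N0 * (d - 1) ^ (m - Suc N0)"
        by (rule Suc.IH[OF fx])
      show "card ({z. poly f z = u} \<inter> piece (Suc m) x) \<le> d - 1" if "u \<in> {u. F m u = y} \<inter> piece m (poly f x)" for u
        using that piece_subset[of m "poly f x"] by (intro fib) auto
    qed
    also have "\<dots> = d ^ Suc N0 * (d - 1) ^ (Suc m - Suc N0)"
    proof -
      have "Suc m - Suc N0 = Suc (m - Suc N0)" using m by linarith
      then show ?thesis by (simp only: power_Suc2 mult.assoc)
    qed
    finally show ?thesis .
  qed
qed

text \<open>The components that contain a critical point: only there can \<^term>\<open>poly f\<close> fail to be injective.\<close>

definition Bad :: "nat \<Rightarrow> complex set" where
  "Bad m = (\<Union>c\<in>{c. poly (pderiv f) c = 0} \<inter> U m. piece m c)"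

lemma crit_finite: "finite {c. poly (pderiv f) c = 0}" and crit_card: "card {c. poly (pderiv f) c = 0} \<le> d - 1"
proof -
  have "pderiv f \<noteq> 0" using deg by (simp add: pderiv_eq_0_iff)
  then show "finite {c. poly (pderiv f) c = 0}" "card {c. poly (pderiv f) c = 0} \<le> d - 1"
    using poly_roots_finite[of "pderiv f"] card_poly_roots_bound[of "pderiv f"] by (simp_all add: degree_pderiv)
qed

lemma Bad_subset: "Bad m \<subseteq> U m"
  using piece_subset by (auto simp: Bad_def)

lemma open_Bad: "open (Bad m)"
  unfolding Bad_def by (intro open_UN ballI open_piece)

lemma open_U_diff_Bad: "open (U m - Bad m)"
proof -
  have "U m - Bad m = U m \<inter> (\<Inter>c\<in>{c. poly (pderiv f) c = 0} \<inter> U m. U m - piece m c)"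
    by (auto simp: Bad_def)
  moreover have "open (\<Inter>c\<in>{c. poly (pderiv f) c = 0} \<inter> U m. U m - piece m c)"
    using crit_finite by (intro open_INT finite_Int disjI1 ballI open_U_diff_piece)
  ultimately show ?thesis by (simp only: open_Int open_U)
qed

text \<open>The iterate is a composition of maps between successive components. The target of each
  is simply connected and the source has no critical point, so \<open>inj_on_clopen_over\<close>
  applies at every step.\<close>

lemma inj_on_piece:
  assumes "z \<in> U n" "k \<le> n" "\<And>j. j < k \<Longrightarrow> F j z \<notin> Bad (n - j)"
  shows "inj_on (F k) (piece n z)"
  using assms
proof (induction k arbitrary: z n)
  case 0
  then show ?case by (simp add: inj_on_def)
next
  case (Suc k)
  then obtain m where n: "n = Suc m" by (cases n) auto
  have z: "z \<in> U (Suc m)" using Suc.prems n by simp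
  have fz: "poly f z \<in> U m" using z poly_in_U by simp
  have "inj_on (poly f) (piece (Suc m) z)"
  proof (rule inj_on_clopen_over[OF clopen_over_piece[OF z] simply_connected_piece connected_piece])
    show "piece (Suc m) z \<noteq> {}" using piece_refl[OF z] by blast
    fix c assume c: "c \<in> piece (Suc m) z"
    show "poly (pderiv f) c \<noteq> 0"
    proof
      assume "poly (pderiv f) c = 0"
      moreover have "c \<in> U (Suc m)" using c piece_subset by blast
      moreover have "z \<in> piece (Suc m) c" using piece_eq[OF c] piece_refl[OF z] by simp
      ultimately have "z \<in> Bad (Suc m)" unfolding Bad_def by blast
      then show False using Suc.prems(3)[of 0] n by simp
    qed
  qed
  moreover have "inj_on (F k) (piece m (poly f z))"
  proof (rule Suc.IH[OF fz])
    show "k \<le> m" using Suc.prems n by simp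
    fix j assume "j < k"
    then show "F j (poly f z) \<notin> Bad (m - j)" using Suc.prems(3)[of "Suc j"] n by (simp add: F_Suc')
  qed
  ultimately have "inj_on (F k \<circ> poly f) (piece (Suc m) z)"
    by (intro comp_inj_on) (simp_all add: image_piece[OF z])
  moreover have "F k \<circ> poly f = F (Suc k)" by (rule ext) (simp add: F_Suc')
  ultimately show ?case by (simp add: n)
qed

end

section \<open>Mass of the components with critical points\<close>

context generic_escaping_poly
begin

text \<open>With \<open>l = n - (m + j)\<close> a point of the set is reached in three stages: a
  point of \<open>S l\<close>, one of its preimages under \<open>F m\<close> in
  \<open>Bad m\<close>, and a preimage of that under \<open>F j\<close>. The factors
  \<open>d ^ l\<close> and \<open>d ^ j\<close> combine to \<open>d ^ (n - m)\<close>, so relative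
  to \<open>d ^ n\<close> the bound does not depend on \<open>j\<close>.\<close>

lemma card_S_Bad:
  assumes N0: "\<not> connected (U (Suc N0))" "connected (U N0)" and n: "n > m + j"
  shows "card (S n \<inter> {z. F j z \<in> Bad m}) \<le> (d - 1) * (d ^ Suc N0 * (d - 1) ^ (m - Suc N0)) * d ^ (n - m)"
proof -
  define \<kappa> where "\<kappa> = d ^ Suc N0 * (d - 1) ^ (m - Suc N0)"
  define l where "l = n - (m + j)"
  have nl: "n = l + (m + j)" using n by (simp add: l_def)
  have BadC: "card ({u. F m u = y} \<inter> Bad m) \<le> (d - 1) * \<kappa>" for y
  proof -
    have "{u. F m u = y} \<inter> Bad m = (\<Union>c\<in>{c. poly (pderiv f) c = 0} \<inter> U m. {u. F m u = y} \<inter> piece m c)"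
      by (auto simp: Bad_def)
    also have "card \<dots> \<le> (d - 1) * \<kappa>"
    proof (rule card_UN_le_bound)
      show "finite ({c. poly (pderiv f) c = 0} \<inter> U m)" using crit_finite by simp
      have "card ({c. poly (pderiv f) c = 0} \<inter> U m) \<le> card {c. poly (pderiv f) c = 0}"
        by (intro card_mono crit_finite) auto
      then show "card ({c. poly (pderiv f) c = 0} \<inter> U m) \<le> d - 1" using crit_card by linarith
      show "card ({u. F m u = y} \<inter> piece m c) \<le> \<kappa>" if "c \<in> {c. poly (pderiv f) c = 0} \<inter> U m" for c
        unfolding \<kappa>_def using that by (intro card_fibre_piece N0) auto
    qed
    finally show ?thesis .
  qed
  have fin1: "finite ({u. F m u = y} \<inter> Bad m)" for y by (intro finite_Int disjI1 finite_fibre)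
  have c2: "card (\<Union>y\<in>S l. {u. F m u = y} \<inter> Bad m) \<le> d ^ l * ((d - 1) * \<kappa>)"
    by (rule card_UN_le_bound[OF finite_S _ BadC]) (simp add: card_S)
  have fin2: "finite (\<Union>y\<in>S l. {u. F m u = y} \<inter> Bad m)" by (intro finite_UN_I finite_S fin1)
  have "S n \<inter> {z. F j z \<in> Bad m} \<subseteq> (\<Union>u\<in>(\<Union>y\<in>S l. {u. F m u = y} \<inter> Bad m). {z. F j z = u})"
    by (auto simp: S_def nl F_add)
  then have "card (S n \<inter> {z. F j z \<in> Bad m}) \<le> card (\<Union>u\<in>(\<Union>y\<in>S l. {u. F m u = y} \<inter> Bad m). {z. F j z = u})"
    using fin2 finite_fibre by (intro card_mono) auto
  also have "\<dots> \<le> (d ^ l * ((d - 1) * \<kappa>)) * d ^ j"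
    by (rule card_UN_le_bound[OF fin2 c2 card_fibre_le])
  also have "\<dots> = (d - 1) * \<kappa> * d ^ (n - m)" by (simp add: nl power_add mult_ac)
  finally show ?thesis by (simp add: \<kappa>_def)
qed

text \<open>The count of \<open>card_S_Bad\<close> as a proportion of the \<open>d ^ n\<close>
  points of \<open>S n\<close>.\<close>

definition bad_mass :: "nat \<Rightarrow> nat \<Rightarrow> real" where
  "bad_mass N0 m = real ((d - 1) * (d ^ Suc N0 * (d - 1) ^ (m - Suc N0))) / d ^ m"

lemma bad_mass_nonneg: "bad_mass N0 m \<ge> 0"
  by (simp add: bad_mass_def)

lemma summable_bad_mass: "summable (bad_mass N0)"
proof -
  \<comment> \<open>After the shift the truncated subtraction in the exponent is exact, and the
    terms are geometric with ratio (d - 1) / d < 1.\<close>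
  have "bad_mass N0 (m + Suc N0) = real (d - 1) * (real (d - 1) / d) ^ m" for m
  proof -
    have gen: "p * (q ^ k * p ^ m) / q ^ (m + k) = p * (p / q) ^ m" if "q \<noteq> 0" for p q :: real and k
      using that by (simp add: power_add power_divide)
    have "bad_mass N0 (m + Suc N0) = real (d - 1) * (real d ^ Suc N0 * real (d - 1) ^ m) / real d ^ (m + Suc N0)"
      unfolding bad_mass_def by (simp add: power_add)
    also have "\<dots> = real (d - 1) * (real (d - 1) / d) ^ m"
      by (rule gen) (use deg in simp)
    finally show ?thesis .
  qed
  moreover have "summable (\<lambda>m. real (d - 1) * (real (d - 1) / d) ^ m)"
    using deg by (intro summable_mult summable_geometric) auto
  ultimately have "summable (\<lambda>m. bad_mass N0 (m + Suc N0))" by (simp only:)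
  then show ?thesis by (rule summable_iff_shift[THEN iffD1])
qed

text \<open>Preimages of clopen parts are clopen: the set where \<open>F j\<close> lands in
  \<open>Bad m\<close> is such a part of \<open>U (m + j)\<close>, so the count of preimages bounds
  its mass.\<close>

lemma mass_Bad_le:
  assumes N0: "\<not> connected (U (Suc N0))" "connected (U N0)"
    and rv: "compact_rv N X (filled_julia f)"
    and pot: "\<And>v. v \<notin> filled_julia f \<Longrightarrow> (\<integral>w. ln (norm (X w - v)) \<partial>N) \<ge> - lim \<gamma>n"
  shows "measure N {w \<in> space N. F j (X w) \<in> Bad m} \<le> bad_mass N0 m"
proof -
  define V where "V = F j -` Bad m"
  have "measure N {w \<in> space N. X w \<in> V} \<le> bad_mass N0 m"
  proof (rule clopen_mass_le[OF rv pot, of V "m + j"])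
    show "open V" unfolding V_def by (intro open_vimage open_Bad continuous_on_F)
    show "V \<subseteq> U (m + j)" using Bad_subset[of m] by (auto simp: V_def U_preimage)
    have "U (m + j) - V = F j -` (U m - Bad m)" by (auto simp: V_def U_preimage)
    then show "open (U (m + j) - V)" by (simp add: open_vimage open_U_diff_Bad continuous_on_F)
    fix n assume n: "n > m + j"
    have "card (S n \<inter> V) \<le> (d - 1) * (d ^ Suc N0 * (d - 1) ^ (m - Suc N0)) * d ^ (n - m)"
      using card_S_Bad[OF N0 n] by (simp add: V_def vimage_def)
    then have "real (card (S n \<inter> V)) \<le> real ((d - 1) * (d ^ Suc N0 * (d - 1) ^ (m - Suc N0)) * d ^ (n - m))"
      by (rule of_nat_mono)
    also have "\<dots> = real ((d - 1) * (d ^ Suc N0 * (d - 1) ^ (m - Suc N0))) * real (d ^ (n - m))" by (rule of_nat_mult)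
    also have "real (d ^ (n - m)) = real d ^ n / real d ^ m"
    proof -
      have "real d ^ (n - m) * real d ^ m = real d ^ n" using n by (simp flip: power_add)
      moreover have "real d ^ m \<noteq> 0" using deg by simp
      ultimately show ?thesis by (simp add: nonzero_eq_divide_eq)
    qed
    finally show "real (card (S n \<inter> V)) \<le> bad_mass N0 m * d ^ n" by (simp add: bad_mass_def)
  qed
  then show ?thesis by (simp add: V_def)
qed

text \<open>For fixed \<open>s\<close> and any \<open>n\<close>, injectivity of
  \<open>F (n - s)\<close> can fail only if the orbit visits a bad component at some level between
  \<open>s + 1\<close> and \<open>n\<close>. The union bound gives a tail of \<open>bad_mass\<close>
  beyond \<open>s\<close>, uniform in \<open>n\<close>. So failure for all large \<open>n\<close>
  has at most this probability, and failure for every \<open>s\<close> has probability zero.\<close>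

lemma AE_univalent_infinitely_often:
  assumes N0: "\<not> connected (U (Suc N0))" "connected (U N0)"
    and rv: "compact_rv N X (filled_julia f)"
    and pot: "\<And>v. v \<notin> filled_julia f \<Longrightarrow> (\<integral>w. ln (norm (X w - v)) \<partial>N) \<ge> - lim \<gamma>n"
  shows "AE w in N. \<exists>s. \<exists>\<^sub>\<infinity>n. s < n \<and> inj_on (F (n - s)) (piece n (X w))"
proof -
  interpret compact_rv N X "filled_julia f" by fact
  define A where "A m j = {w \<in> space N. F j (X w) \<in> Bad m}" for m j
  define D where "D s n = (\<Union>j<n - s. A (n - j) j)" for s n
  \<comment> \<open>The event that the good behaviour fails for all large levels;
    \<open>Suc (s + n)\<close> runs through the levels above \<open>s\<close>.\<close>
  define E where "E s = (\<Union>k. \<Inter>n\<in>{k..}. D s (Suc (s + n)))" for s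
  have A: "A m j \<in> sets N" for m j
  proof -
    have "(\<lambda>w. F j (X w)) \<in> borel_measurable N"
      by (rule measurable_compose[OF X_meas borel_measurable_continuous_onI[OF continuous_on_F]])
    from measurable_sets[OF this, of "Bad m"] open_Bad[of m] show ?thesis
      by (simp add: A_def vimage_def Int_def conj_commute)
  qed
  have D: "D s n \<in> sets N" for s n unfolding D_def using A by auto
  have mD: "measure N (D s n) \<le> (\<Sum>m. bad_mass N0 (m + Suc s))" for s n
  proof -
    have "measure N (D s n) \<le> (\<Sum>j<n - s. measure N (A (n - j) j))"
      unfolding D_def using A by (intro finite_measure_subadditive_finite) auto
    also have "\<dots> \<le> (\<Sum>j<n - s. bad_mass N0 (n - j))"
      unfolding A_def by (intro sum_mono mass_Bad_le[OF N0 rv pot])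
    \<comment> \<open>For \<open>j < n - s\<close> the level \<open>n - j\<close> takes each of the
      values s + 1, ..., n once.\<close>
    also have "\<dots> = (\<Sum>m<n - s. bad_mass N0 (m + Suc s))"
    proof (rule sum.reindex_bij_witness[of _ "\<lambda>m. n - Suc s - m" "\<lambda>j. n - Suc s - j"])
      fix j assume "j \<in> {..<n - s}"
      then have "n - Suc s - j + Suc s = n - j" by auto
      then show "bad_mass N0 (n - Suc s - j + Suc s) = bad_mass N0 (n - j)" by (simp only:)
    qed auto
    also have "\<dots> \<le> (\<Sum>m. bad_mass N0 (m + Suc s))"
      using summable_bad_mass by (intro sum_le_suminf summable_ignore_initial_segment) (auto intro: bad_mass_nonneg)
    finally show ?thesis .
  qed
  have E: "E s \<in> sets N" for s unfolding E_def using D by auto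
  have mE: "measure N (E s) \<le> (\<Sum>m. bad_mass N0 (m + Suc s))" for s
  proof (rule LIMSEQ_le_const2)
    have "incseq (\<lambda>k. \<Inter>n\<in>{k..}. D s (Suc (s + n)))" by (force simp: incseq_def)
    then show "(\<lambda>k. measure N (\<Inter>n\<in>{k..}. D s (Suc (s + n)))) \<longlonglongrightarrow> measure N (E s)"
      unfolding E_def using D by (intro finite_Lim_measure_incseq) auto
    have "measure N (\<Inter>n\<in>{k..}. D s (Suc (s + n))) \<le> measure N (D s (Suc (s + k)))" for k
      using D by (intro finite_measure_mono) auto
    then show "\<exists>K. \<forall>k\<ge>K. measure N (\<Inter>n\<in>{k..}. D s (Suc (s + n))) \<le> (\<Sum>m. bad_mass N0 (m + Suc s))"
      using mD order_trans by blast
  qed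
  have "measure N (\<Inter>s. E s) \<le> 0"
  proof (rule LIMSEQ_le_const)
    show "(\<lambda>s. \<Sum>m. bad_mass N0 (m + Suc s)) \<longlonglongrightarrow> 0"
      using LIMSEQ_Suc[OF suminf_exist_split2[OF summable_bad_mass]] by simp
    have "measure N (\<Inter>s. E s) \<le> measure N (E s)" for s
      using E by (intro finite_measure_mono) auto
    then show "\<exists>K. \<forall>s\<ge>K. measure N (\<Inter>s. E s) \<le> (\<Sum>m. bad_mass N0 (m + Suc s))"
      using mE order_trans by blast
  qed
  then have "emeasure N (\<Inter>s. E s) = 0" by (simp add: emeasure_eq_measure measure_le_0_iff)
  moreover have "(\<Inter>s. E s) \<in> sets N" using E by auto
  ultimately have "(\<Inter>s. E s) \<in> null_sets N" by (simp add: null_sets_def)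
  then show ?thesis
  proof (rule AE_I')
    show "{w \<in> space N. \<not> (\<exists>s. \<exists>\<^sub>\<infinity>n. s < n \<and> inj_on (F (n - s)) (piece n (X w)))} \<subseteq> (\<Inter>s. E s)"
    proof
      fix w assume w: "w \<in> {w \<in> space N. \<not> (\<exists>s. \<exists>\<^sub>\<infinity>n. s < n \<and> inj_on (F (n - s)) (piece n (X w)))}"
      have "w \<in> E s" for s
      proof -
        have "\<not> (\<exists>\<^sub>\<infinity>n. s < n \<and> inj_on (F (n - s)) (piece n (X w)))" using w by blast
        then obtain k where k: "\<And>n. n > k \<Longrightarrow> \<not> (s < n \<and> inj_on (F (n - s)) (piece n (X w)))"
          unfolding INFM_nat by blast
        have "w \<in> D s (Suc (s + n))" if "n \<ge> k" for n
        proof (rule ccontr)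
          assume notD: "w \<notin> D s (Suc (s + n))"
          have "inj_on (F (Suc (s + n) - s)) (piece (Suc (s + n)) (X w))"
          proof (rule inj_on_piece)
            show "X w \<in> U (Suc (s + n))" using X_in[of w] w by (auto simp: filled_julia_eq_U)
            fix j assume "j < Suc (s + n) - s"
            then show "F j (X w) \<notin> Bad (Suc (s + n) - j)" using notD w by (auto simp: D_def A_def)
          qed simp
          then show False using k[of "Suc (s + n)"] that by simp
        qed
        then show "w \<in> E s" unfolding E_def by blast
      qed
      then show "w \<in> (\<Inter>s. E s)" by blast
    qed
  qed
qed

end

section \<open>Point components\<close>

context escaping_poly
begin

lemma F_filled_julia: "x \<in> filled_julia f \<Longrightarrow> F m x \<in> filled_julia f"
  by (auto simp: filled_julia_eq_U U_def simp flip: F_add)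

lemma component_singleton:
  assumes z: "z \<in> frontier (filled_julia f)"
    and inf: "\<exists>\<^sub>\<infinity>n. s < n \<and> inj_on (F (n - s)) (piece n z)"
  shows "connected_component_set (filled_julia f) z = {z}"
proof -
  define K where "K = filled_julia f"
  have cK: "compact K" unfolding K_def by (rule compact_filled_julia)
  have zK: "z \<in> K" using z frontier_subset_closed[OF compact_imp_closed[OF cK]] by (auto simp: K_def)
  have KU: "K \<subseteq> U n" for n by (auto simp: K_def filled_julia_eq_U)
  define I where "I = {n. s < n \<and> inj_on (F (n - s)) (piece n z)}"
  have "infinite I" using inf by (simp add: I_def INFM_iff_infinite)
  define e where "e = enumerate I"
  have e: "strict_mono e" "\<And>i. e i \<in> I" using \<open>infinite I\<close> by (auto simp: e_def strict_mono_enumerate enumerate_in_set)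
  define y where "y i = F (e i - s) z" for i
  have yK: "\<forall>i. y i \<in> K" using F_filled_julia zK by (simp add: y_def K_def)
  have "seq_compact K" using cK by (simp add: compact_eq_seq_compact_metric)
  then obtain l r1 where l: "l \<in> K" "strict_mono (r1 :: nat \<Rightarrow> nat)" "(y \<circ> r1) \<longlonglongrightarrow> l"
    using yK by (rule seq_compactE)
  \<comment> \<open>The images \<open>F (n - s) z\<close> stay in the compact set \<open>K\<close>,
    so along a subsequence they lie in a single component of \<open>U s\<close>. It serves as the
    common domain of the inverse branches \<open>h i\<close>.\<close>
  define Q where "Q = piece s l"
  have lQ: "l \<in> Q" unfolding Q_def using l(1) KU by (intro piece_refl) auto
  have oQ: "open Q" "connected Q" by (simp_all add: Q_def open_piece connected_piece)
  have "eventually (\<lambda>i. (y \<circ> r1) i \<in> Q) sequentially"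
    using l(3) oQ(1) lQ by (rule topological_tendstoD)
  then obtain i0 where i0: "\<And>i. i \<ge> i0 \<Longrightarrow> y (r1 i) \<in> Q" by (auto simp: eventually_sequentially)
  define n where "n i = e (r1 (i + i0))" for i
  define u where "u i = y (r1 (i + i0))" for i
  have n_mono: "strict_mono n" using e(1) l(2) by (simp add: n_def strict_mono_def)
  have n: "s < n i" "inj_on (F (n i - s)) (piece (n i) z)" for i using e(2) by (auto simp: n_def I_def)
  have u_eq: "u i = F (n i - s) z" for i by (simp add: u_def n_def y_def)
  have uQ: "u i \<in> Q" for i using i0 by (simp add: u_def)
  have u_lim: "u \<longlonglongrightarrow> l" using LIMSEQ_ignore_initial_segment[OF l(3), of i0] by (simp add: u_def[abs_def])
  have image: "F (n i - s) ` piece (n i) z = Q" for i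
  proof -
    have "F (n i - s) ` piece (s + (n i - s)) z = piece s (F (n i - s) z)"
      by (rule F_image_piece) (use zK KU in auto)
    moreover have "piece s (u i) = Q" unfolding Q_def by (rule piece_eq) (use uQ in \<open>simp add: Q_def\<close>)
    ultimately show ?thesis using n(1)[of i] by (simp add: u_eq)
  qed
  have "\<exists>g. g holomorphic_on Q \<and> (\<forall>x\<in>piece (n i) z. g (F (n i - s) x) = x)" for i
  proof -
    obtain g where "g holomorphic_on (F (n i - s) ` piece (n i) z)"
      "\<And>x. x \<in> piece (n i) z \<Longrightarrow> g (F (n i - s) x) = x"
      by (rule holomorphic_has_inverse[OF holomorphic_F open_piece n(2)]) blast
    then show ?thesis by (auto simp: image)
  qed
  then obtain h where h: "\<And>i. h i holomorphic_on Q" "\<And>i x. x \<in> piece (n i) z \<Longrightarrow> h i (F (n i - s) x) = x" by metis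
  have h_in: "h i x \<in> piece (n i) z" if x: "x \<in> Q" for i x
  proof -
    have "x \<in> F (n i - s) ` piece (n i) z" using x image by simp
    then obtain p where "x = F (n i - s) p" "p \<in> piece (n i) z" by (rule imageE)
    then show ?thesis using h(2) by simp
  qed
  have h_bound: "norm (h i x) \<le> R" if "x \<in> Q" for i x
    using h_in[OF that, of i] piece_subset[of "n i" z] U_antimono[of 0 "n i"] by (auto simp: U_0 subset_iff intro!: less_imp_le)
  obtain g r where g: "g holomorphic_on Q" "strict_mono (r :: nat \<Rightarrow> nat)"
    "\<And>K. compact K \<Longrightarrow> K \<subseteq> Q \<Longrightarrow> uniform_limit K (h \<circ> r) g sequentially"
  proof (rule Montel[OF oQ(1), of "{k. k holomorphic_on Q \<and> (\<forall>x\<in>Q. norm (k x) \<le> R)}" h])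
    show "\<exists>B. \<forall>k\<in>{k. k holomorphic_on Q \<and> (\<forall>x\<in>Q. norm (k x) \<le> R)}. \<forall>x\<in>K. norm (k x) \<le> B" if "K \<subseteq> Q" for K
      using that by (intro exI[of _ R]) auto
    show "range h \<subseteq> {k. k holomorphic_on Q \<and> (\<forall>x\<in>Q. norm (k x) \<le> R)}" using h(1) h_bound by auto
  qed auto
  have r_lim: "(\<lambda>k. u (r k)) \<longlonglongrightarrow> l" using LIMSEQ_subseq_LIMSEQ[OF u_lim g(2)] by (simp add: o_def)
  \<comment> \<open>Each branch sends \<open>u i\<close> to \<open>z\<close>, and
    \<open>u (r k)\<close> tends to \<open>l\<close>; uniform convergence near \<open>l\<close>
    carries this over to the limit. The index shift by \<open>k0\<close> keeps the arguments in a
    closed disc inside \<open>Q\<close>.\<close>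
  have gl: "g l = z"
  proof -
    obtain \<epsilon> where \<epsilon>: "\<epsilon> > 0" "cball l \<epsilon> \<subseteq> Q" using oQ(1) lQ open_contains_cball by blast
    have "eventually (\<lambda>k. u (r k) \<in> cball l \<epsilon>) sequentially"
      using tendstoD[OF r_lim \<epsilon>(1)] by eventually_elim (simp add: dist_commute)
    then obtain k0 where k0: "\<And>k. k \<ge> k0 \<Longrightarrow> u (r k) \<in> cball l \<epsilon>" by (auto simp: eventually_sequentially)
    have ul: "uniform_limit (cball l \<epsilon>) (\<lambda>k. h (r (k + k0))) g sequentially"
      using filterlim_compose[OF g(3)[OF compact_cball \<epsilon>(2), unfolded o_def] filterlim_add_const_nat_at_top, of k0] .
    have d0: "(\<lambda>k. dist (h (r (k + k0)) (u (r (k + k0)))) (g (u (r (k + k0))))) \<longlonglongrightarrow> 0"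
      by (rule uniform_limit_dist[OF ul]) (use k0 in auto)
    have "h (r (k + k0)) (u (r (k + k0))) = z" for k
      unfolding u_eq by (rule h(2)) (use zK KU in \<open>auto intro: piece_refl\<close>)
    then have "(\<lambda>k. dist z (g (u (r (k + k0))))) \<longlonglongrightarrow> 0" using d0 by simp
    moreover have "(\<lambda>k. dist z (g (u (r (k + k0))))) \<longlonglongrightarrow> dist z (g l)"
    proof (intro tendsto_dist tendsto_const)
      have "isCont g l" using g(1) oQ(1) lQ holomorphic_on_imp_continuous_on continuous_on_eq_continuous_at by blast
      then show "(\<lambda>k. g (u (r (k + k0)))) \<longlonglongrightarrow> g l"
        by (rule isCont_tendsto_compose) (rule LIMSEQ_ignore_initial_segment[OF r_lim])
    qed
    ultimately show ?thesis using LIMSEQ_unique by fastforce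
  qed
  have ne: "- U (n i) \<noteq> {}" for i
  proof -
    have "of_real (2 * R) \<notin> U (n i)" using U_antimono[of 0 "n i"] R2 by (auto simp: U_0)
    then show ?thesis by blast
  qed
  \<comment> \<open>Values omitted by the branches, which map into \<open>U (n i)\<close>. Choosing
    them nearest to \<open>z\<close> makes them converge to \<open>z\<close>: points outside
    \<open>K\<close> lie arbitrarily near the frontier point \<open>z\<close>, and each of them is
    outside \<open>U (n i)\<close> for large \<open>i\<close>.\<close>
  have "\<exists>\<zeta>. \<zeta> \<in> - U (n i) \<and> infdist z (- U (n i)) = dist z \<zeta>" for i
    using infdist_attains_inf[of "- U (n i)" z] ne[of i] open_U[of "n i"] by (metis closed_Compl)
  then obtain \<zeta> where \<zeta>: "\<And>i. \<zeta> i \<notin> U (n i)" "\<And>i. infdist z (- U (n i)) = dist z (\<zeta> i)" by (metis ComplD)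
  have \<zeta>_lim: "\<zeta> \<longlonglongrightarrow> z"
  proof (rule tendstoI)
    fix \<epsilon> :: real assume "\<epsilon> > 0"
    have "z \<in> closure (- K)" using z by (simp add: frontier_closures K_def)
    then obtain p where p: "p \<in> - K" "dist p z < \<epsilon>" using \<open>\<epsilon> > 0\<close> closure_approachable by blast
    then obtain N where N: "p \<notin> U N" by (auto simp: K_def filled_julia_eq_U)
    have "dist (\<zeta> i) z < \<epsilon>" if "i \<ge> N" for i
    proof -
      have "N \<le> n i" using that strict_mono_imp_increasing[OF n_mono, of i] by simp
      then have "p \<in> - U (n i)" using N U_antimono[of N "n i"] by auto
      then have "infdist z (- U (n i)) \<le> dist z p" by (rule infdist_le)
      then show ?thesis using p(2) \<zeta>(2)[of i] by (simp add: dist_commute)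
    qed
    then show "eventually (\<lambda>i. dist (\<zeta> i) z < \<epsilon>) sequentially" by (auto simp: eventually_sequentially)
  qed
  have const: "g x = z" if x: "x \<in> Q" for x
  proof -
    have "(\<lambda>x. g x - z) constant_on Q"
    proof (rule ccontr)
      assume nc: "\<not> (\<lambda>x. g x - z) constant_on Q"
      \<comment> \<open>By Hurwitz' theorem a nonconstant limit of the zero-free functions
        \<open>h (r k) x - \<zeta> (r k)\<close> would be zero-free, against
        \<open>g l = z\<close>.\<close>
      have "g l - z \<noteq> 0"
      proof (rule Hurwitz_no_zeros[OF oQ, of "\<lambda>k x. h (r k) x - \<zeta> (r k)" "\<lambda>x. g x - z"])
        show "(\<lambda>x. h (r k) x - \<zeta> (r k)) holomorphic_on Q" for k by (intro holomorphic_intros h)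
        show "(\<lambda>x. g x - z) holomorphic_on Q" by (intro holomorphic_intros g)
        show "uniform_limit K' (\<lambda>k x. h (r k) x - \<zeta> (r k)) (\<lambda>x. g x - z) sequentially" if K': "compact K'" "K' \<subseteq> Q" for K'
        proof (rule uniform_limitI)
          fix \<epsilon> :: real assume "\<epsilon> > 0"
          then have e2: "\<epsilon> / 2 > 0" by simp
          have "eventually (\<lambda>k. \<forall>x\<in>K'. dist (h (r k) x) (g x) < \<epsilon> / 2) sequentially"
            using uniform_limitD[OF g(3)[OF K'] e2] by simp
          moreover have "eventually (\<lambda>k. dist (\<zeta> (r k)) z < \<epsilon> / 2) sequentially"
            using tendstoD[OF LIMSEQ_subseq_LIMSEQ[OF \<zeta>_lim g(2)] e2] by simp
          ultimately show "eventually (\<lambda>k. \<forall>x\<in>K'. dist (h (r k) x - \<zeta> (r k)) (g x - z) < \<epsilon>) sequentially"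
          proof eventually_elim
            case (elim k)
            show ?case
            proof
              fix x assume "x \<in> K'"
              then have "dist (h (r k) x) (g x) < \<epsilon> / 2" using elim by blast
              moreover have "dist (h (r k) x - \<zeta> (r k)) (g x - z) \<le> dist (h (r k) x) (g x) + dist (\<zeta> (r k)) z"
                using norm_triangle_ineq4[of "h (r k) x - g x" "\<zeta> (r k) - z"] by (simp add: dist_norm algebra_simps)
              ultimately show "dist (h (r k) x - \<zeta> (r k)) (g x - z) < \<epsilon>" using elim by linarith
            qed
          qed
        qed
        show "h (r k) x - \<zeta> (r k) \<noteq> 0" if "x \<in> Q" for k x
          using h_in[OF that, of "r k"] piece_subset[of "n (r k)" z] \<zeta>(1)[of "r k"] by auto
      qed (use nc lQ in auto)
      then show False using gl by simp
    qed
    then obtain c where "\<And>x. x \<in> Q \<Longrightarrow> g x - z = c" by (auto simp: constant_on_def)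
    from this[OF x] this[OF lQ] show ?thesis using gl by simp
  qed
  have "x = z" if x: "x \<in> connected_component_set K z" for x
  proof -
    have xK: "x \<in> K" using x connected_component_subset by blast
    have xp: "x \<in> piece (n i) z" for i
    proof -
      have "connected_component_set K z \<subseteq> piece (n i) z"
        using connected_component_subset[of K z] KU[of "n i"] zK
        by (intro piece_maximal connected_connected_component) auto
      then show ?thesis using x by blast
    qed
    \<comment> \<open>\<open>Q\<close> is closed relative to \<open>U s\<close>, which contains
      \<open>K\<close>. Compactness makes the convergence to the constant \<open>z\<close> uniform
      at the moving points \<open>v k\<close>, and every one of them is sent back to
      \<open>x\<close> by its branch.\<close>
    have cKQ: "compact (K \<inter> Q)"
    proof -
      have "K \<inter> Q = K - (U s - Q)" using KU[of s] by auto
      then show ?thesis using cK open_U_diff_piece[of s l] by (simp add: Q_def compact_diff)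
    qed
    define v where "v k = F (n (r k) - s) x" for k
    have v: "v k \<in> K \<inter> Q" for k
      using F_filled_julia xK image[of "r k"] xp[of "r k"] by (auto simp: v_def K_def)
    have "(\<lambda>k. dist ((h \<circ> r) k (v k)) (g (v k))) \<longlonglongrightarrow> 0"
      by (rule uniform_limit_dist[OF g(3)[OF cKQ]]) (use v in auto)
    moreover have "dist ((h \<circ> r) k (v k)) (g (v k)) = dist x z" for k
      using const[of "v k"] v[of k] h(2)[OF xp] by (simp add: v_def)
    ultimately have "(\<lambda>k::nat. dist x z) \<longlonglongrightarrow> 0" by simp
    then show ?thesis by (simp add: LIMSEQ_const_iff)
  qed
  then show ?thesis using zK by (auto simp: K_def)
qed

text \<open>If all \<open>U n\<close> were connected, the filled Julia set would be a nested
  intersection of compact connected sets; its complement is a union of connected sets with a common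
  point. The frontier of a connected set with connected complement is connected, contrary to the
  assumption. As \<open>U 0\<close> is a disc, some connected level is followed by a disconnected
  one.\<close>

lemma exists_disconnection_level:
  assumes "\<not> connected (julia f)"
  obtains N0 where "\<not> connected (U (Suc N0))" "connected (U N0)"
proof -
  have "\<exists>n. \<not> connected (U n)"
  proof (rule ccontr)
    assume "\<not> ?thesis"
    then have conn: "connected (U n)" for n by blast
    have cl: "closure (U n) \<subseteq> L n" for n by (intro closure_minimal U_subset_L closed_L)
    have "connected (\<Inter>n. closure (U n))"
    proof (rule connected_nest)
      show "compact (closure (U n))" for n
        using cl[of n] compact_L[of n] by (meson bounded_subset closed_closure compact_eq_bounded_closed)
      show "connected (closure (U n))" for n by (rule connected_imp_connected_closure[OF conn])
      show "closure (U n) \<subseteq> closure (U m)" if "m \<le> n" for m n using U_antimono[OF that] by (rule closure_mono)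
    qed
    moreover have "(\<Inter>n. closure (U n)) = filled_julia f"
    proof
      show "(\<Inter>n. closure (U n)) \<subseteq> filled_julia f" unfolding filled_julia_eq using cl by blast
      show "filled_julia f \<subseteq> (\<Inter>n. closure (U n))" unfolding filled_julia_eq_U using closure_subset by blast
    qed
    ultimately have cK: "connected (filled_julia f)" by simp
    have "connected (\<Union> (range (\<lambda>n. - L n)))"
    proof (rule connected_Union)
      have "of_real (2 * R) \<in> - L n" for n using L_antimono[of 0 n] R2 by (auto simp: L_0)
      then show "\<Inter> (range (\<lambda>n. - L n)) \<noteq> {}" by blast
    qed (auto intro: connected_compl_L)
    moreover have "\<Union> (range (\<lambda>n. - L n)) = - filled_julia f" by (auto simp: filled_julia_eq)
    ultimately have "connected (- filled_julia f)" by simp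
    with cK have "connected (julia f)" unfolding julia_def by (rule connected_frontier_simple)
    with assms show False by simp
  qed
  then obtain n where n: "\<not> connected (U n)" by blast
  show ?thesis
  proof (rule ccontr)
    assume neg: "\<not> thesis"
    have "connected (U m)" for m
    proof (induction m)
      case 0
      show ?case by (simp add: U_0)
    next
      case (Suc m)
      then show ?case using that[of m] neg by blast
    qed
    with n show False by blast
  qed
qed

end

text \<open>In a compact set a one-point component has arbitrarily small clopen neighbourhoods, and
  conversely a component lies in every clopen set that meets it. So the set is a countable
  intersection of relatively open sets \<open>W k\<close>. Its measurability is used to evaluate the
  harmonic measure as an image measure.\<close>

lemma point_components_borel:
  assumes K: "compact K"
  shows "point_components K \<in> sets borel"
proof -
  define small where "small k C \<longleftrightarrow> openin (top_of_set K) C \<and> closedin (top_of_set K) C \<and>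
     (\<forall>x\<in>C. \<forall>y\<in>C. dist x y \<le> 1 / real (Suc k))" for k C
  define W where "W k = \<Union> (Collect (small k))" for k
  have W: "W k \<in> sets borel" for k
  proof -
    have "openin (top_of_set K) (W k)" unfolding W_def by (intro openin_Union) (auto simp: small_def)
    then obtain T where "open T" "W k = K \<inter> T" by (auto simp: openin_open)
    moreover have "K \<in> sets borel" using K by (rule borel_compact)
    ultimately show ?thesis by (metis borel_open sets.Int)
  qed
  have "point_components K = K \<inter> (\<Inter>k. W k)"
  proof (intro equalityI subsetI)
    fix z assume "z \<in> point_components K"
    then have z: "z \<in> K" "connected_component_set K z = {z}" by (auto simp: point_components_def)
    have comp: "{z} \<in> components K" using z by (metis componentsI)
    have "z \<in> W k" for k
    proof -
      have zb: "{z} \<subseteq> ball z (1 / (2 * real (Suc k)))" by simp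
      obtain C where C: "openin (top_of_set K) C" "compact C" "{z} \<subseteq> C" "C \<subseteq> ball z (1 / (2 * real (Suc k)))"
        by (rule Sura_Bura_clopen_subset[OF closed_imp_locally_compact[OF compact_imp_closed[OF K]] comp _ open_ball zb]) simp_all
      have "closedin (top_of_set K) C"
        using C(1,2) openin_imp_subset by (intro closed_subset compact_imp_closed) auto
      moreover have "dist x y \<le> 1 / real (Suc k)" if "x \<in> C" "y \<in> C" for x y
      proof -
        have "dist z x < 1 / (2 * real (Suc k))" "dist z y < 1 / (2 * real (Suc k))" using C(4) that by auto
        then have "dist x y < 1 / (2 * real (Suc k)) + 1 / (2 * real (Suc k))"
          using dist_triangle3[of x y z] by linarith
        also have "\<dots> = 1 / real (Suc k)" by (simp add: field_simps)
        finally show ?thesis by simp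
      qed
      ultimately have "small k C" using C(1) by (simp add: small_def)
      then show ?thesis using C(3) unfolding W_def by blast
    qed
    then show "z \<in> K \<inter> (\<Inter>k. W k)" using z by blast
  next
    fix z assume z: "z \<in> K \<inter> (\<Inter>k. W k)"
    have "x = z" if x: "x \<in> connected_component_set K z" for x
    proof -
      have "dist x z \<le> 1 / real (Suc k)" for k
      proof -
        obtain C where C: "small k C" "z \<in> C" using z unfolding W_def by blast
        have "connected_component_set K z \<subseteq> C"
        proof -
          have "C = {} \<or> C \<inter> connected_component_set K z = connected_component_set K z \<or> C \<inter> connected_component_set K z = {}"
          proof -
            let ?L = "connected_component_set K z"
            have sub: "?L \<subseteq> K" by (rule connected_component_subset)
            obtain T T' where T: "open T" "C = K \<inter> T" "closed T'" "C = K \<inter> T'"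
              using C(1) by (auto simp: small_def openin_open closedin_closed)
            have "?L \<inter> C = ?L \<inter> T" "?L \<inter> C = ?L \<inter> T'" using sub T(2,4) by auto
            then have "openin (top_of_set ?L) (?L \<inter> C)" "closedin (top_of_set ?L) (?L \<inter> C)"
              using T(1,3) by (metis openin_open, metis closedin_closed)
            then show ?thesis using connected_clopen[of ?L] by (auto simp: Int_commute)
          qed
          moreover have "z \<in> connected_component_set K z" using z by simp
          ultimately show ?thesis using C(2) by blast
        qed
        then show ?thesis using C x by (auto simp: small_def)
      qed
      then have "dist x z \<le> 0"
        by (intro LIMSEQ_le_const[OF LIMSEQ_Suc[OF lim_const_over_n[of 1]]]) auto
      then show ?thesis by simp
    qed
    then show "z \<in> point_components K" using z by (auto simp: point_components_def)
  qed
  moreover have "(\<Inter>k. W k) \<in> sets borel" using W by auto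
  moreover have "K \<in> sets borel" using K by (rule borel_compact)
  ultimately show ?thesis by (simp only: sets.Int)
qed

theorem theoremA:
  fixes f :: "complex poly"
    and M :: "'w measure"
    and Z :: "real \<Rightarrow> 'w \<Rightarrow> complex \<times> real"
  assumes "degree f \<ge> 2"
    and "\<not> connected (julia f)"
    and "brownian_motion_from_infinity M Z"
  shows "(AE w in M. enters Z (filled_julia f) w \<and>
            first_entry_point Z (filled_julia f) w \<in> point_components (filled_julia f)) \<and>
         emeasure (harmonic_measure M Z (filled_julia f)) (point_components (filled_julia f)) = 1"
proof -
  obtain R where R: "R \<ge> 2" "\<And>z. norm z \<ge> R \<Longrightarrow> norm (poly f z) \<ge> 2 * norm z"
    by (rule exists_escape_radius[OF assms(1)]) blast
  interpret escaping_poly f R by unfold_locales (use assms(1) R in auto)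
  obtain a where a: "norm a < 1" "\<And>n z. F n z = a \<Longrightarrow> poly (pderiv (iter_poly f n)) z \<noteq> 0"
    by (rule exists_generic_point) blast
  have gen: "generic_escaping_poly f R a" by unfold_locales (use a in auto)
  interpret generic_escaping_poly f R a by (rule gen)
  interpret sphere_brownian M Z by unfold_locales (rule assms(3))
  define K where "K = filled_julia f"
  obtain k0 where k0: "k0 \<in> filled_julia f" using filled_julia_nonempty by blast
  \<comment> \<open>The default value \<open>k0\<close> makes \<open>X\<close> take values in
    \<open>K\<close> on all paths, as \<open>compact_rv\<close> demands; it is used only on a null
    set of paths.\<close>
  define X where "X w = (if enters Z K w then first_entry_point Z K w else k0)" for w
  note entry = filled_julia_entry[OF gen k0, folded K_def, folded X_def]
  have rv: "compact_rv M X (filled_julia f)"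
    using entry(3,4) compact_filled_julia prob_space_axioms
    by (auto simp: compact_rv_def compact_rv_axioms_def K_def X_def[abs_def])
  obtain N0 where N0: "\<not> connected (U (Suc N0))" "connected (U N0)"
    by (rule exists_disconnection_level[OF assms(2)]) blast
  have pot: "- lim \<gamma>n \<le> (\<integral>w. ln (norm (X w - v)) \<partial>M)" if "v \<notin> filled_julia f" for v
    using entry(6)[of v] that by (simp add: K_def X_def)
  have univ: "AE w in M. \<exists>s. \<exists>\<^sub>\<infinity>n. s < n \<and> inj_on (F (n - s)) (piece n (X w))"
    by (rule AE_univalent_infinitely_often[OF N0 rv]) (rule pot)
  have "AE w in M. enters Z K w \<and> first_entry_point Z K w \<in> point_components K"
    using entry(2) univ AE_space
  proof eventually_elim
    case (elim w)
    then have X: "X w = first_entry_point Z K w" by (simp add: X_def)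
    have fr: "X w \<in> frontier K" using entry(5)[of w] elim by (simp add: X_def)
    have "X w \<in> K" using entry(4)[of w] elim by (simp add: X_def)
    moreover have "connected_component_set K (X w) = {X w}"
      using elim component_singleton fr unfolding K_def by blast
    ultimately show ?case using X elim by (simp add: point_components_def)
  qed
  moreover have "emeasure (harmonic_measure M Z K) (point_components K) = 1"
  proof -
    define E where "E = {w \<in> space M. enters Z K w}"
    have E: "E \<in> sets M" using entry(1) by (simp add: E_def)
    have pcB: "point_components K \<in> sets borel" using compact_filled_julia by (auto simp: K_def intro: point_components_borel)
    have spE: "space (restrict_space M E) = E" using E sets.sets_into_space by (auto simp: space_restrict_space)
    have XM: "X \<in> borel_measurable M" using entry(3) by (simp add: X_def[abs_def])
    \<comment> \<open>The entry point is meaningful only for paths that enter \<open>K\<close>; on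
      that event it coincides with the measurable map \<open>X\<close>.\<close>
    have fep: "first_entry_point Z K \<in> measurable (restrict_space M E) borel"
    proof (subst measurable_cong)
      show "first_entry_point Z K w = X w" if "w \<in> space (restrict_space M E)" for w
        using that unfolding spE by (simp add: E_def X_def)
      show "X \<in> measurable (restrict_space M E) borel" by (rule measurable_restrict_space1[OF XM])
    qed
    have "emeasure (harmonic_measure M Z K) (point_components K) =
        emeasure (restrict_space M E) (first_entry_point Z K -` point_components K \<inter> E)"
      unfolding harmonic_measure_def E_def[symmetric] using emeasure_distr[OF fep pcB] by (simp add: spE)
    also have "\<dots> = emeasure M (first_entry_point Z K -` point_components K \<inter> E)"
      using E by (intro emeasure_restrict_space) (auto simp: Int_absorb2 sets.sets_into_space)
    also have "first_entry_point Z K -` point_components K \<inter> E =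
        {w \<in> space M. enters Z K w \<and> first_entry_point Z K w \<in> point_components K}"
      by (auto simp: E_def)
    also have "emeasure M \<dots> = 1"
    proof (rule emeasure_eq_1_AE)
      have "{w \<in> space M. enters Z K w \<and> first_entry_point Z K w \<in> point_components K} = E \<inter> (X -` point_components K \<inter> space M)"
      proof -
        have "enters Z K w \<Longrightarrow> X w = first_entry_point Z K w" for w by (simp add: X_def)
        then show ?thesis unfolding E_def by auto
      qed
      then show "{w \<in> space M. enters Z K w \<and> first_entry_point Z K w \<in> point_components K} \<in> sets M"
        using E measurable_sets[OF XM pcB] by auto
      show "AE w in M. w \<in> {w \<in> space M. enters Z K w \<and> first_entry_point Z K w \<in> point_components K}"
        using calculation AE_space \<open>AE w in M. enters Z K w \<and> first_entry_point Z K w \<in> point_components K\<close>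
        by (auto elim: eventually_elim2)
    qed
    finally show ?thesis .
  qed
  ultimately show ?thesis by (simp add: K_def)
qed

end
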